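(* Let $V$ be a vector space over a field $\mathbb{K}$ and let $*$ be a bilinear product on $V$, extended to $T(V)$ as described in the context. Define a product $\circledast$ on $T(V)$ by $$\forall f,g\in T(V),\quad f\circledast g=\sum \left(f*g^{(1)}\right) g^{(2)}.$$ Then $(T(V),\circledast,\Delta_{sh})$ is a Hopf algebra.
   Context: $T(V)=\bigoplus_{n\ge 0}V^{\otimes n}$ is the tensor algebra with concatenation product (written by juxtaposition) and unit $1$. $\Delta_{sh}$ is the cocommutative deshuffling coproduct, the algebra morphism (for concatenation) with $\Delta_{sh}(x)=x\otimes 1+1\otimes x$ for $x\in V$, with counit $\varepsilon$ ($\varepsilon(1)=1$, $\varepsilon(V^{\otimes n})=0$ for $n\geq 1$). Sweedler notation: $\Delta_{sh}(h)=\sum h^{(1)}\otimes h^{(2)}$. Extension of $*$: a bilinear product $*$ on $V$ extends uniquely to a bilinear map $T(V)\otimes T(V)\to T(V)$ such that for all $f,g,h\in T(V)$, $x,y\in V$: $f*1=f$; $1*f=\varepsilon(f)1$; $x*(fy)=(x*f)*y-x*(f*y)$; $(fg)*h=\sum (f*h^{(1)})(g*h^{(2)})$. *)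

theory Defs
  imports "HOL-Algebra.Module" "HOL-Algebra.QuotRing"
begin

section \<open>Linear algebra over a commutative ring\<close>

definition linear_map ::
  "('k, 'r) ring_scheme \<Rightarrow> ('k, 'a, 'm) module_scheme \<Rightarrow> ('k, 'b, 'n) module_scheme \<Rightarrow> ('a \<Rightarrow> 'b) set"
  where "linear_map K M N =
    {h \<in> carrier M \<rightarrow> carrier N.
      (\<forall>x\<in>carrier M. \<forall>y\<in>carrier M. h (x \<oplus>\<^bsub>M\<^esub> y) = h x \<oplus>\<^bsub>N\<^esub> h y) \<and>
      (\<forall>c\<in>carrier K. \<forall>x\<in>carrier M. h (c \<odot>\<^bsub>M\<^esub> x) = c \<odot>\<^bsub>N\<^esub> h x)}"

definition bilinear_map ::
  "('k, 'r) ring_scheme \<Rightarrow> ('k, 'a, 'm) module_scheme \<Rightarrow> ('k, 'b, 'n) module_scheme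
    \<Rightarrow> ('k, 'c, 'p) module_scheme \<Rightarrow> ('a \<Rightarrow> 'b \<Rightarrow> 'c) \<Rightarrow> bool"
  where "bilinear_map K M N P \<beta> \<longleftrightarrow>
    (\<forall>x\<in>carrier M. \<beta> x \<in> linear_map K N P) \<and>
    (\<forall>y\<in>carrier N. (\<lambda>x. \<beta> x y) \<in> linear_map K M P)"

definition base_module :: "('k, 'r) ring_scheme \<Rightarrow> ('k, 'k) module"
  where "base_module K =
    \<lparr>carrier = carrier K, mult = mult K, one = one K, zero = zero K, add = add K, smult = mult K\<rparr>"

definition generated_submodule ::
  "('k, 'r) ring_scheme \<Rightarrow> ('k, 'a, 'm) module_scheme \<Rightarrow> 'a set \<Rightarrow> 'a set"
  where "generated_submodule K M S = \<Inter>{N. submodule N K M \<and> S \<subseteq> N}"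

text \<open>The multiplication and unit of the quotient are meaningful only if \<open>M\<close> is an algebra
  and \<open>N\<close> a two-sided ideal.\<close>

definition quotient_module ::
  "('k, 'a, 'm) module_scheme \<Rightarrow> 'a set \<Rightarrow> ('k, 'a set) module"
  where "quotient_module M N =
    \<lparr>carrier = a_rcosets\<^bsub>M\<^esub> N, mult = rcoset_mult M N, one = N +>\<^bsub>M\<^esub> \<one>\<^bsub>M\<^esub>,
     zero = N, add = set_add M, smult = (\<lambda>c X. \<Union>x\<in>X. N +>\<^bsub>M\<^esub> (c \<odot>\<^bsub>M\<^esub> x))\<rparr>"

text \<open>The free module on \<open>X\<close>: functions with finite support contained in \<open>X\<close>. The ring fields
  \<^const>\<open>mult\<close> and \<^const>\<open>one\<close> of the record are irrelevant here.\<close>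

definition free_module :: "('k, 'r) ring_scheme \<Rightarrow> 'x set \<Rightarrow> ('k, 'x \<Rightarrow> 'k) module"
  where "free_module K X =
    \<lparr>carrier = {f. (\<forall>x. f x \<in> carrier K) \<and> finite {x. f x \<noteq> \<zero>\<^bsub>K\<^esub>} \<and> {x. f x \<noteq> \<zero>\<^bsub>K\<^esub>} \<subseteq> X},
     mult = undefined, one = undefined,
     zero = (\<lambda>_. \<zero>\<^bsub>K\<^esub>), add = (\<lambda>f g x. f x \<oplus>\<^bsub>K\<^esub> g x), smult = (\<lambda>c f x. c \<otimes>\<^bsub>K\<^esub> f x)\<rparr>"

definition free_gen :: "('k, 'r) ring_scheme \<Rightarrow> 'x \<Rightarrow> 'x \<Rightarrow> 'k"
  where "free_gen K x = (\<lambda>y. if y = x then \<one>\<^bsub>K\<^esub> else \<zero>\<^bsub>K\<^esub>)"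

definition free_lift ::
  "('k, 'r) ring_scheme \<Rightarrow> ('k, 'a, 'm) module_scheme \<Rightarrow> ('x \<Rightarrow> 'a) \<Rightarrow> ('x \<Rightarrow> 'k) \<Rightarrow> 'a"
  where "free_lift K M \<phi> f = (\<Oplus>\<^bsub>M\<^esub>x\<in>{x. f x \<noteq> \<zero>\<^bsub>K\<^esub>}. f x \<odot>\<^bsub>M\<^esub> \<phi> x)"


section \<open>Tensor products\<close>

definition tensor_relations ::
  "('k, 'r) ring_scheme \<Rightarrow> ('k, 'a, 'm) module_scheme \<Rightarrow> ('k, 'b, 'n) module_scheme
    \<Rightarrow> ('a \<times> 'b \<Rightarrow> 'k) set"
  where "tensor_relations K M N =
    (let F = free_module K (carrier M \<times> carrier N) in
      {free_gen K (c \<odot>\<^bsub>M\<^esub> x \<oplus>\<^bsub>M\<^esub> d \<odot>\<^bsub>M\<^esub> x', y)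
          \<ominus>\<^bsub>F\<^esub> (c \<odot>\<^bsub>F\<^esub> free_gen K (x, y) \<oplus>\<^bsub>F\<^esub> d \<odot>\<^bsub>F\<^esub> free_gen K (x', y)) | c d x x' y.
        c \<in> carrier K \<and> d \<in> carrier K \<and> x \<in> carrier M \<and> x' \<in> carrier M \<and> y \<in> carrier N} \<union>
      {free_gen K (x, c \<odot>\<^bsub>N\<^esub> y \<oplus>\<^bsub>N\<^esub> d \<odot>\<^bsub>N\<^esub> y')
          \<ominus>\<^bsub>F\<^esub> (c \<odot>\<^bsub>F\<^esub> free_gen K (x, y) \<oplus>\<^bsub>F\<^esub> d \<odot>\<^bsub>F\<^esub> free_gen K (x, y')) | c d x y y'.
        c \<in> carrier K \<and> d \<in> carrier K \<and> x \<in> carrier M \<and> y \<in> carrier N \<and> y' \<in> carrier N})"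

definition tensor_null ::
  "('k, 'r) ring_scheme \<Rightarrow> ('k, 'a, 'm) module_scheme \<Rightarrow> ('k, 'b, 'n) module_scheme
    \<Rightarrow> ('a \<times> 'b \<Rightarrow> 'k) set"
  where "tensor_null K M N =
    generated_submodule K (free_module K (carrier M \<times> carrier N)) (tensor_relations K M N)"

definition pure_tensor ::
  "('k, 'r) ring_scheme \<Rightarrow> ('k, 'a, 'm) module_scheme \<Rightarrow> ('k, 'b, 'n) module_scheme
    \<Rightarrow> 'a \<Rightarrow> 'b \<Rightarrow> ('a \<times> 'b \<Rightarrow> 'k) set"
  where "pure_tensor K M N x y =
    tensor_null K M N +>\<^bsub>free_module K (carrier M \<times> carrier N)\<^esub> free_gen K (x, y)"

text \<open>The linear map on a tensor product induced by a bilinear map \<open>\<beta>\<close> into \<open>P\<close>: the linear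
  extension of \<open>\<beta>\<close> to the free module is constant on cosets. With \<open>X = \<Delta> h\<close> this renders
  Sweedler notation: \<open>tensor_lift K P \<beta> (\<Delta> h)\<close> is the sum of the \<open>\<beta> h\<^sub>1 h\<^sub>2\<close> for
  \<open>\<Delta> h\<close> the sum of the \<open>h\<^sub>1 \<otimes> h\<^sub>2\<close>.\<close>

definition tensor_lift ::
  "('k, 'r) ring_scheme \<Rightarrow> ('k, 'c, 'p) module_scheme \<Rightarrow> ('a \<Rightarrow> 'b \<Rightarrow> 'c) \<Rightarrow> ('a \<times> 'b \<Rightarrow> 'k) set \<Rightarrow> 'c"
  where "tensor_lift K P \<beta> X = the_elem (free_lift K P (\<lambda>(x, y). \<beta> x y) ` X)"

text \<open>For algebras the multiplication is \<open>(x \<otimes> y) (x' \<otimes> y') = x x' \<otimes> y y'\<close>; the fields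
  \<^const>\<open>mult\<close> and \<^const>\<open>one\<close> are irrelevant when \<open>M\<close> and \<open>N\<close> are only modules.\<close>

definition tensor_product ::
  "('k, 'r) ring_scheme \<Rightarrow> ('k, 'a, 'm) module_scheme \<Rightarrow> ('k, 'b, 'n) module_scheme
    \<Rightarrow> ('k, ('a \<times> 'b \<Rightarrow> 'k) set) module"
  where "tensor_product K M N =
    (let Q = quotient_module (free_module K (carrier M \<times> carrier N)) (tensor_null K M N) in
      Q\<lparr>mult := (\<lambda>X Y. tensor_lift K Q (\<lambda>x y. tensor_lift K Q (\<lambda>x' y'.
            pure_tensor K M N (x \<otimes>\<^bsub>M\<^esub> x') (y \<otimes>\<^bsub>N\<^esub> y')) Y) X),
        one := pure_tensor K M N \<one>\<^bsub>M\<^esub> \<one>\<^bsub>N\<^esub>\<rparr>)"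


section \<open>Hopf algebras\<close>

text \<open>\<^locale>\<open>algebra\<close> requires a commutative multiplication, which is not wanted here.\<close>

locale assoc_algebra = Module.module K A + ring A for K (structure) and A (structure) +
  assumes smult_mult_left:
      "\<lbrakk>c \<in> carrier K; x \<in> carrier A; y \<in> carrier A\<rbrakk> \<Longrightarrow> (c \<odot>\<^bsub>A\<^esub> x) \<otimes>\<^bsub>A\<^esub> y = c \<odot>\<^bsub>A\<^esub> (x \<otimes>\<^bsub>A\<^esub> y)"
    and smult_mult_right:
      "\<lbrakk>c \<in> carrier K; x \<in> carrier A; y \<in> carrier A\<rbrakk> \<Longrightarrow> x \<otimes>\<^bsub>A\<^esub> (c \<odot>\<^bsub>A\<^esub> y) = c \<odot>\<^bsub>A\<^esub> (x \<otimes>\<^bsub>A\<^esub> y)"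

definition algebra_hom ::
  "('k, 'r) ring_scheme \<Rightarrow> ('k, 'a, 'm) module_scheme \<Rightarrow> ('k, 'b, 'n) module_scheme \<Rightarrow> ('a \<Rightarrow> 'b) set"
  where "algebra_hom K A B = linear_map K A B \<inter> ring_hom A B"

text \<open>Coassociativity compares \<open>(\<Delta> \<otimes> id) \<circ> \<Delta>\<close> and \<open>(id \<otimes> \<Delta>) \<circ> \<Delta>\<close> in \<open>C \<otimes> (C \<otimes> C)\<close>: in
  the left-hand side the inner lift sends \<open>a \<otimes> b\<close> to \<open>a \<otimes> (b \<otimes> z)\<close>, which is the canonical
  associator applied to \<open>(a \<otimes> b) \<otimes> z\<close>.\<close>

locale coalgebra = Module.module K C for K (structure) and C (structure) +
  fixes \<Delta> and \<epsilon>
  assumes comult_linear: "\<Delta> \<in> linear_map K C (tensor_product K C C)"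
    and counit_linear: "\<epsilon> \<in> linear_map K C (base_module K)"
    and coassoc: "h \<in> carrier C \<Longrightarrow>
      tensor_lift K (tensor_product K C (tensor_product K C C))
        (\<lambda>x z. tensor_lift K (tensor_product K C (tensor_product K C C))
          (\<lambda>a b. pure_tensor K C (tensor_product K C C) a (pure_tensor K C C b z)) (\<Delta> x)) (\<Delta> h) =
      tensor_lift K (tensor_product K C (tensor_product K C C))
        (\<lambda>x z. pure_tensor K C (tensor_product K C C) x (\<Delta> z)) (\<Delta> h)"
    and counit_left: "h \<in> carrier C \<Longrightarrow> tensor_lift K C (\<lambda>x y. \<epsilon> x \<odot>\<^bsub>C\<^esub> y) (\<Delta> h) = h"
    and counit_right: "h \<in> carrier C \<Longrightarrow> tensor_lift K C (\<lambda>x y. \<epsilon> y \<odot>\<^bsub>C\<^esub> x) (\<Delta> h) = h"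

locale bialgebra = assoc_algebra K H + coalgebra K H \<Delta> \<epsilon>
  for K (structure) and H (structure) and \<Delta> and \<epsilon> +
  assumes comult_hom: "\<Delta> \<in> algebra_hom K H (tensor_product K H H)"
    and counit_hom: "\<epsilon> \<in> algebra_hom K H (base_module K)"

locale hopf_algebra = bialgebra K H \<Delta> \<epsilon>
  for K (structure) and H (structure) and \<Delta> and \<epsilon> +
  assumes antipode_exists: "\<exists>S\<in>linear_map K H H. \<forall>h\<in>carrier H.
      tensor_lift K H (\<lambda>x y. S x \<otimes>\<^bsub>H\<^esub> y) (\<Delta> h) = \<epsilon> h \<odot>\<^bsub>H\<^esub> \<one>\<^bsub>H\<^esub> \<and>
      tensor_lift K H (\<lambda>x y. x \<otimes>\<^bsub>H\<^esub> S y) (\<Delta> h) = \<epsilon> h \<odot>\<^bsub>H\<^esub> \<one>\<^bsub>H\<^esub>"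


section \<open>The tensor algebra\<close>

definition word_algebra ::
  "('k, 'r) ring_scheme \<Rightarrow> ('k, 'v, 'm) module_scheme \<Rightarrow> ('k, 'v list \<Rightarrow> 'k) module"
  where "word_algebra K V = (free_module K (lists (carrier V)))
    \<lparr>mult := (\<lambda>f g w. \<Oplus>\<^bsub>K\<^esub>i\<in>{..length w}. f (take i w) \<otimes>\<^bsub>K\<^esub> g (drop i w)),
     one := free_gen K []\<rparr>"

definition multilinear_relations ::
  "('k, 'r) ring_scheme \<Rightarrow> ('k, 'v, 'm) module_scheme \<Rightarrow> ('v list \<Rightarrow> 'k) set"
  where "multilinear_relations K V =
    (let F = word_algebra K V in
      {free_gen K (u @ [c \<odot>\<^bsub>V\<^esub> x \<oplus>\<^bsub>V\<^esub> d \<odot>\<^bsub>V\<^esub> y] @ w)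
          \<ominus>\<^bsub>F\<^esub> (c \<odot>\<^bsub>F\<^esub> free_gen K (u @ [x] @ w) \<oplus>\<^bsub>F\<^esub> d \<odot>\<^bsub>F\<^esub> free_gen K (u @ [y] @ w)) | u c x d y w.
        u \<in> lists (carrier V) \<and> w \<in> lists (carrier V) \<and> c \<in> carrier K \<and> d \<in> carrier K \<and>
        x \<in> carrier V \<and> y \<in> carrier V})"

definition tensor_algebra_null ::
  "('k, 'r) ring_scheme \<Rightarrow> ('k, 'v, 'm) module_scheme \<Rightarrow> ('v list \<Rightarrow> 'k) set"
  where "tensor_algebra_null K V =
    generated_submodule K (word_algebra K V) (multilinear_relations K V)"

text \<open>The relations are homogeneous in the length of words. The cosets of combinations of words
  of length \<open>n\<close> form the \<open>n\<close>-th tensor power of \<open>V\<close>, and \<open>T(V)\<close> is the direct sum of these.\<close>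

definition tensor_algebra ::
  "('k, 'r) ring_scheme \<Rightarrow> ('k, 'v, 'm) module_scheme \<Rightarrow> ('k, ('v list \<Rightarrow> 'k) set) module"
  where "tensor_algebra K V = quotient_module (word_algebra K V) (tensor_algebra_null K V)"

definition tensor_incl ::
  "('k, 'r) ring_scheme \<Rightarrow> ('k, 'v, 'm) module_scheme \<Rightarrow> 'v \<Rightarrow> ('v list \<Rightarrow> 'k) set"
  where "tensor_incl K V x = tensor_algebra_null K V +>\<^bsub>word_algebra K V\<^esub> free_gen K [x]"

text \<open>The algebra morphism from \<open>T(V)\<close> to \<open>A\<close> extending a linear map \<open>\<phi>\<close> from \<open>V\<close> to \<open>A\<close>:
  the class of a word \<open>x\<^sub>1 \<dots> x\<^sub>n\<close> is sent to \<open>\<phi> x\<^sub>1 \<dots> \<phi> x\<^sub>n\<close>.\<close>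

definition tensor_algebra_lift ::
  "('k, 'r) ring_scheme \<Rightarrow> ('k, 'a, 'm) module_scheme \<Rightarrow> ('v \<Rightarrow> 'a) \<Rightarrow> ('v list \<Rightarrow> 'k) set \<Rightarrow> 'a"
  where "tensor_algebra_lift K A \<phi> X =
    the_elem (free_lift K A (\<lambda>w. foldr (\<lambda>x p. \<phi> x \<otimes>\<^bsub>A\<^esub> p) w \<one>\<^bsub>A\<^esub>) ` X)"

definition deshuffle ::
  "('k, 'r) ring_scheme \<Rightarrow> ('k, 'v, 'm) module_scheme
    \<Rightarrow> ('v list \<Rightarrow> 'k) set \<Rightarrow> (('v list \<Rightarrow> 'k) set \<times> ('v list \<Rightarrow> 'k) set \<Rightarrow> 'k) set"
  where "deshuffle K V =
    (let T = tensor_algebra K V; TT = tensor_product K T T in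
      tensor_algebra_lift K TT (\<lambda>x.
        pure_tensor K T T (tensor_incl K V x) \<one>\<^bsub>T\<^esub> \<oplus>\<^bsub>TT\<^esub> pure_tensor K T T \<one>\<^bsub>T\<^esub> (tensor_incl K V x)))"

text \<open>The coefficient of the empty word, which is the same for all representatives of a coset.\<close>

definition tensor_counit :: "('v list \<Rightarrow> 'k) set \<Rightarrow> 'k"
  where "tensor_counit X = the_elem ((\<lambda>f. f []) ` X)"


section \<open>Extending a product from \<open>V\<close> to \<open>T(V)\<close>\<close>

locale product_extension =
  fixes K (structure) and V (structure)
    and star :: "'v \<Rightarrow> 'v \<Rightarrow> 'v"
    and ext :: "('v list \<Rightarrow> 'k) set \<Rightarrow> ('v list \<Rightarrow> 'k) set \<Rightarrow> ('v list \<Rightarrow> 'k) set" (infixl \<open>\<star>\<close> 70)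
    and T (structure)
  defines "T \<equiv> tensor_algebra K V"
  assumes ext_bilinear: "bilinear_map K T T T (\<star>)"
    and ext_extends: "\<lbrakk>x \<in> carrier V; y \<in> carrier V\<rbrakk> \<Longrightarrow>
      tensor_incl K V x \<star> tensor_incl K V y = tensor_incl K V (star x y)"
    and ext_one_right: "f \<in> carrier T \<Longrightarrow> f \<star> \<one>\<^bsub>T\<^esub> = f"
    and ext_one_left: "f \<in> carrier T \<Longrightarrow> \<one>\<^bsub>T\<^esub> \<star> f = tensor_counit f \<odot>\<^bsub>T\<^esub> \<one>\<^bsub>T\<^esub>"
    and ext_letter: "\<lbrakk>x \<in> carrier V; f \<in> carrier T; y \<in> carrier V\<rbrakk> \<Longrightarrow>
      tensor_incl K V x \<star> (f \<otimes>\<^bsub>T\<^esub> tensor_incl K V y) =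
        (tensor_incl K V x \<star> f) \<star> tensor_incl K V y \<ominus>\<^bsub>T\<^esub> tensor_incl K V x \<star> (f \<star> tensor_incl K V y)"
    and ext_mult: "\<lbrakk>f \<in> carrier T; g \<in> carrier T; h \<in> carrier T\<rbrakk> \<Longrightarrow>
      (f \<otimes>\<^bsub>T\<^esub> g) \<star> h = tensor_lift K T (\<lambda>a b. (f \<star> a) \<otimes>\<^bsub>T\<^esub> (g \<star> b)) (deshuffle K V h)"

definition circledast ::
  "('k, 'r) ring_scheme \<Rightarrow> ('k, 'v, 'm) module_scheme
    \<Rightarrow> (('v list \<Rightarrow> 'k) set \<Rightarrow> ('v list \<Rightarrow> 'k) set \<Rightarrow> ('v list \<Rightarrow> 'k) set)
    \<Rightarrow> ('v list \<Rightarrow> 'k) set \<Rightarrow> ('v list \<Rightarrow> 'k) set \<Rightarrow> ('v list \<Rightarrow> 'k) set"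
  where "circledast K V ext f g =
    tensor_lift K (tensor_algebra K V) (\<lambda>a b. ext f a \<otimes>\<^bsub>tensor_algebra K V\<^esub> b) (deshuffle K V g)"

end

theory Submission
  imports Defs
begin

text \<open>Everything reduces to right multiplication by letters. For \<open>x \<in> V\<close> the map \<open>h \<mapsto> h \<star> x\<close> is a
  derivation and a coderivation of \<open>T(V)\<close>, hence \<open>h \<mapsto> h \<bullet> x = h \<star> x + h x\<close> (with \<open>\<bullet>\<close> for the circled
  product) is a coderivation too. Induction on \<open>f\<close> gives \<open>(f \<star> g) \<star> x = f \<star> (g \<bullet> x)\<close>, which in turn
  gives \<open>(f \<bullet> g) \<bullet> x = f \<bullet> (g \<bullet> x)\<close>. Since \<open>h \<star> x\<close> does not raise the degree of \<open>h\<close>, the maps \<open>h \<mapsto> h \<bullet> x\<close>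
  generate \<open>T(V)\<close> from \<open>1\<close>, and associativity, the multiplicativity of coproduct and counit and the
  antipode axioms all follow by induction along this generation.\<close>

section \<open>Linear maps and generated submodules\<close>

text \<open>The axiom for \<open>x \<star> (f y)\<close> is associativity in disguise: as
  \<open>f \<bullet> y = f \<star> y + f y\<close>, it says
  \<open>(x \<star> f) \<star> y = x \<star> (f \<bullet> y)\<close> for letters \<open>x\<close>,
  \<open>y\<close>. Coderivations enter when the letter \<open>x\<close> is replaced by a product,
  because \<open>(f g) \<star> h\<close> distributes \<open>h\<close> through the coproduct.
  Sweedler sums are never manipulated. An equation between sums over \<Delta> h becomes an equality
  of two linear maps on T \<otimes> T, checked on pure tensors, and an induction step becomes an
  intertwining relation for the operator \<open>leibniz A\<close>. The obstacle is that \<bullet>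
  does not respect the grading: \<open>h \<bullet> x\<close> has the component
  \<open>h \<star> x\<close> in the degree of \<open>h\<close> besides \<open>h x\<close>, so a word
  is not the \<bullet>-product of its letters. Generation by \<bullet> therefore needs an induction
  over length. The antipode, whose values are forced along \<bullet>, still has to be constructed as
  a multilinear function of concatenated words, since only for these is a universal property at
  hand.\<close>

lemma linear_mapI:
  assumes "\<And>x. x \<in> carrier M \<Longrightarrow> h x \<in> carrier N"
    and "\<And>x y. \<lbrakk>x \<in> carrier M; y \<in> carrier M\<rbrakk> \<Longrightarrow> h (x \<oplus>\<^bsub>M\<^esub> y) = h x \<oplus>\<^bsub>N\<^esub> h y"
    and "\<And>c x. \<lbrakk>c \<in> carrier K; x \<in> carrier M\<rbrakk> \<Longrightarrow> h (c \<odot>\<^bsub>M\<^esub> x) = c \<odot>\<^bsub>N\<^esub> h x"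
  shows "h \<in> linear_map K M N"
  using assms by (auto simp: linear_map_def)

lemma linear_map_closed: "\<lbrakk>h \<in> linear_map K M N; x \<in> carrier M\<rbrakk> \<Longrightarrow> h x \<in> carrier N"
  and linear_map_add: "\<lbrakk>h \<in> linear_map K M N; x \<in> carrier M; y \<in> carrier M\<rbrakk>
    \<Longrightarrow> h (x \<oplus>\<^bsub>M\<^esub> y) = h x \<oplus>\<^bsub>N\<^esub> h y"
  and linear_map_smult: "\<lbrakk>h \<in> linear_map K M N; c \<in> carrier K; x \<in> carrier M\<rbrakk>
    \<Longrightarrow> h (c \<odot>\<^bsub>M\<^esub> x) = c \<odot>\<^bsub>N\<^esub> h x"
  by (auto simp: linear_map_def)

lemma linear_map_zero:
  assumes "Module.module K M" "Module.module K N" "h \<in> linear_map K M N"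
  shows "h \<zero>\<^bsub>M\<^esub> = \<zero>\<^bsub>N\<^esub>"
proof -
  interpret M: Module.module K M by fact
  interpret N: Module.module K N by fact
  have "h \<zero>\<^bsub>M\<^esub> = h (\<zero>\<^bsub>K\<^esub> \<odot>\<^bsub>M\<^esub> \<zero>\<^bsub>M\<^esub>)" by simp
  also have "\<dots> = \<zero>\<^bsub>K\<^esub> \<odot>\<^bsub>N\<^esub> h \<zero>\<^bsub>M\<^esub>" using assms(3) by (intro linear_map_smult) auto
  also have "\<dots> = \<zero>\<^bsub>N\<^esub>" using linear_map_closed[OF assms(3)] by simp
  finally show ?thesis .
qed

lemma linear_map_uminus:
  assumes "Module.module K M" "Module.module K N" "h \<in> linear_map K M N" "x \<in> carrier M"
  shows "h (\<ominus>\<^bsub>M\<^esub> x) = \<ominus>\<^bsub>N\<^esub> h x"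
proof -
  interpret M: Module.module K M by fact
  interpret N: Module.module K N by fact
  have "h (\<ominus>\<^bsub>M\<^esub> x) = h ((\<ominus>\<^bsub>K\<^esub> \<one>\<^bsub>K\<^esub>) \<odot>\<^bsub>M\<^esub> x)" using assms(4) by (simp add: M.smult_l_minus)
  also have "\<dots> = (\<ominus>\<^bsub>K\<^esub> \<one>\<^bsub>K\<^esub>) \<odot>\<^bsub>N\<^esub> h x" using assms by (intro linear_map_smult) auto
  also have "\<dots> = \<ominus>\<^bsub>N\<^esub> h x" using linear_map_closed[OF assms(3,4)] by (simp add: N.smult_l_minus)
  finally show ?thesis .
qed

lemma linear_map_minus:
  assumes "Module.module K M" "Module.module K N" "h \<in> linear_map K M N" "x \<in> carrier M" "y \<in> carrier M"
  shows "h (x \<ominus>\<^bsub>M\<^esub> y) = h x \<ominus>\<^bsub>N\<^esub> h y"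
proof -
  interpret M: Module.module K M by fact
  show ?thesis using assms linear_map_uminus[OF assms(1-3), of y]
    by (simp add: a_minus_def linear_map_add)
qed

lemma linear_map_id: "(\<lambda>x. x) \<in> linear_map K M M"
  by (simp add: linear_map_def)

lemma linear_map_compose:
  "\<lbrakk>f \<in> linear_map K M N; g \<in> linear_map K N P\<rbrakk> \<Longrightarrow> (\<lambda>x. g (f x)) \<in> linear_map K M P"
  by (auto simp: linear_map_def Pi_def)

lemma linear_map_sum:
  assumes "Module.module K N" "f \<in> linear_map K M N" "g \<in> linear_map K M N"
  shows "(\<lambda>x. f x \<oplus>\<^bsub>N\<^esub> g x) \<in> linear_map K M N"
proof -
  interpret N: Module.module K N by fact
  show ?thesis
    using assms(2,3)
    by (intro linear_mapI)
      (auto simp: linear_map_closed linear_map_add linear_map_smult N.a_ac N.smult_r_distr)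
qed

lemma linear_map_neg:
  assumes "Module.module K N" "f \<in> linear_map K M N"
  shows "(\<lambda>x. \<ominus>\<^bsub>N\<^esub> f x) \<in> linear_map K M N"
proof -
  interpret N: Module.module K N by fact
  show ?thesis
    using assms(2)
    by (intro linear_mapI)
      (auto simp: linear_map_closed linear_map_add linear_map_smult N.smult_r_minus N.minus_add)
qed

lemma linear_map_smult_const:
  assumes "Module.module K N" "c \<in> carrier K"
  shows "(\<lambda>x. c \<odot>\<^bsub>N\<^esub> x) \<in> linear_map K N N"
proof -
  interpret N: Module.module K N by fact
  show ?thesis
    using assms(2)
    by (intro linear_mapI)
      (auto simp: N.smult_r_distr N.smult_assoc1[symmetric] N.R.m_comm)
qed

lemma linear_map_smult_vector:
  assumes "Module.module K N" "f \<in> linear_map K M (base_module K)" "y \<in> carrier N"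
  shows "(\<lambda>x. f x \<odot>\<^bsub>N\<^esub> y) \<in> linear_map K M N"
proof -
  interpret N: Module.module K N by fact
  show ?thesis
    using assms(2,3)
    by (auto simp: linear_map_def base_module_def Pi_iff N.smult_l_distr N.smult_assoc1)
qed

lemma bilinear_mapI:
  assumes "\<And>x y. \<lbrakk>x \<in> carrier M; y \<in> carrier N\<rbrakk> \<Longrightarrow> \<beta> x y \<in> carrier P"
    and "\<And>x y z. \<lbrakk>x \<in> carrier M; y \<in> carrier N; z \<in> carrier N\<rbrakk> \<Longrightarrow> \<beta> x (y \<oplus>\<^bsub>N\<^esub> z) = \<beta> x y \<oplus>\<^bsub>P\<^esub> \<beta> x z"
    and "\<And>c x y. \<lbrakk>c \<in> carrier K; x \<in> carrier M; y \<in> carrier N\<rbrakk> \<Longrightarrow> \<beta> x (c \<odot>\<^bsub>N\<^esub> y) = c \<odot>\<^bsub>P\<^esub> \<beta> x y"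
    and "\<And>x y z. \<lbrakk>x \<in> carrier M; y \<in> carrier M; z \<in> carrier N\<rbrakk> \<Longrightarrow> \<beta> (x \<oplus>\<^bsub>M\<^esub> y) z = \<beta> x z \<oplus>\<^bsub>P\<^esub> \<beta> y z"
    and "\<And>c x y. \<lbrakk>c \<in> carrier K; x \<in> carrier M; y \<in> carrier N\<rbrakk> \<Longrightarrow> \<beta> (c \<odot>\<^bsub>M\<^esub> x) y = c \<odot>\<^bsub>P\<^esub> \<beta> x y"
  shows "bilinear_map K M N P \<beta>"
  using assms by (simp add: bilinear_map_def linear_map_def)

lemma bilinear_map_right: "\<lbrakk>bilinear_map K M N P \<beta>; x \<in> carrier M\<rbrakk> \<Longrightarrow> \<beta> x \<in> linear_map K N P"
  and bilinear_map_left: "\<lbrakk>bilinear_map K M N P \<beta>; y \<in> carrier N\<rbrakk> \<Longrightarrow> (\<lambda>x. \<beta> x y) \<in> linear_map K M P"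
  by (auto simp: bilinear_map_def)

lemma bilinear_mapI_linear:
  assumes "\<And>x. x \<in> carrier M \<Longrightarrow> (\<lambda>y. \<beta> x y) \<in> linear_map K N P"
    and "\<And>y. y \<in> carrier N \<Longrightarrow> (\<lambda>x. \<beta> x y) \<in> linear_map K M P"
  shows "bilinear_map K M N P \<beta>"
  using assms by (simp add: bilinear_map_def)

lemma bilinear_map_closed:
  "\<lbrakk>bilinear_map K M N P \<beta>; x \<in> carrier M; y \<in> carrier N\<rbrakk> \<Longrightarrow> \<beta> x y \<in> carrier P"
  by (auto simp: bilinear_map_def linear_map_def)

lemma bilinear_map_compose:
  assumes "bilinear_map K M N P \<beta>" "F \<in> linear_map K M' M" "G \<in> linear_map K N' N"
  shows "bilinear_map K M' N' P (\<lambda>x y. \<beta> (F x) (G y))"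
  using assms by (auto simp: bilinear_map_def linear_map_def Pi_def)

lemma bilinear_map_post_compose:
  assumes "bilinear_map K M N P \<beta>" "F \<in> linear_map K P Q"
  shows "bilinear_map K M N Q (\<lambda>x y. F (\<beta> x y))"
  using assms by (auto simp: bilinear_map_def linear_map_def Pi_def)

lemma bilinear_map_sum:
  assumes "Module.module K P" "bilinear_map K M N P \<beta>" "bilinear_map K M N P \<gamma>"
  shows "bilinear_map K M N P (\<lambda>x y. \<beta> x y \<oplus>\<^bsub>P\<^esub> \<gamma> x y)"
  using assms by (auto simp: bilinear_map_def intro!: linear_map_sum)

text \<open>The algebras here arise from free modules and quotients by overwriting
  \<open>mult\<close> and \<open>one\<close>, fields that the module axioms do not mention. This
  transfers the axioms to \<open>word_algebra\<close>, to tensor products and to T with the new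
  product.\<close>

lemma module_cong:
  assumes "Module.module K M" "carrier M' = carrier M" "add M' = add M" "zero M' = zero M"
    "module.smult M' = module.smult M"
  shows "Module.module K M'"
proof -
  interpret M: Module.module K M by fact
  show ?thesis
  proof (intro moduleI abelian_groupI)
    show "cring K" by (rule M.R.is_cring)
    fix x assume "x \<in> carrier M'"
    then show "\<exists>y\<in>carrier M'. y \<oplus>\<^bsub>M'\<^esub> x = \<zero>\<^bsub>M'\<^esub>"
      using assms(2-5) M.l_neg by auto
  qed (use assms(2-5) in \<open>auto simp: M.a_ac M.smult_l_distr M.smult_r_distr M.smult_assoc1\<close>)
qed

lemma base_module_module:
  assumes "cring K"
  shows "Module.module K (base_module K)"
proof -
  interpret cring K by fact
  show ?thesis
  proof (intro moduleI abelian_groupI)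
    fix x assume "x \<in> carrier (base_module K)"
    then show "\<exists>y\<in>carrier (base_module K). y \<oplus>\<^bsub>base_module K\<^esub> x = \<zero>\<^bsub>base_module K\<^esub>"
      using l_neg by (auto simp: base_module_def)
  qed (auto simp: base_module_def a_ac m_ac l_distr r_distr assms)
qed

lemma generated_submodule_subset: "S \<subseteq> generated_submodule K M S"
  by (auto simp: generated_submodule_def)

lemma submodule_collect:
  assumes "Module.module K M" "P \<zero>\<^bsub>M\<^esub>"
    and "\<And>x y. \<lbrakk>x \<in> carrier M; y \<in> carrier M; P x; P y\<rbrakk> \<Longrightarrow> P (x \<oplus>\<^bsub>M\<^esub> y)"
    and "\<And>c x. \<lbrakk>c \<in> carrier K; x \<in> carrier M; P x\<rbrakk> \<Longrightarrow> P (c \<odot>\<^bsub>M\<^esub> x)"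
  shows "submodule {x \<in> carrier M. P x} K M"
proof -
  interpret M: Module.module K M by fact
  show ?thesis
  proof (rule M.submoduleI)
    fix a assume a: "a \<in> {x \<in> carrier M. P x}"
    \<comment> \<open>Negation is scaling by -1, so closure under scalars covers it.\<close>
    then have "P ((\<ominus>\<^bsub>K\<^esub> \<one>\<^bsub>K\<^esub>) \<odot>\<^bsub>M\<^esub> a)" by (intro assms(4)) auto
    with a show "\<ominus>\<^bsub>M\<^esub> a \<in> {x \<in> carrier M. P x}" by (simp add: M.smult_l_minus)
  qed (auto simp: assms)
qed

text \<open>The elements with \<open>P\<close> form a submodule containing \<open>S\<close>, so the
  intersection of all such submodules lies inside. All later induction principles on T descend from
  this one.\<close>

lemma generated_submodule_induct [consumes 3, case_names gen zero add smult]: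
  assumes "Module.module K M" "S \<subseteq> carrier M" "x \<in> generated_submodule K M S"
    and gen: "\<And>x. x \<in> S \<Longrightarrow> P x" and zero: "P \<zero>\<^bsub>M\<^esub>"
    and add: "\<And>x y. \<lbrakk>x \<in> carrier M; y \<in> carrier M; P x; P y\<rbrakk> \<Longrightarrow> P (x \<oplus>\<^bsub>M\<^esub> y)"
    and smult: "\<And>c x. \<lbrakk>c \<in> carrier K; x \<in> carrier M; P x\<rbrakk> \<Longrightarrow> P (c \<odot>\<^bsub>M\<^esub> x)"
  shows "P x"
proof -
  have "submodule {x \<in> carrier M. P x} K M"
    by (rule submodule_collect) fact+
  moreover have "S \<subseteq> {x \<in> carrier M. P x}" using assms(2) gen by auto
  ultimately have "x \<in> {x \<in> carrier M. P x}"
    using assms(3) by (auto simp: generated_submodule_def)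
  then show ?thesis by simp
qed

lemma generated_submodule_submodule:
  assumes "Module.module K M" "S \<subseteq> carrier M"
  shows "submodule (generated_submodule K M S) K M"
proof -
  interpret M: Module.module K M by fact
  show ?thesis
  proof (rule M.submoduleI)
    show "generated_submodule K M S \<subseteq> carrier M"
      using M.carrier_is_submodule assms(2) by (auto simp: generated_submodule_def)
  qed (auto simp: generated_submodule_def M.submoduleE submodule.axioms(1)
        intro: subgroup.one_closed[OF submodule.axioms(1), simplified])
qed

lemma linear_map_eq_on_generated:
  assumes "Module.module K M" "Module.module K N" "S \<subseteq> carrier M"
    and "F \<in> linear_map K M N" "G \<in> linear_map K M N"
    and "\<And>x. x \<in> S \<Longrightarrow> F x = G x" and "x \<in> generated_submodule K M S"
  shows "F x = G x"
  using assms(1,3,7)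
  by (induction rule: generated_submodule_induct)
    (use assms in \<open>auto simp: linear_map_zero linear_map_add linear_map_smult\<close>)

lemma linear_map_vanish_on_generated:
  assumes "Module.module K M" "Module.module K N" "S \<subseteq> carrier M" "F \<in> linear_map K M N"
    and "\<And>x. x \<in> S \<Longrightarrow> F x = \<zero>\<^bsub>N\<^esub>" and "x \<in> generated_submodule K M S"
  shows "F x = \<zero>\<^bsub>N\<^esub>"
proof -
  interpret N: Module.module K N by fact
  show ?thesis
    by (rule linear_map_eq_on_generated[OF assms(1-4) _ assms(5,6)]) (auto intro!: linear_mapI)
qed


section \<open>Free modules and quotient modules\<close>

lemma free_module_carrier: "f \<in> carrier (free_module K X) \<longleftrightarrow>
    (\<forall>x. f x \<in> carrier K) \<and> finite {x. f x \<noteq> \<zero>\<^bsub>K\<^esub>} \<and> {x. f x \<noteq> \<zero>\<^bsub>K\<^esub>} \<subseteq> X"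
  and free_module_add: "f \<oplus>\<^bsub>free_module K X\<^esub> g = (\<lambda>x. f x \<oplus>\<^bsub>K\<^esub> g x)"
  and free_module_zero: "\<zero>\<^bsub>free_module K X\<^esub> = (\<lambda>x. \<zero>\<^bsub>K\<^esub>)"
  and free_module_smult: "c \<odot>\<^bsub>free_module K X\<^esub> f = (\<lambda>x. c \<otimes>\<^bsub>K\<^esub> f x)"
  by (simp_all add: free_module_def)

lemmas free_module_simps = free_module_carrier free_module_add free_module_zero free_module_smult

context cring begin

text \<open>A function that vanishes wherever both \<open>f\<close> and \<open>g\<close> do has its
  support in the union of theirs. Sums, multiples, negatives and the deletion of one value are all
  of this kind.\<close>

lemma free_module_closed:
  assumes "f \<in> carrier (free_module R X)" "g \<in> carrier (free_module R X)"
    "\<And>x. h x \<in> carrier R" "\<And>x. f x = \<zero> \<Longrightarrow> g x = \<zero> \<Longrightarrow> h x = \<zero>"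
  shows "h \<in> carrier (free_module R X)"
proof -
  have "{x. h x \<noteq> \<zero>} \<subseteq> {x. f x \<noteq> \<zero>} \<union> {x. g x \<noteq> \<zero>}" using assms by auto
  then show ?thesis using assms(1-3) unfolding free_module_carrier
    by (meson finite_Un finite_subset le_sup_iff order_trans)
qed

lemma free_module_module: "Module.module R (free_module R X)"
proof (intro moduleI abelian_groupI)
  show "cring R" by (rule is_cring)
next
  fix f g assume fg: "f \<in> carrier (free_module R X)" "g \<in> carrier (free_module R X)"
  show "f \<oplus>\<^bsub>free_module R X\<^esub> g \<in> carrier (free_module R X)"
    by (rule free_module_closed[OF fg]) (use fg in \<open>auto simp: free_module_simps\<close>)
  show "f \<oplus>\<^bsub>free_module R X\<^esub> g = g \<oplus>\<^bsub>free_module R X\<^esub> f"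
    using fg by (auto simp: free_module_simps a_ac)
next
  fix c f assume cf: "c \<in> carrier R" "f \<in> carrier (free_module R X)"
  show "c \<odot>\<^bsub>free_module R X\<^esub> f \<in> carrier (free_module R X)"
    by (rule free_module_closed[OF cf(2) cf(2)]) (use cf in \<open>auto simp: free_module_simps\<close>)
next
  fix f assume f: "f \<in> carrier (free_module R X)"
  have "(\<lambda>x. \<ominus> f x) \<in> carrier (free_module R X)"
    by (rule free_module_closed[OF f f]) (use f in \<open>auto simp: free_module_simps\<close>)
  then show "\<exists>g\<in>carrier (free_module R X). g \<oplus>\<^bsub>free_module R X\<^esub> f = \<zero>\<^bsub>free_module R X\<^esub>"
    using f by (auto simp: free_module_simps l_neg intro!: bexI[of _ "\<lambda>x. \<ominus> f x"])
qed (auto simp: free_module_simps a_ac m_ac l_distr r_distr)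

lemma free_gen_closed: "x \<in> X \<Longrightarrow> free_gen R x \<in> carrier (free_module R X)"
  by (auto simp: free_gen_def free_module_carrier intro: finite_subset[of _ "{x}"])

lemma free_module_generated:
  "generated_submodule R (free_module R X) (free_gen R ` X) = carrier (free_module R X)"
    (is "?G = carrier ?F")
proof
  interpret F: Module.module R "?F" by (rule free_module_module)
  have sub: "free_gen R ` X \<subseteq> carrier ?F" using free_gen_closed by auto
  note G = generated_submodule_submodule[OF free_module_module sub]
  show "?G \<subseteq> carrier ?F" by (rule F.submoduleE(1)[OF G])
  have "f \<in> ?G" if "finite B" "f \<in> carrier ?F" "{x. f x \<noteq> \<zero>} = B" for f B
    using that
  proof (induction B arbitrary: f rule: finite_induct)
    case empty
    then have "f = \<zero>\<^bsub>?F\<^esub>" by (auto simp: free_module_zero)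
    then show ?case using subgroup.one_closed[OF submodule.axioms(1)[OF G]] by simp
  next
    case (insert b B)
    \<comment> \<open>Deleting the value at \<open>b\<close> leaves the support \<open>B\<close>,
      and \<open>f\<close> is recovered by adding \<open>f b\<close> times the generator at
      \<open>b\<close>.\<close>
    let ?g = "f(b := \<zero>)"
    have b: "b \<in> X" using insert by (auto simp: free_module_carrier)
    have fc: "\<And>x. f x \<in> carrier R" using insert by (auto simp: free_module_carrier)
    have g: "?g \<in> carrier ?F"
      by (rule free_module_closed[OF insert.prems(1) insert.prems(1)]) (auto simp: fc)
    have "{x. ?g x \<noteq> \<zero>} = B" using insert by auto
    with g insert.IH have "?g \<in> ?G" by blast
    moreover have "f b \<odot>\<^bsub>?F\<^esub> free_gen R b \<in> ?G"
      by (intro F.submoduleE(4)[OF G] subsetD[OF generated_submodule_subset] imageI b fc)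
    moreover have "f = ?g \<oplus>\<^bsub>?F\<^esub> (f b \<odot>\<^bsub>?F\<^esub> free_gen R b)"
      by (auto simp: free_module_simps free_gen_def fc)
    ultimately show ?case using F.submoduleE(5)[OF G, of ?g "f b \<odot>\<^bsub>?F\<^esub> free_gen R b"] by simp
  qed
  then show "carrier ?F \<subseteq> ?G" by (auto simp: free_module_carrier)
qed

text \<open>Adding or scaling may cancel coefficients and shrink the support. Letting the sum run
  over any finite set between the support and \<open>X\<close> puts the sums in the linearity proof
  over one index set.\<close>

lemma free_lift_eq:
  assumes "Module.module R M" "f \<in> carrier (free_module R X)" "\<And>x. x \<in> X \<Longrightarrow> \<phi> x \<in> carrier M"
    "finite B" "B \<subseteq> X" "{x. f x \<noteq> \<zero>} \<subseteq> B"
  shows "free_lift R M \<phi> f = (\<Oplus>\<^bsub>M\<^esub>x\<in>B. f x \<odot>\<^bsub>M\<^esub> \<phi> x)"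
proof -
  interpret M: Module.module R M by fact
  show ?thesis unfolding free_lift_def
    by (rule M.add.finprod_mono_neutral_cong_left) (use assms in \<open>auto simp: free_module_carrier\<close>)
qed

lemma free_lift_gen:
  assumes "Module.module R M" "\<And>x. x \<in> X \<Longrightarrow> \<phi> x \<in> carrier M" "x \<in> X"
  shows "free_lift R M \<phi> (free_gen R x) = \<phi> x"
proof -
  interpret M: Module.module R M by fact
  show ?thesis
    using assms free_gen_closed[OF assms(3)]
    by (subst free_lift_eq[where X=X and B="{x}"]) (auto simp: free_gen_def)
qed

lemma free_lift_linear:
  assumes "Module.module R M" "\<And>x. x \<in> X \<Longrightarrow> \<phi> x \<in> carrier M"
  shows "free_lift R M \<phi> \<in> linear_map R (free_module R X) M"
proof -
  interpret M: Module.module R M by fact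
  interpret F: Module.module R "free_module R X" by (rule free_module_module)
  show ?thesis
  proof (rule linear_mapI)
    fix f assume f: "f \<in> carrier (free_module R X)"
    let ?B = "{x. f x \<noteq> \<zero>}"
    have B: "finite ?B" "?B \<subseteq> X" "\<And>x. f x \<in> carrier R" using f by (auto simp: free_module_carrier)
    then show "free_lift R M \<phi> f \<in> carrier M"
      using assms by (auto simp: free_lift_def intro!: M.finsum_closed)
    fix c assume c: "c \<in> carrier R"
    have "free_lift R M \<phi> (c \<odot>\<^bsub>free_module R X\<^esub> f) = (\<Oplus>\<^bsub>M\<^esub>x\<in>?B. (c \<odot>\<^bsub>free_module R X\<^esub> f) x \<odot>\<^bsub>M\<^esub> \<phi> x)"
      by (rule free_lift_eq[OF assms(1) F.smult_closed[OF c f]])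
        (use assms B c in \<open>auto simp: free_module_smult\<close>)
    also have "\<dots> = (\<Oplus>\<^bsub>M\<^esub>x\<in>?B. c \<odot>\<^bsub>M\<^esub> (f x \<odot>\<^bsub>M\<^esub> \<phi> x))"
      by (rule M.finsum_cong') (use assms B c in \<open>auto simp: free_module_smult M.smult_assoc1\<close>)
    also have "\<dots> = c \<odot>\<^bsub>M\<^esub> free_lift R M \<phi> f"
      unfolding free_lift_def
      by (rule M.finsum_smult_ldistr[symmetric]) (use assms B c in auto)
    finally show "free_lift R M \<phi> (c \<odot>\<^bsub>free_module R X\<^esub> f) = c \<odot>\<^bsub>M\<^esub> free_lift R M \<phi> f" .
  next
    fix f g assume f: "f \<in> carrier (free_module R X)" and g: "g \<in> carrier (free_module R X)"
    let ?B = "{x. f x \<noteq> \<zero>} \<union> {x. g x \<noteq> \<zero>}"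
    have B: "finite ?B" "?B \<subseteq> X" "\<And>x. f x \<in> carrier R" "\<And>x. g x \<in> carrier R"
      using f g by (auto simp: free_module_carrier)
    have "free_lift R M \<phi> (f \<oplus>\<^bsub>free_module R X\<^esub> g)
        = (\<Oplus>\<^bsub>M\<^esub>x\<in>?B. (f \<oplus>\<^bsub>free_module R X\<^esub> g) x \<odot>\<^bsub>M\<^esub> \<phi> x)"
      by (rule free_lift_eq[OF assms(1) F.a_closed[OF f g]])
        (use assms B in \<open>auto simp: free_module_add\<close>)
    also have "\<dots> = (\<Oplus>\<^bsub>M\<^esub>x\<in>?B. f x \<odot>\<^bsub>M\<^esub> \<phi> x \<oplus>\<^bsub>M\<^esub> g x \<odot>\<^bsub>M\<^esub> \<phi> x)"
      by (rule M.finsum_cong') (use assms B in \<open>auto simp: free_module_add M.smult_l_distr\<close>)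
    also have "\<dots> = (\<Oplus>\<^bsub>M\<^esub>x\<in>?B. f x \<odot>\<^bsub>M\<^esub> \<phi> x) \<oplus>\<^bsub>M\<^esub> (\<Oplus>\<^bsub>M\<^esub>x\<in>?B. g x \<odot>\<^bsub>M\<^esub> \<phi> x)"
      by (rule M.finsum_addf) (use assms B in auto)
    also have "(\<Oplus>\<^bsub>M\<^esub>x\<in>?B. f x \<odot>\<^bsub>M\<^esub> \<phi> x) = free_lift R M \<phi> f"
      by (rule free_lift_eq[symmetric]) (use assms B f in auto)
    also have "(\<Oplus>\<^bsub>M\<^esub>x\<in>?B. g x \<odot>\<^bsub>M\<^esub> \<phi> x) = free_lift R M \<phi> g"
      by (rule free_lift_eq[symmetric]) (use assms B g in auto)
    finally show "free_lift R M \<phi> (f \<oplus>\<^bsub>free_module R X\<^esub> g)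
      = free_lift R M \<phi> f \<oplus>\<^bsub>M\<^esub> free_lift R M \<phi> g" .
  qed
qed

end

section \<open>Quotient modules and the linear maps that factor through them\<close>

locale module_quotient = Module.module K M for K (structure) and M (structure) +
  fixes N
  assumes sub: "submodule N K M"
begin

abbreviation "Q \<equiv> quotient_module M N"

lemma N_subset: "N \<subseteq> carrier M" by (rule submoduleE(1)[OF sub])

sublocale S: abelian_subgroup N M
  by (intro abelian_subgroupI3 additive_subgroupI submodule.axioms(1)[OF sub] M.abelian_group_axioms)

lemma quotient_carrier: "carrier Q = (\<lambda>x. N +>\<^bsub>M\<^esub> x) ` carrier M"
  by (auto simp: quotient_module_def A_RCOSETS_def')

lemma quotient_add: "\<lbrakk>x \<in> carrier M; y \<in> carrier M\<rbrakk> \<Longrightarrow> (N +>\<^bsub>M\<^esub> x) \<oplus>\<^bsub>Q\<^esub> (N +>\<^bsub>M\<^esub> y) = N +>\<^bsub>M\<^esub> (x \<oplus>\<^bsub>M\<^esub> y)"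
  by (simp add: quotient_module_def S.a_rcos_sum)

lemma quotient_zero: "\<zero>\<^bsub>Q\<^esub> = N"
  by (simp add: quotient_module_def)

lemma coset_eqI:
  assumes "x \<in> carrier M" "y \<in> carrier M" "x \<ominus>\<^bsub>M\<^esub> y \<in> N"
  shows "N +>\<^bsub>M\<^esub> x = N +>\<^bsub>M\<^esub> y"
proof -
  have "x \<in> N +>\<^bsub>M\<^esub> y" using assms by (simp add: S.a_rcos_module M.minus_eq)
  then show ?thesis using S.a_repr_independence'[OF _ assms(2)] by simp
qed

lemma coset_elem:
  assumes "x \<in> carrier M" "z \<in> N +>\<^bsub>M\<^esub> x"
  obtains n where "n \<in> N" "z = n \<oplus>\<^bsub>M\<^esub> x"
  using assms by (auto simp: a_r_coset_def')

text \<open>The scalar action is defined as a union over all representatives \<open>z\<close> of the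
  coset. Since \<open>c z - c x = c n\<close> with \<open>n \<in> N\<close>, all members of this
  union are the same coset.\<close>

lemma quotient_smult:
  assumes "c \<in> carrier K" "x \<in> carrier M"
  shows "c \<odot>\<^bsub>Q\<^esub> (N +>\<^bsub>M\<^esub> x) = N +>\<^bsub>M\<^esub> (c \<odot>\<^bsub>M\<^esub> x)"
proof -
  have "N +>\<^bsub>M\<^esub> (c \<odot>\<^bsub>M\<^esub> z) = N +>\<^bsub>M\<^esub> (c \<odot>\<^bsub>M\<^esub> x)" if z: "z \<in> N +>\<^bsub>M\<^esub> x" for z
  proof -
    obtain n where n: "n \<in> N" "z = n \<oplus>\<^bsub>M\<^esub> x" using coset_elem[OF assms(2) z] .
    then have nc: "n \<in> carrier M" using N_subset by auto
    have "c \<odot>\<^bsub>M\<^esub> z \<ominus>\<^bsub>M\<^esub> c \<odot>\<^bsub>M\<^esub> x = c \<odot>\<^bsub>M\<^esub> n"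
      using n nc assms by (simp add: smult_r_distr M.a_assoc M.minus_eq M.r_neg)
    then show ?thesis using n nc assms submoduleE(4)[OF sub]
      by (intro coset_eqI) auto
  qed
  then have "(\<Union>z\<in>N +>\<^bsub>M\<^esub> x. N +>\<^bsub>M\<^esub> (c \<odot>\<^bsub>M\<^esub> z)) = (\<Union>z\<in>N +>\<^bsub>M\<^esub> x. N +>\<^bsub>M\<^esub> (c \<odot>\<^bsub>M\<^esub> x))"
    by (intro SUP_cong) auto
  also have "\<dots> = N +>\<^bsub>M\<^esub> (c \<odot>\<^bsub>M\<^esub> x)" using S.a_rcos_self[OF assms(2)] by blast
  finally show ?thesis by (simp add: quotient_module_def)
qed

lemma quotient_module_module: "Module.module K Q"
proof (intro moduleI abelian_groupI)
  show "cring K" by (rule R.is_cring)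
  have zero: "\<zero>\<^bsub>Q\<^esub> = N +>\<^bsub>M\<^esub> \<zero>\<^bsub>M\<^esub>" using N_subset by (simp add: quotient_zero)
  then show "\<zero>\<^bsub>Q\<^esub> \<in> carrier Q" by (auto simp: quotient_carrier)
  fix X assume "X \<in> carrier Q"
  then obtain x where x: "x \<in> carrier M" "X = N +>\<^bsub>M\<^esub> x" by (auto simp: quotient_carrier)
  then show "\<one>\<^bsub>K\<^esub> \<odot>\<^bsub>Q\<^esub> X = X" by (simp add: quotient_smult)
  show "\<zero>\<^bsub>Q\<^esub> \<oplus>\<^bsub>Q\<^esub> X = X" using x by (simp add: zero quotient_add)
  have "(N +>\<^bsub>M\<^esub> (\<ominus>\<^bsub>M\<^esub> x)) \<oplus>\<^bsub>Q\<^esub> X = \<zero>\<^bsub>Q\<^esub>" using x by (simp add: zero quotient_add M.l_neg)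
  then show "\<exists>y\<in>carrier Q. y \<oplus>\<^bsub>Q\<^esub> X = \<zero>\<^bsub>Q\<^esub>" using x by (auto simp: quotient_carrier)
qed (auto simp: quotient_carrier quotient_add quotient_smult M.a_ac
    smult_l_distr smult_r_distr smult_assoc1)

text \<open>A linear map that vanishes on \<open>N\<close> is constant on each coset, so the image
  is a singleton and \<open>the_elem\<close> reads off its value. Every lift in the definitions has
  this form.\<close>

lemma the_elem_coset:
  assumes "Module.module K P" "F \<in> linear_map K M P" "\<And>x. x \<in> N \<Longrightarrow> F x = \<zero>\<^bsub>P\<^esub>" "x \<in> carrier M"
  shows "the_elem (F ` (N +>\<^bsub>M\<^esub> x)) = F x"
proof -
  interpret P: Module.module K P by fact
  have "F z = F x" if z: "z \<in> N +>\<^bsub>M\<^esub> x" for z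
  proof -
    obtain n where n: "n \<in> N" "z = n \<oplus>\<^bsub>M\<^esub> x" using coset_elem[OF assms(4) z] .
    then have "F z = F n \<oplus>\<^bsub>P\<^esub> F x" using N_subset assms(4) linear_map_add[OF assms(2)] by auto
    then show ?thesis using assms(3)[OF n(1)] linear_map_closed[OF assms(2,4)] by simp
  qed
  then have "F ` (N +>\<^bsub>M\<^esub> x) = (\<lambda>_. F x) ` (N +>\<^bsub>M\<^esub> x)" by (rule image_cong[OF refl])
  also have "\<dots> = {F x}" using S.a_rcos_self[OF assms(4)] by blast
  finally show ?thesis by simp
qed

lemma the_elem_linear:
  assumes "Module.module K P" "F \<in> linear_map K M P" "\<And>x. x \<in> N \<Longrightarrow> F x = \<zero>\<^bsub>P\<^esub>"
  shows "(\<lambda>X. the_elem (F ` X)) \<in> linear_map K Q P"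
  using assms the_elem_coset[OF assms]
  by (intro linear_mapI)
    (auto simp: quotient_carrier quotient_add quotient_smult linear_map_add linear_map_smult linear_map_closed)

lemma quotient_generated:
  assumes "S \<subseteq> carrier M" "generated_submodule K M S = carrier M"
  shows "generated_submodule K Q ((\<lambda>x. N +>\<^bsub>M\<^esub> x) ` S) = carrier Q"
proof
  have sub: "(\<lambda>x. N +>\<^bsub>M\<^esub> x) ` S \<subseteq> carrier Q" using assms(1) by (auto simp: quotient_carrier)
  note G = generated_submodule_submodule[OF quotient_module_module sub]
  interpret Q: Module.module K Q by (rule quotient_module_module)
  show "generated_submodule K Q ((\<lambda>x. N +>\<^bsub>M\<^esub> x) ` S) \<subseteq> carrier Q"
    by (rule Q.submoduleE(1)[OF G])
  show "carrier Q \<subseteq> generated_submodule K Q ((\<lambda>x. N +>\<^bsub>M\<^esub> x) ` S)" (is "_ \<subseteq> ?G")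
  proof
    fix X assume "X \<in> carrier Q"
    then obtain x where x: "x \<in> carrier M" "X = N +>\<^bsub>M\<^esub> x" by (auto simp: quotient_carrier)
    have "N +>\<^bsub>M\<^esub> x \<in> ?G"
      using module_axioms assms(1) x(1)[folded assms(2)]
    proof (induction rule: generated_submodule_induct)
      case (gen x)
      then show ?case by (intro subsetD[OF generated_submodule_subset]) auto
    next
      case zero
      have "N +>\<^bsub>M\<^esub> \<zero>\<^bsub>M\<^esub> = \<zero>\<^bsub>Q\<^esub>" using N_subset by (simp add: quotient_zero)
      then show ?case using subgroup.one_closed[OF submodule.axioms(1)[OF G]] by simp
    next
      case (add x y)
      then show ?case
        using Q.submoduleE(5)[OF G, of "N +>\<^bsub>M\<^esub> x" "N +>\<^bsub>M\<^esub> y"] by (simp add: quotient_add)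
    next
      case (smult c x)
      then show ?case
        using Q.submoduleE(4)[OF G, of c "N +>\<^bsub>M\<^esub> x"] by (simp add: quotient_smult)
    qed
    then show "X \<in> ?G" using x by simp
  qed
qed

end

section \<open>Tensor products\<close>

lemma bilinear_map_cong:
  assumes "Module.module K M" "Module.module K N" "bilinear_map K M N P \<beta>"
    "\<And>x y. \<lbrakk>x \<in> carrier M; y \<in> carrier N\<rbrakk> \<Longrightarrow> \<beta> x y = \<gamma> x y"
  shows "bilinear_map K M N P \<gamma>"
proof -
  interpret M: Module.module K M by fact
  interpret N: Module.module K N by fact
  show ?thesis using assms(3)
    by (auto simp: bilinear_map_def linear_map_def Pi_iff assms(4)[symmetric])
qed

text \<open>Module notions ignore the \<open>mult\<close> and \<open>one\<close> fields. This rule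
  and the following ones allow results about T to be reused verbatim when its multiplication is
  replaced by \<bullet>.\<close>

lemma generated_submodule_update [simp]:
  "generated_submodule K (M\<lparr>mult := m\<rparr>) S = generated_submodule K M S"
  "generated_submodule K (M\<lparr>one := u\<rparr>) S = generated_submodule K M S"
  by (simp_all add: generated_submodule_def submodule_def submodule_axioms_def)

lemma linear_map_update [simp]:
  "linear_map K M (N\<lparr>mult := m\<rparr>) = linear_map K M N"
  "linear_map K (M\<lparr>mult := m'\<rparr>) N = linear_map K M N"
  by (simp_all add: linear_map_def)

lemma tensor_lift_update [simp]:
  "tensor_lift K (M\<lparr>mult := m\<rparr>) \<beta> X = tensor_lift K M \<beta> X"
  "tensor_lift K (M\<lparr>one := u\<rparr>) \<beta> X = tensor_lift K M \<beta> X"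
  by (simp_all add: tensor_lift_def free_lift_def finsum_def)

lemma tensor_null_update [simp]:
  "tensor_null K (M\<lparr>mult := m\<rparr>) (N\<lparr>mult := n\<rparr>) = tensor_null K M N"
  by (simp add: tensor_null_def tensor_relations_def)

lemma pure_tensor_update [simp]:
  "pure_tensor K (M\<lparr>mult := m\<rparr>) (N\<lparr>mult := n\<rparr>) = pure_tensor K M N"
  by (simp add: pure_tensor_def fun_eq_iff)

text \<open>New multiplications on the factors affect only the multiplication of the tensor product.
  The right-hand side repeats the \<open>mult\<close> of the left-hand side on purpose: everything
  else is that of the old tensor product.\<close>

lemma tensor_product_update:
  "tensor_product K (M\<lparr>mult := m\<rparr>) (N\<lparr>mult := n\<rparr>) = (tensor_product K M N)
    \<lparr>mult := mult (tensor_product K (M\<lparr>mult := m\<rparr>) (N\<lparr>mult := n\<rparr>))\<rparr>"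
  by (simp add: tensor_product_def Let_def)

locale two_modules = M: Module.module K M + N: Module.module K N
  for K :: "('k, 'r) ring_scheme" (structure) and M :: "('k, 'a, 'm) module_scheme" (structure)
    and N :: "('k, 'b, 'n) module_scheme" (structure)
begin

abbreviation "F \<equiv> free_module K (carrier M \<times> carrier N)"
abbreviation "MN \<equiv> tensor_product K M N"
abbreviation "pure \<equiv> pure_tensor K M N"

lemma F_module: "Module.module K F" by (rule M.R.free_module_module)

lemma relations_subset: "tensor_relations K M N \<subseteq> carrier F"
proof -
  interpret F: Module.module K F by (rule F_module)
  show ?thesis
    unfolding tensor_relations_def Let_def
    by (auto intro!: F.minus_closed F.M.add.m_closed F.smult_closed M.R.free_gen_closed)
qed

sublocale quot: module_quotient K F "tensor_null K M N"
  by (intro module_quotient.intro module_quotient_axioms.intro F_module)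
    (simp add: tensor_null_def generated_submodule_submodule F_module relations_subset)

lemma linear_map_tensor:
  "linear_map K P MN = linear_map K P quot.Q" "linear_map K MN P = linear_map K quot.Q P"
  by (simp_all add: linear_map_def tensor_product_def Let_def)

lemma tensor_module: "Module.module K MN"
  by (rule module_cong[OF quot.quotient_module_module]) (simp_all add: tensor_product_def Let_def)

lemma tensor_carrier: "carrier MN = carrier quot.Q"
  and tensor_add: "add MN = add quot.Q"
  and tensor_smult: "module.smult MN = module.smult quot.Q"
  by (simp_all add: tensor_product_def Let_def)

lemma pure_eq: "pure x y = tensor_null K M N +>\<^bsub>F\<^esub> free_gen K (x, y)"
  by (simp add: pure_tensor_def)

lemma pure_closed: "\<lbrakk>x \<in> carrier M; y \<in> carrier N\<rbrakk> \<Longrightarrow> pure x y \<in> carrier MN"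
  by (auto simp: pure_eq tensor_carrier quot.quotient_carrier M.R.free_gen_closed)

text \<open>The common part of the two combination lemmas below. With the pairs \<open>p\<close>,
  \<open>q\<close>, \<open>r\<close> left abstract, one statement serves for relations in either
  slot.\<close>

lemma pure_relation:
  assumes "free_gen K p \<ominus>\<^bsub>F\<^esub> (c \<odot>\<^bsub>F\<^esub> free_gen K q \<oplus>\<^bsub>F\<^esub> d \<odot>\<^bsub>F\<^esub> free_gen K r) \<in> tensor_relations K M N"
    and "p \<in> carrier M \<times> carrier N" "q \<in> carrier M \<times> carrier N" "r \<in> carrier M \<times> carrier N"
    and "c \<in> carrier K" "d \<in> carrier K"
  shows "pure (fst p) (snd p) = c \<odot>\<^bsub>MN\<^esub> pure (fst q) (snd q) \<oplus>\<^bsub>MN\<^esub> d \<odot>\<^bsub>MN\<^esub> pure (fst r) (snd r)"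
proof -
  interpret F: Module.module K F by (rule F_module)
  have g: "free_gen K p \<in> carrier F" "free_gen K q \<in> carrier F" "free_gen K r \<in> carrier F"
    using assms(2-4) by (auto intro!: M.R.free_gen_closed)
  have "tensor_null K M N +>\<^bsub>F\<^esub> free_gen K p =
      tensor_null K M N +>\<^bsub>F\<^esub> (c \<odot>\<^bsub>F\<^esub> free_gen K q \<oplus>\<^bsub>F\<^esub> d \<odot>\<^bsub>F\<^esub> free_gen K r)"
    using assms(5,6) g subsetD[OF generated_submodule_subset assms(1)]
    by (intro quot.coset_eqI) (simp_all add: tensor_null_def)
  then show ?thesis using g assms(5,6)
    by (simp add: pure_eq tensor_add tensor_smult quot.quotient_add quot.quotient_smult)
qed

lemma pure_combination_left:
  assumes "c \<in> carrier K" "d \<in> carrier K" "x \<in> carrier M" "x' \<in> carrier M" "y \<in> carrier N"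
  shows "pure (c \<odot>\<^bsub>M\<^esub> x \<oplus>\<^bsub>M\<^esub> d \<odot>\<^bsub>M\<^esub> x') y = c \<odot>\<^bsub>MN\<^esub> pure x y \<oplus>\<^bsub>MN\<^esub> d \<odot>\<^bsub>MN\<^esub> pure x' y"
  using assms
  by (intro pure_relation[of "(_, _)" _ "(_, _)" _ "(_, _)", simplified])
    (auto simp: tensor_relations_def Let_def)

lemma pure_combination_right:
  assumes "c \<in> carrier K" "d \<in> carrier K" "x \<in> carrier M" "y \<in> carrier N" "y' \<in> carrier N"
  shows "pure x (c \<odot>\<^bsub>N\<^esub> y \<oplus>\<^bsub>N\<^esub> d \<odot>\<^bsub>N\<^esub> y') = c \<odot>\<^bsub>MN\<^esub> pure x y \<oplus>\<^bsub>MN\<^esub> d \<odot>\<^bsub>MN\<^esub> pure x y'"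
  using assms
  by (intro pure_relation[of "(_, _)" _ "(_, _)" _ "(_, _)", simplified])
    (auto simp: tensor_relations_def Let_def)

lemma pure_bilinear: "bilinear_map K M N MN pure"
proof -
  interpret T: Module.module K MN by (rule tensor_module)
  show ?thesis
  proof (rule bilinear_mapI)
    fix x y assume xy: "x \<in> carrier M" "y \<in> carrier N"
    show "pure x y \<in> carrier MN" using xy by (rule pure_closed)
    fix c assume c: "c \<in> carrier K"
    show "pure x (c \<odot>\<^bsub>N\<^esub> y) = c \<odot>\<^bsub>MN\<^esub> pure x y"
      \<comment> \<open>The relations combine additivity and homogeneity; the second coefficient 0
        isolates homogeneity, and below both coefficients 1 isolate additivity.\<close>
      using pure_combination_right[of c "\<zero>\<^bsub>K\<^esub>" x y y] xy c pure_closed[OF xy] by simp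
    show "pure (c \<odot>\<^bsub>M\<^esub> x) y = c \<odot>\<^bsub>MN\<^esub> pure x y"
      using pure_combination_left[of c "\<zero>\<^bsub>K\<^esub>" x x y] xy c pure_closed[OF xy] by simp
  next
    fix x y z assume xy: "x \<in> carrier M" "y \<in> carrier N" "z \<in> carrier N"
    show "pure x (y \<oplus>\<^bsub>N\<^esub> z) = pure x y \<oplus>\<^bsub>MN\<^esub> pure x z"
      using pure_combination_right[of "\<one>\<^bsub>K\<^esub>" "\<one>\<^bsub>K\<^esub>" x y z] xy pure_closed by simp
  next
    fix x y z assume xy: "x \<in> carrier M" "y \<in> carrier M" "z \<in> carrier N"
    show "pure (x \<oplus>\<^bsub>M\<^esub> y) z = pure x z \<oplus>\<^bsub>MN\<^esub> pure y z"
      using pure_combination_left[of "\<one>\<^bsub>K\<^esub>" "\<one>\<^bsub>K\<^esub>" x y z] xy pure_closed by simp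
  qed
qed

lemma tensor_generated:
  "generated_submodule K MN ((\<lambda>(x, y). pure x y) ` (carrier M \<times> carrier N)) = carrier MN"
proof -
  have "generated_submodule K quot.Q
      ((\<lambda>f. tensor_null K M N +>\<^bsub>F\<^esub> f) ` free_gen K ` (carrier M \<times> carrier N)) = carrier quot.Q"
    by (rule quot.quotient_generated) (auto simp: M.R.free_module_generated M.R.free_gen_closed)
  moreover have "(\<lambda>f. tensor_null K M N +>\<^bsub>F\<^esub> f) ` free_gen K ` (carrier M \<times> carrier N)
      = (\<lambda>(x, y). pure x y) ` (carrier M \<times> carrier N)"
    unfolding image_image by (rule image_cong) (auto simp: pure_eq)
  moreover have "generated_submodule K MN S = generated_submodule K quot.Q S" for S
    by (simp add: tensor_product_def Let_def generated_submodule_update)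
  ultimately show ?thesis by (simp add: tensor_carrier)
qed

text \<open>The replacement for Sweedler calculus: an identity wanted at \<Delta> h is stated for an
  arbitrary \<open>X\<close> and checked on pure tensors, which generate.\<close>

lemma tensor_eqI:
  assumes "Module.module K P" "f \<in> linear_map K MN P" "g \<in> linear_map K MN P" "X \<in> carrier MN"
    and "\<And>x y. \<lbrakk>x \<in> carrier M; y \<in> carrier N\<rbrakk> \<Longrightarrow> f (pure x y) = g (pure x y)"
  shows "f X = g X"
  by (rule linear_map_eq_on_generated[OF tensor_module assms(1) _ assms(2,3) _ assms(4)[folded tensor_generated]])
    (auto simp: assms(5) intro: pure_closed)

context
  fixes P :: "('k, 'c, 'p) module_scheme" and \<beta>
  assumes P: "Module.module K P" and \<beta>: "bilinear_map K M N P \<beta>"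
begin

lemma free_lift_bilinear: "free_lift K P (\<lambda>(x, y). \<beta> x y) \<in> linear_map K F P"
  using \<beta> by (intro M.R.free_lift_linear P) (auto intro: bilinear_map_closed)

lemma free_lift_bilinear_gen:
  "\<lbrakk>x \<in> carrier M; y \<in> carrier N\<rbrakk> \<Longrightarrow> free_lift K P (\<lambda>(x, y). \<beta> x y) (free_gen K (x, y)) = \<beta> x y"
  using M.R.free_lift_gen[of P "carrier M \<times> carrier N" "\<lambda>(x, y). \<beta> x y" "(x, y)"] P \<beta>
  by (auto intro: bilinear_map_closed)

text \<open>Linearity of \<beta> in the first slot kills the first family of relations, linearity in
  the second slot the other one; the rest of the null module follows by linearity.\<close>

lemma free_lift_null:
  assumes "z \<in> tensor_null K M N"
  shows "free_lift K P (\<lambda>(x, y). \<beta> x y) z = \<zero>\<^bsub>P\<^esub>"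
proof -
  interpret P: Module.module K P by (rule P)
  interpret F: Module.module K F by (rule F_module)
  let ?L = "free_lift K P (\<lambda>(x, y). \<beta> x y)"
  have L: "?L (free_gen K (x, y) \<ominus>\<^bsub>F\<^esub> (c \<odot>\<^bsub>F\<^esub> free_gen K (x', y') \<oplus>\<^bsub>F\<^esub> d \<odot>\<^bsub>F\<^esub> free_gen K (x'', y'')))
     = \<beta> x y \<ominus>\<^bsub>P\<^esub> (c \<odot>\<^bsub>P\<^esub> \<beta> x' y' \<oplus>\<^bsub>P\<^esub> d \<odot>\<^bsub>P\<^esub> \<beta> x'' y'')"
    if "x \<in> carrier M" "x' \<in> carrier M" "x'' \<in> carrier M"
      "y \<in> carrier N" "y' \<in> carrier N" "y'' \<in> carrier N" "c \<in> carrier K" "d \<in> carrier K"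
    for c d x x' x'' y y' y''
    using that
    by (simp add: linear_map_minus[OF F_module P free_lift_bilinear]
        linear_map_add[OF free_lift_bilinear] linear_map_smult[OF free_lift_bilinear]
        free_lift_bilinear_gen M.R.free_gen_closed)
  show ?thesis
    using assms unfolding tensor_null_def
  proof (rule linear_map_vanish_on_generated[OF F_module P relations_subset free_lift_bilinear, rotated])
    fix z assume "z \<in> tensor_relations K M N"
    then show "?L z = \<zero>\<^bsub>P\<^esub>"
      using \<beta> unfolding tensor_relations_def Let_def
      by (auto simp: L linear_map_add[OF bilinear_map_right[OF \<beta>]] linear_map_smult[OF bilinear_map_right[OF \<beta>]]
         linear_map_add[OF bilinear_map_left[OF \<beta>]] linear_map_smult[OF bilinear_map_left[OF \<beta>]]
         bilinear_map_closed[OF \<beta>] P.r_neg P.minus_eq)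
  qed
qed

lemma tensor_lift_pure:
  "\<lbrakk>x \<in> carrier M; y \<in> carrier N\<rbrakk> \<Longrightarrow> tensor_lift K P \<beta> (pure x y) = \<beta> x y"
  unfolding tensor_lift_def pure_eq
  by (subst quot.the_elem_coset[OF P free_lift_bilinear free_lift_null])
    (auto simp: free_lift_bilinear_gen intro!: M.R.free_gen_closed)

lemma tensor_lift_linear: "tensor_lift K P \<beta> \<in> linear_map K MN P"
  unfolding linear_map_tensor tensor_lift_def[abs_def]
  by (rule quot.the_elem_linear[OF P free_lift_bilinear free_lift_null])

lemma tensor_lift_closed: "X \<in> carrier MN \<Longrightarrow> tensor_lift K P \<beta> X \<in> carrier P"
  by (rule linear_map_closed[OF tensor_lift_linear])

end

lemma linear_tensor_lift:
  assumes "Module.module K P" "bilinear_map K M N P \<beta>"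
    and "Module.module K P'" "f \<in> linear_map K P P'" "X \<in> carrier MN"
  shows "f (tensor_lift K P \<beta> X) = tensor_lift K P' (\<lambda>x y. f (\<beta> x y)) X"
proof -
  note b = bilinear_map_post_compose[OF assms(2,4)]
  show ?thesis
    by (rule tensor_eqI[OF assms(3) linear_map_compose[OF tensor_lift_linear[OF assms(1,2)] assms(4)]
          tensor_lift_linear[OF assms(3) b] assms(5)])
      (simp add: tensor_lift_pure[OF assms(1,2)] tensor_lift_pure[OF assms(3) b])
qed

lemma tensor_lift_cong:
  assumes "Module.module K P" "bilinear_map K M N P \<beta>"
    and "\<And>x y. \<lbrakk>x \<in> carrier M; y \<in> carrier N\<rbrakk> \<Longrightarrow> \<beta> x y = \<gamma> x y" "X \<in> carrier MN"
  shows "tensor_lift K P \<beta> X = tensor_lift K P \<gamma> X"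
proof -
  have g: "bilinear_map K M N P \<gamma>"
    by (rule bilinear_map_cong[OF _ _ assms(2,3)]) unfold_locales
  show ?thesis
    by (rule tensor_eqI[OF assms(1) tensor_lift_linear[OF assms(1,2)] tensor_lift_linear[OF assms(1) g] assms(4)])
      (simp add: tensor_lift_pure[OF assms(1,2)] tensor_lift_pure[OF assms(1) g] assms(3))
qed

lemma tensor_lift_sum:
  assumes "Module.module K P" "bilinear_map K M N P \<beta>" "bilinear_map K M N P \<gamma>" "X \<in> carrier MN"
  shows "tensor_lift K P (\<lambda>x y. \<beta> x y \<oplus>\<^bsub>P\<^esub> \<gamma> x y) X = tensor_lift K P \<beta> X \<oplus>\<^bsub>P\<^esub> tensor_lift K P \<gamma> X"
proof -
  note b = bilinear_map_sum[OF assms(1-3)]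
  show ?thesis
    by (rule tensor_eqI[OF assms(1) tensor_lift_linear[OF assms(1) b] linear_map_sum[OF assms(1)
            tensor_lift_linear[OF assms(1,2)] tensor_lift_linear[OF assms(1,3)]] assms(4)])
      (simp add: tensor_lift_pure[OF assms(1,2)] tensor_lift_pure[OF assms(1,3)] tensor_lift_pure[OF assms(1) b])
qed

text \<open>Complements \<open>tensor_lift_linear\<close>: there the tensor varies, here the
  bilinear map does. Nested lifts need both, as in the multiplication of a tensor product, the
  associator, and \<bullet> in its first argument.\<close>

lemma tensor_lift_param_linear:
  assumes "Module.module K P" "Module.module K A" "X \<in> carrier MN"
    and bil: "\<And>a. a \<in> carrier A \<Longrightarrow> bilinear_map K M N P (\<beta> a)"
    and lin: "\<And>x y. \<lbrakk>x \<in> carrier M; y \<in> carrier N\<rbrakk> \<Longrightarrow> (\<lambda>a. \<beta> a x y) \<in> linear_map K A P"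
  shows "(\<lambda>a. tensor_lift K P (\<beta> a) X) \<in> linear_map K A P"
proof (rule linear_mapI)
  interpret A: Module.module K A by fact
  fix a assume a: "a \<in> carrier A"
  show "tensor_lift K P (\<beta> a) X \<in> carrier P"
    by (rule tensor_lift_closed[OF assms(1) bil[OF a] assms(3)])
  { fix c assume c: "c \<in> carrier K"
    then have ca: "c \<odot>\<^bsub>A\<^esub> a \<in> carrier A" using a by simp
    show "tensor_lift K P (\<beta> (c \<odot>\<^bsub>A\<^esub> a)) X = c \<odot>\<^bsub>P\<^esub> tensor_lift K P (\<beta> a) X"
      unfolding linear_tensor_lift[OF assms(1) bil[OF a] assms(1) linear_map_smult_const[OF assms(1) c] assms(3)]
      by (rule tensor_lift_cong[OF assms(1) bil[OF ca] _ assms(3)]) (rule linear_map_smult[OF lin _ a], auto simp: c) }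
  fix b assume b: "b \<in> carrier A"
  then have ab: "a \<oplus>\<^bsub>A\<^esub> b \<in> carrier A" using a by simp
  show "tensor_lift K P (\<beta> (a \<oplus>\<^bsub>A\<^esub> b)) X = tensor_lift K P (\<beta> a) X \<oplus>\<^bsub>P\<^esub> tensor_lift K P (\<beta> b) X"
    unfolding tensor_lift_sum[OF assms(1) bil[OF a] bil[OF b] assms(3), symmetric]
    by (rule tensor_lift_cong[OF assms(1) bil[OF ab] _ assms(3)]) (rule linear_map_add[OF lin _ _], auto simp: a b)
qed

section \<open>The multiplication on a tensor product of two modules with bilinear products\<close>

context
  assumes multM: "bilinear_map K M M M (mult M)" and multN: "bilinear_map K N N N (mult N)"
begin

lemma tensor_mult_inner_bilinear:
  assumes "x \<in> carrier M" "y \<in> carrier N"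
  shows "bilinear_map K M N MN (\<lambda>x' y'. pure (x \<otimes>\<^bsub>M\<^esub> x') (y \<otimes>\<^bsub>N\<^esub> y'))"
  using assms
  by (auto intro!: bilinear_map_compose[OF pure_bilinear] bilinear_map_right[OF multM] bilinear_map_right[OF multN])

lemma tensor_mult_eq: "X \<otimes>\<^bsub>MN\<^esub> Y =
  tensor_lift K MN (\<lambda>x y. tensor_lift K MN (\<lambda>x' y'. pure (x \<otimes>\<^bsub>M\<^esub> x') (y \<otimes>\<^bsub>N\<^esub> y')) Y) X"
  by (simp add: tensor_product_def Let_def tensor_lift_update)

lemma tensor_mult_outer_bilinear:
  assumes "Y \<in> carrier MN"
  shows "bilinear_map K M N MN (\<lambda>x y. tensor_lift K MN (\<lambda>x' y'. pure (x \<otimes>\<^bsub>M\<^esub> x') (y \<otimes>\<^bsub>N\<^esub> y')) Y)"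
proof (rule bilinear_mapI_linear)
  fix x assume x: "x \<in> carrier M"
  show "(\<lambda>y. tensor_lift K MN (\<lambda>x' y'. pure (x \<otimes>\<^bsub>M\<^esub> x') (y \<otimes>\<^bsub>N\<^esub> y')) Y) \<in> linear_map K N MN"
    by (rule tensor_lift_param_linear[OF tensor_module N.module_axioms assms tensor_mult_inner_bilinear[OF x]])
     (auto intro!: linear_map_compose[OF bilinear_map_left[OF multN]] bilinear_map_right[OF pure_bilinear]
        bilinear_map_closed[OF multM] x)
next
  fix y assume y: "y \<in> carrier N"
  show "(\<lambda>x. tensor_lift K MN (\<lambda>x' y'. pure (x \<otimes>\<^bsub>M\<^esub> x') (y \<otimes>\<^bsub>N\<^esub> y')) Y) \<in> linear_map K M MN"
    by (rule tensor_lift_param_linear[OF tensor_module M.module_axioms assms tensor_mult_inner_bilinear[OF _ y]])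
     (auto intro!: linear_map_compose[OF bilinear_map_left[OF multM]] bilinear_map_left[OF pure_bilinear]
        bilinear_map_closed[OF multN] y)
qed

lemma tensor_mult_bilinear: "bilinear_map K MN MN MN (mult MN)"
  unfolding tensor_mult_eq[abs_def]
proof (rule bilinear_mapI_linear)
  fix Y assume Y: "Y \<in> carrier MN"
  show "(\<lambda>X. tensor_lift K MN (\<lambda>x y. tensor_lift K MN (\<lambda>x' y'. pure (x \<otimes>\<^bsub>M\<^esub> x') (y \<otimes>\<^bsub>N\<^esub> y')) Y) X)
      \<in> linear_map K MN MN"
    by (rule tensor_lift_linear[OF tensor_module tensor_mult_outer_bilinear[OF Y]])
next
  fix X assume X: "X \<in> carrier MN"
  show "(\<lambda>Y. tensor_lift K MN (\<lambda>x y. tensor_lift K MN (\<lambda>x' y'. pure (x \<otimes>\<^bsub>M\<^esub> x') (y \<otimes>\<^bsub>N\<^esub> y')) Y) X)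
      \<in> linear_map K MN MN"
    by (rule tensor_lift_param_linear[OF tensor_module tensor_module X tensor_mult_outer_bilinear])
     (auto intro!: tensor_lift_linear[OF tensor_module tensor_mult_inner_bilinear])
qed

lemma tensor_mult_pure:
  assumes "x \<in> carrier M" "y \<in> carrier N" "x' \<in> carrier M" "y' \<in> carrier N"
  shows "pure x y \<otimes>\<^bsub>MN\<^esub> pure x' y' = pure (x \<otimes>\<^bsub>M\<^esub> x') (y \<otimes>\<^bsub>N\<^esub> y')"
  using assms
  by (simp add: tensor_mult_eq tensor_lift_pure[OF tensor_module tensor_mult_outer_bilinear]
      tensor_lift_pure[OF tensor_module tensor_mult_inner_bilinear] pure_closed)

end

end

section \<open>The tensor algebra\<close>

locale tensor_algebra_over = V: Module.module K V
  for K :: "('k, 'r) ring_scheme" (structure) and V :: "('k, 'v, 'm) module_scheme" (structure)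
begin

abbreviation "L \<equiv> lists (carrier V)"
abbreviation "W \<equiv> word_algebra K V"
abbreviation "T \<equiv> tensor_algebra K V"
abbreviation "gen \<equiv> free_gen K :: 'v list \<Rightarrow> 'v list \<Rightarrow> 'k"
abbreviation "null \<equiv> tensor_algebra_null K V"
abbreviation "incl \<equiv> tensor_incl K V"

section \<open>The algebra of words under concatenation\<close>

lemma word_algebra_module: "Module.module K W"
  by (rule module_cong[OF V.R.free_module_module]) (simp_all add: word_algebra_def)

lemma word_algebra_simps:
  "carrier W = carrier (free_module K L)" "add W = add (free_module K L)"
  "module.smult W = module.smult (free_module K L)" "\<one>\<^bsub>W\<^esub> = gen []"
  "mult W = (\<lambda>f g w. \<Oplus>\<^bsub>K\<^esub>i\<in>{..length w}. f (take i w) \<otimes>\<^bsub>K\<^esub> g (drop i w))"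
  "\<zero>\<^bsub>W\<^esub> = \<zero>\<^bsub>free_module K L\<^esub>"
  by (simp_all add: word_algebra_def)

lemma gen_closed: "w \<in> L \<Longrightarrow> gen w \<in> carrier W"
  by (simp only: word_algebra_simps V.R.free_gen_closed)

lemma gen_image: "gen ` L \<subseteq> carrier W"
  by (rule image_subsetI) (rule gen_closed)

lemma linear_map_word_algebra: "linear_map K W P = linear_map K (free_module K L) P"
  by (simp add: linear_map_def word_algebra_simps)

lemma word_algebra_generated: "generated_submodule K W (gen ` L) = carrier W"
  unfolding word_algebra_def by (simp add: generated_submodule_update V.R.free_module_generated)

lemma word_algebra_value: "f \<in> carrier W \<Longrightarrow> f w \<in> carrier K"
  by (simp add: word_algebra_simps free_module_carrier)

text \<open>A nonzero coefficient at \<open>w\<close> requires a cut of \<open>w\<close> into a word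
  of the support of \<open>f\<close> and a word of the support of \<open>g\<close>. So the support
  of the product lies in a finite set of concatenations.\<close>

lemma word_mult_closed:
  assumes "f \<in> carrier W" "g \<in> carrier W"
  shows "f \<otimes>\<^bsub>W\<^esub> g \<in> carrier W"
proof -
  note f = assms[unfolded word_algebra_simps free_module_carrier]
  have supp: "{w. (f \<otimes>\<^bsub>W\<^esub> g) w \<noteq> \<zero>\<^bsub>K\<^esub>}
      \<subseteq> (\<lambda>(u, v). u @ v) ` ({u. f u \<noteq> \<zero>\<^bsub>K\<^esub>} \<times> {v. g v \<noteq> \<zero>\<^bsub>K\<^esub>})"
  proof (rule subsetI, rule ccontr)
    fix w assume w: "w \<in> {w. (f \<otimes>\<^bsub>W\<^esub> g) w \<noteq> \<zero>\<^bsub>K\<^esub>}"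
      and n: "w \<notin> (\<lambda>(u, v). u @ v) ` ({u. f u \<noteq> \<zero>\<^bsub>K\<^esub>} \<times> {v. g v \<noteq> \<zero>\<^bsub>K\<^esub>})"
    have "f (take i w) \<otimes>\<^bsub>K\<^esub> g (drop i w) = \<zero>\<^bsub>K\<^esub>" for i
    proof -
      have "f (take i w) = \<zero>\<^bsub>K\<^esub> \<or> g (drop i w) = \<zero>\<^bsub>K\<^esub>"
        using n append_take_drop_id[of i w] by (force simp: image_iff)
      then show ?thesis using f by auto
    qed
    then have "(f \<otimes>\<^bsub>W\<^esub> g) w = \<zero>\<^bsub>K\<^esub>" by (simp add: word_algebra_simps)
    then show False using w by simp
  qed
  have "finite ((\<lambda>(u, v). u @ v) ` ({u. f u \<noteq> \<zero>\<^bsub>K\<^esub>} \<times> {v. g v \<noteq> \<zero>\<^bsub>K\<^esub>}))"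
    using f by blast
  then have fin: "finite {w. (f \<otimes>\<^bsub>W\<^esub> g) w \<noteq> \<zero>\<^bsub>K\<^esub>}" using supp finite_subset by blast
  have "(\<lambda>(u, v). u @ v) ` ({u. f u \<noteq> \<zero>\<^bsub>K\<^esub>} \<times> {v. g v \<noteq> \<zero>\<^bsub>K\<^esub>}) \<subseteq> L"
    using f by (fastforce simp: append_in_lists_conv simp del: in_lists_conv_set)
  then have sub: "{w. (f \<otimes>\<^bsub>W\<^esub> g) w \<noteq> \<zero>\<^bsub>K\<^esub>} \<subseteq> L" using supp by blast
  have "(f \<otimes>\<^bsub>W\<^esub> g) w \<in> carrier K" for w
    using f by (auto simp: word_algebra_simps intro!: V.R.finsum_closed)
  then show ?thesis using fin sub
    by (subst word_algebra_simps(1)) (auto simp: free_module_carrier)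
qed

lemma word_mult_bilinear: "bilinear_map K W W W (mult W)"
proof (rule bilinear_mapI)
  fix f g assume fg: "f \<in> carrier W" "g \<in> carrier W"
  note v = fg[THEN word_algebra_value]
  show "f \<otimes>\<^bsub>W\<^esub> g \<in> carrier W" using fg by (rule word_mult_closed)
  fix c assume c: "c \<in> carrier K"
  show "f \<otimes>\<^bsub>W\<^esub> (c \<odot>\<^bsub>W\<^esub> g) = c \<odot>\<^bsub>W\<^esub> (f \<otimes>\<^bsub>W\<^esub> g)"
    using v c
    by (auto simp: word_algebra_simps free_module_simps V.R.finsum_rdistr V.R.m_lcomm intro!: V.R.finsum_cong')
  show "(c \<odot>\<^bsub>W\<^esub> f) \<otimes>\<^bsub>W\<^esub> g = c \<odot>\<^bsub>W\<^esub> (f \<otimes>\<^bsub>W\<^esub> g)"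
    using v c
    by (auto simp: word_algebra_simps free_module_simps V.R.finsum_rdistr V.R.m_assoc intro!: V.R.finsum_cong')
next
  fix f g h assume fgh: "f \<in> carrier W" "g \<in> carrier W" "h \<in> carrier W"
  note v = fgh[THEN word_algebra_value]
  show "f \<otimes>\<^bsub>W\<^esub> (g \<oplus>\<^bsub>W\<^esub> h) = f \<otimes>\<^bsub>W\<^esub> g \<oplus>\<^bsub>W\<^esub> f \<otimes>\<^bsub>W\<^esub> h"
    using v by (simp add: word_algebra_simps free_module_simps V.R.r_distr V.R.finsum_addf)
  show "(f \<oplus>\<^bsub>W\<^esub> g) \<otimes>\<^bsub>W\<^esub> h = f \<otimes>\<^bsub>W\<^esub> h \<oplus>\<^bsub>W\<^esub> g \<otimes>\<^bsub>W\<^esub> h"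
    using v by (simp add: word_algebra_simps free_module_simps V.R.l_distr V.R.finsum_addf)
qed

text \<open>A cut of \<open>w\<close> contributes only if its parts are \<open>u\<close> and
  \<open>v\<close>, which forces \<open>i = length u\<close>. If \<open>w\<close> is shorter than
  \<open>u\<close>, this index is out of range and \<open>w\<close> differs from
  \<open>u @ v\<close>, so both sides vanish.\<close>

lemma gen_mult: "gen u \<otimes>\<^bsub>W\<^esub> gen v = gen (u @ v)"
proof
  fix w
  have eq: "gen u (take i w) \<otimes>\<^bsub>K\<^esub> gen v (drop i w) =
      (if length u = i then gen (u @ v) w else \<zero>\<^bsub>K\<^esub>)" if "i \<in> {..length w}" for i
    using that append_take_drop_id[of i w] by (auto simp: free_gen_def)
  have "(gen u \<otimes>\<^bsub>W\<^esub> gen v) w =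
      (\<Oplus>\<^bsub>K\<^esub>i\<in>{..length w}. if length u = i then gen (u @ v) w else \<zero>\<^bsub>K\<^esub>)"
    unfolding word_algebra_simps
    by (rule V.R.finsum_cong'[OF refl _ eq]) (auto simp: free_gen_def)
  also have "\<dots> = gen (u @ v) w"
  proof (cases "length u \<le> length w")
    case True
    then show ?thesis by (intro V.R.add.finprod_singleton) (auto simp: free_gen_def)
  next
    case False
    then have "w \<noteq> u @ v" by auto
    then show ?thesis by (auto simp: free_gen_def intro!: V.R.add.finprod_one_eqI)
  qed
  finally show "(gen u \<otimes>\<^bsub>W\<^esub> gen v) w = gen (u @ v) w" .
qed

lemma word_algebra_linear_eqI:
  assumes "Module.module K P" "f \<in> linear_map K W P" "g \<in> linear_map K W P" "x \<in> carrier W"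
    and "\<And>w. w \<in> L \<Longrightarrow> f (gen w) = g (gen w)"
  shows "f x = g x"
  by (rule linear_map_eq_on_generated[OF word_algebra_module assms(1) gen_image assms(2,3) _
        assms(4)[folded word_algebra_generated]])
    (erule imageE, simp only: assms(5))

lemma word_mult_assoc:
  assumes "f \<in> carrier W" "g \<in> carrier W" "h \<in> carrier W"
  shows "(f \<otimes>\<^bsub>W\<^esub> g) \<otimes>\<^bsub>W\<^esub> h = f \<otimes>\<^bsub>W\<^esub> (g \<otimes>\<^bsub>W\<^esub> h)"
proof -
  note l = bilinear_map_left[OF word_mult_bilinear] and r = bilinear_map_right[OF word_mult_bilinear]
    and c = word_mult_closed
  \<comment> \<open>Trilinearity is spent one argument at a time: first \<open>h\<close>, then
    \<open>g\<close>, then \<open>f\<close> is reduced to words, where associativity is that of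
    \<open>@\<close>.\<close>
  have 1: "(gen u \<otimes>\<^bsub>W\<^esub> gen v) \<otimes>\<^bsub>W\<^esub> h = gen u \<otimes>\<^bsub>W\<^esub> (gen v \<otimes>\<^bsub>W\<^esub> h)" if "u \<in> L" "v \<in> L" for u v
    by (rule word_algebra_linear_eqI[OF word_algebra_module r linear_map_compose[OF r r] assms(3)])
      (use that in \<open>simp_all add: gen_mult gen_closed c\<close>)
  have 2: "(gen u \<otimes>\<^bsub>W\<^esub> g) \<otimes>\<^bsub>W\<^esub> h = gen u \<otimes>\<^bsub>W\<^esub> (g \<otimes>\<^bsub>W\<^esub> h)" if "u \<in> L" for u
    by (rule word_algebra_linear_eqI[OF word_algebra_module linear_map_compose[OF r l]
          linear_map_compose[OF l r] assms(2) 1])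
      (use that assms in \<open>simp_all add: gen_closed c\<close>)
  show ?thesis
    by (rule word_algebra_linear_eqI[OF word_algebra_module linear_map_compose[OF l l]
          l assms(1) 2])
      (use assms in \<open>simp_all add: gen_closed c\<close>)
qed

lemma word_mult_one:
  assumes "f \<in> carrier W"
  shows "\<one>\<^bsub>W\<^esub> \<otimes>\<^bsub>W\<^esub> f = f" "f \<otimes>\<^bsub>W\<^esub> \<one>\<^bsub>W\<^esub> = f"
proof -
  note l = bilinear_map_left[OF word_mult_bilinear] and r = bilinear_map_right[OF word_mult_bilinear]
  have e: "gen [] \<in> carrier W" by (rule gen_closed) simp
  show "\<one>\<^bsub>W\<^esub> \<otimes>\<^bsub>W\<^esub> f = f"
    unfolding word_algebra_simps(4)
    by (rule word_algebra_linear_eqI[OF word_algebra_module r linear_map_id assms]) (simp_all add: gen_mult e)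
  show "f \<otimes>\<^bsub>W\<^esub> \<one>\<^bsub>W\<^esub> = f"
    unfolding word_algebra_simps(4)
    by (rule word_algebra_linear_eqI[OF word_algebra_module l linear_map_id assms]) (simp_all add: gen_mult e)
qed

lemma word_algebra_ring: "ring W"
proof -
  interpret W: Module.module K W by (rule word_algebra_module)
  note l = bilinear_map_left[OF word_mult_bilinear] and r = bilinear_map_right[OF word_mult_bilinear]
  have e: "\<one>\<^bsub>W\<^esub> \<in> carrier W" unfolding word_algebra_simps(4) by (rule gen_closed) simp
  show ?thesis
    by (intro ringI W.abelian_group_axioms monoidI)
      (auto simp: word_mult_closed word_mult_assoc word_mult_one e linear_map_add[OF l] linear_map_add[OF r])
qed

section \<open>The ideal of multilinear relations and the quotient algebra\<close>

lemma multilinear_relations_subset: "multilinear_relations K V \<subseteq> carrier W"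
proof -
  interpret W: Module.module K W by (rule word_algebra_module)
  show ?thesis
    unfolding multilinear_relations_def Let_def
    by (auto intro!: W.minus_closed W.M.add.m_closed W.smult_closed gen_closed)
qed

sublocale quot: module_quotient K W null
  by (intro module_quotient.intro module_quotient_axioms.intro word_algebra_module)
    (simp add: tensor_algebra_null_def generated_submodule_submodule word_algebra_module multilinear_relations_subset)

lemma tensor_algebra_eq: "T = quot.Q"
  by (simp add: tensor_algebra_def)

text \<open>The words \<open>u\<close> and \<open>w\<close> around the varying letter are arbitrary,
  so multiplication by \<open>v\<close> merely lengthens one of them. This is what makes the null
  module an ideal.\<close>

lemma multilinear_relation_mult:
  assumes "z \<in> multilinear_relations K V" "v \<in> L"
  shows "gen v \<otimes>\<^bsub>W\<^esub> z \<in> multilinear_relations K V" "z \<otimes>\<^bsub>W\<^esub> gen v \<in> multilinear_relations K V"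
proof -
  interpret W: ring W by (rule word_algebra_ring)
  interpret W: Module.module K W by (rule word_algebra_module)
  obtain u c x d y w where z: "z = gen (u @ [c \<odot>\<^bsub>V\<^esub> x \<oplus>\<^bsub>V\<^esub> d \<odot>\<^bsub>V\<^esub> y] @ w)
          \<ominus>\<^bsub>W\<^esub> (c \<odot>\<^bsub>W\<^esub> gen (u @ [x] @ w) \<oplus>\<^bsub>W\<^esub> d \<odot>\<^bsub>W\<^esub> gen (u @ [y] @ w))"
    and m: "u \<in> L" "w \<in> L" "c \<in> carrier K" "d \<in> carrier K" "x \<in> carrier V" "y \<in> carrier V"
    using assms(1) unfolding multilinear_relations_def Let_def by blast
  have g: "gen v \<in> carrier W" "gen (u @ [c \<odot>\<^bsub>V\<^esub> x \<oplus>\<^bsub>V\<^esub> d \<odot>\<^bsub>V\<^esub> y] @ w) \<in> carrier W"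
    "gen (u @ [x] @ w) \<in> carrier W" "gen (u @ [y] @ w) \<in> carrier W"
    using m assms(2) by (auto intro!: gen_closed)
  note l = bilinear_map_left[OF word_mult_bilinear g(1)] and r = bilinear_map_right[OF word_mult_bilinear g(1)]
  have "gen v \<otimes>\<^bsub>W\<^esub> z = gen ((v @ u) @ [c \<odot>\<^bsub>V\<^esub> x \<oplus>\<^bsub>V\<^esub> d \<odot>\<^bsub>V\<^esub> y] @ w)
          \<ominus>\<^bsub>W\<^esub> (c \<odot>\<^bsub>W\<^esub> gen ((v @ u) @ [x] @ w) \<oplus>\<^bsub>W\<^esub> d \<odot>\<^bsub>W\<^esub> gen ((v @ u) @ [y] @ w))"
    using g m unfolding z
    by (simp add: linear_map_minus[OF word_algebra_module word_algebra_module r] linear_map_add[OF r]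
        linear_map_smult[OF r] gen_mult)
  moreover have "v @ u \<in> L" using m assms(2) by auto
  ultimately show "gen v \<otimes>\<^bsub>W\<^esub> z \<in> multilinear_relations K V"
    using m unfolding multilinear_relations_def Let_def by blast
  have "z \<otimes>\<^bsub>W\<^esub> gen v = gen (u @ [c \<odot>\<^bsub>V\<^esub> x \<oplus>\<^bsub>V\<^esub> d \<odot>\<^bsub>V\<^esub> y] @ (w @ v))
          \<ominus>\<^bsub>W\<^esub> (c \<odot>\<^bsub>W\<^esub> gen (u @ [x] @ (w @ v)) \<oplus>\<^bsub>W\<^esub> d \<odot>\<^bsub>W\<^esub> gen (u @ [y] @ (w @ v)))"
    using g m unfolding z
    by (simp add: linear_map_minus[OF word_algebra_module word_algebra_module l] linear_map_add[OF l]
        linear_map_smult[OF l] gen_mult)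
  moreover have "w @ v \<in> L" using m assms(2) by auto
  ultimately show "z \<otimes>\<^bsub>W\<^esub> gen v \<in> multilinear_relations K V"
    using m unfolding multilinear_relations_def Let_def by blast
qed

lemma null_mult:
  assumes "z \<in> null" "f \<in> carrier W"
  shows "f \<otimes>\<^bsub>W\<^esub> z \<in> null" "z \<otimes>\<^bsub>W\<^esub> f \<in> null"
proof -
  interpret W: Module.module K W by (rule word_algebra_module)
  note sub = quot.sub
  note zero = subgroup.one_closed[OF submodule.axioms(1)[OF sub], simplified]
  note cl = zero quot.submoduleE(4,5)[OF sub]
  note l = bilinear_map_left[OF word_mult_bilinear] and r = bilinear_map_right[OF word_mult_bilinear]
  \<comment> \<open>Two successive linear extensions: here the word \<open>v\<close> is fixed and
    \<open>z\<close> runs from relations to the null module; afterwards \<open>z\<close> is fixed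
    and the factor runs from words to \<open>f\<close>.\<close>
  have gz: "gen v \<otimes>\<^bsub>W\<^esub> z \<in> null \<and> z \<otimes>\<^bsub>W\<^esub> gen v \<in> null" if v: "v \<in> L" for v
    using word_algebra_module multilinear_relations_subset assms(1)[unfolded tensor_algebra_null_def]
  proof (induction rule: generated_submodule_induct)
    case (gen z)
    then show ?case unfolding tensor_algebra_null_def
      by (intro conjI subsetD[OF generated_submodule_subset] multilinear_relation_mult v)
  qed (simp_all add: linear_map_zero[OF word_algebra_module word_algebra_module l]
      linear_map_zero[OF word_algebra_module word_algebra_module r] gen_closed[OF v] cl
      linear_map_add[OF l] linear_map_add[OF r] linear_map_smult[OF l] linear_map_smult[OF r])
  have z: "z \<in> carrier W" using assms(1) quot.N_subset by auto
  have "f \<otimes>\<^bsub>W\<^esub> z \<in> null \<and> z \<otimes>\<^bsub>W\<^esub> f \<in> null"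
    using word_algebra_module gen_image assms(2)[folded word_algebra_generated]
  proof (induction rule: generated_submodule_induct)
    case (gen f)
    then show ?case using gz by blast
  qed (simp_all add: linear_map_zero[OF word_algebra_module word_algebra_module l]
      linear_map_zero[OF word_algebra_module word_algebra_module r] z cl
      linear_map_add[OF l] linear_map_add[OF r] linear_map_smult[OF l] linear_map_smult[OF r])
  then show "f \<otimes>\<^bsub>W\<^esub> z \<in> null" "z \<otimes>\<^bsub>W\<^esub> f \<in> null" by auto
qed

lemma null_ideal: "ideal null W"
  using null_mult
  by (intro idealI word_algebra_ring submodule.axioms(1)[OF quot.sub]) auto

lemma coset_mult:
  "\<lbrakk>f \<in> carrier W; g \<in> carrier W\<rbrakk>
    \<Longrightarrow> (null +>\<^bsub>W\<^esub> f) \<otimes>\<^bsub>T\<^esub> (null +>\<^bsub>W\<^esub> g) = null +>\<^bsub>W\<^esub> (f \<otimes>\<^bsub>W\<^esub> g)"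
  by (simp add: tensor_algebra_def quotient_module_def ideal.rcoset_mult_add[OF null_ideal])

definition word :: "'v list \<Rightarrow> ('v list \<Rightarrow> 'k) set"
  where "word w = null +>\<^bsub>W\<^esub> gen w"

lemma tensor_algebra_module: "Module.module K T"
  unfolding tensor_algebra_eq by (rule quot.quotient_module_module)

lemma word_closed: "w \<in> L \<Longrightarrow> word w \<in> carrier T"
  by (simp only: word_def tensor_algebra_eq quot.quotient_carrier gen_closed imageI)

lemma word_image: "word ` L \<subseteq> carrier T"
  by (rule image_subsetI) (rule word_closed)

lemma incl_eq: "incl x = word [x]" and one_eq: "\<one>\<^bsub>T\<^esub> = word []"
  by (simp_all add: tensor_incl_def word_def tensor_algebra_def quotient_module_def word_algebra_simps)

lemma word_append: "\<lbrakk>u \<in> L; v \<in> L\<rbrakk> \<Longrightarrow> word u \<otimes>\<^bsub>T\<^esub> word v = word (u @ v)"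
  unfolding word_def by (simp only: coset_mult gen_closed gen_mult)

lemma word_multilinear:
  assumes "u \<in> L" "w \<in> L" "c \<in> carrier K" "d \<in> carrier K" "x \<in> carrier V" "y \<in> carrier V"
  shows "word (u @ [c \<odot>\<^bsub>V\<^esub> x \<oplus>\<^bsub>V\<^esub> d \<odot>\<^bsub>V\<^esub> y] @ w) =
    c \<odot>\<^bsub>T\<^esub> word (u @ [x] @ w) \<oplus>\<^bsub>T\<^esub> d \<odot>\<^bsub>T\<^esub> word (u @ [y] @ w)"
proof -
  interpret W: Module.module K W by (rule word_algebra_module)
  have g: "gen (u @ [c \<odot>\<^bsub>V\<^esub> x \<oplus>\<^bsub>V\<^esub> d \<odot>\<^bsub>V\<^esub> y] @ w) \<in> carrier W"
    "gen (u @ [x] @ w) \<in> carrier W" "gen (u @ [y] @ w) \<in> carrier W"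
    using assms by (auto intro!: gen_closed)
  have "gen (u @ [c \<odot>\<^bsub>V\<^esub> x \<oplus>\<^bsub>V\<^esub> d \<odot>\<^bsub>V\<^esub> y] @ w)
          \<ominus>\<^bsub>W\<^esub> (c \<odot>\<^bsub>W\<^esub> gen (u @ [x] @ w) \<oplus>\<^bsub>W\<^esub> d \<odot>\<^bsub>W\<^esub> gen (u @ [y] @ w)) \<in> multilinear_relations K V"
    using assms unfolding multilinear_relations_def Let_def by blast
  then have "gen (u @ [c \<odot>\<^bsub>V\<^esub> x \<oplus>\<^bsub>V\<^esub> d \<odot>\<^bsub>V\<^esub> y] @ w)
          \<ominus>\<^bsub>W\<^esub> (c \<odot>\<^bsub>W\<^esub> gen (u @ [x] @ w) \<oplus>\<^bsub>W\<^esub> d \<odot>\<^bsub>W\<^esub> gen (u @ [y] @ w)) \<in> null"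
    unfolding tensor_algebra_null_def by (rule subsetD[OF generated_submodule_subset])
  then have "word (u @ [c \<odot>\<^bsub>V\<^esub> x \<oplus>\<^bsub>V\<^esub> d \<odot>\<^bsub>V\<^esub> y] @ w) =
     null +>\<^bsub>W\<^esub> (c \<odot>\<^bsub>W\<^esub> gen (u @ [x] @ w) \<oplus>\<^bsub>W\<^esub> d \<odot>\<^bsub>W\<^esub> gen (u @ [y] @ w))"
    unfolding word_def using g assms by (intro quot.coset_eqI) auto
  then show ?thesis
    using g assms by (simp add: word_def tensor_algebra_eq quot.quotient_add quot.quotient_smult)
qed

lemma tensor_algebra_generated: "generated_submodule K T (word ` L) = carrier T"
  using quot.quotient_generated[OF gen_image word_algebra_generated]
  by (simp add: tensor_algebra_eq word_def[abs_def] image_image)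

lemma tensor_algebra_induct [consumes 1, case_names word zero add smult]:
  assumes "X \<in> carrier T"
    and "\<And>w. w \<in> L \<Longrightarrow> P (word w)" "P \<zero>\<^bsub>T\<^esub>"
    and "\<And>x y. \<lbrakk>x \<in> carrier T; y \<in> carrier T; P x; P y\<rbrakk> \<Longrightarrow> P (x \<oplus>\<^bsub>T\<^esub> y)"
    and "\<And>c x. \<lbrakk>c \<in> carrier K; x \<in> carrier T; P x\<rbrakk> \<Longrightarrow> P (c \<odot>\<^bsub>T\<^esub> x)"
  shows "P X"
  using tensor_algebra_module word_image assms(1)[folded tensor_algebra_generated]
  by (rule generated_submodule_induct) (erule imageE, simp only: assms(2), (fact assms(3-5))+)

lemma tensor_algebra_eqI:
  assumes "Module.module K P" "f \<in> linear_map K T P" "g \<in> linear_map K T P" "X \<in> carrier T"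
    and "\<And>w. w \<in> L \<Longrightarrow> f (word w) = g (word w)"
  shows "f X = g X"
  by (rule linear_map_eq_on_generated[OF tensor_algebra_module assms(1) word_image assms(2,3) _
        assms(4)[folded tensor_algebra_generated]])
    (erule imageE, simp only: assms(5))

lemma word_coset:
  assumes "X \<in> carrier T"
  obtains f where "f \<in> carrier W" "X = null +>\<^bsub>W\<^esub> f"
  using assms by (auto simp: tensor_algebra_eq quot.quotient_carrier)

lemma tensor_algebra_assoc_algebra: "assoc_algebra K T"
proof -
  interpret W: ring W by (rule word_algebra_ring)
  interpret W: Module.module K W by (rule word_algebra_module)
  interpret T: Module.module K T by (rule tensor_algebra_module)
  note l = bilinear_map_left[OF word_mult_bilinear] and r = bilinear_map_right[OF word_mult_bilinear]
  have one: "\<one>\<^bsub>T\<^esub> = null +>\<^bsub>W\<^esub> \<one>\<^bsub>W\<^esub>" by (simp add: tensor_algebra_def quotient_module_def)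
  have add: "(null +>\<^bsub>W\<^esub> f) \<oplus>\<^bsub>T\<^esub> (null +>\<^bsub>W\<^esub> g) = null +>\<^bsub>W\<^esub> (f \<oplus>\<^bsub>W\<^esub> g)"
    if "f \<in> carrier W" "g \<in> carrier W" for f g
    using that by (simp add: tensor_algebra_eq quot.quotient_add)
  have smult: "c \<odot>\<^bsub>T\<^esub> (null +>\<^bsub>W\<^esub> f) = null +>\<^bsub>W\<^esub> (c \<odot>\<^bsub>W\<^esub> f)"
    if "c \<in> carrier K" "f \<in> carrier W" for c f
    using that by (simp add: tensor_algebra_eq quot.quotient_smult)
  have closed: "null +>\<^bsub>W\<^esub> f \<in> carrier T" if "f \<in> carrier W" for f
    using that by (auto simp: tensor_algebra_eq quot.quotient_carrier)
  have mon: "monoid T"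
    by (intro monoidI)
      (auto elim!: word_coset simp: one coset_mult closed W.m_assoc)
  have ring: "ring T"
    by (intro ringI T.abelian_group_axioms mon)
      (auto elim!: word_coset simp: coset_mult add W.l_distr W.r_distr)
  show ?thesis
    by (intro assoc_algebra.intro assoc_algebra_axioms.intro tensor_algebra_module ring)
      (auto elim!: word_coset simp: coset_mult smult linear_map_smult[OF l] linear_map_smult[OF r])
qed

sublocale T: assoc_algebra K T by (rule tensor_algebra_assoc_algebra)

lemma mult_bilinear: "bilinear_map K T T T (mult T)"
  by (intro bilinear_mapI) (auto simp: T.l_distr T.r_distr T.smult_mult_left T.smult_mult_right)

section \<open>Linear maps out of the tensor algebra\<close>

definition multilinear :: "('k, 'c, 'p) module_scheme \<Rightarrow> ('v list \<Rightarrow> 'c) \<Rightarrow> bool"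
  where "multilinear P \<phi> \<longleftrightarrow> (\<forall>w\<in>L. \<phi> w \<in> carrier P) \<and>
    (\<forall>u\<in>L. \<forall>w\<in>L. \<forall>c\<in>carrier K. \<forall>d\<in>carrier K. \<forall>x\<in>carrier V. \<forall>y\<in>carrier V.
      \<phi> (u @ [c \<odot>\<^bsub>V\<^esub> x \<oplus>\<^bsub>V\<^esub> d \<odot>\<^bsub>V\<^esub> y] @ w) = c \<odot>\<^bsub>P\<^esub> \<phi> (u @ [x] @ w) \<oplus>\<^bsub>P\<^esub> d \<odot>\<^bsub>P\<^esub> \<phi> (u @ [y] @ w))"

text \<open>The universal property of T as a direct sum of tensor powers. It serves the algebra
  morphisms below, and also the antipode, whose recursion on words is not an iterated concatenation
  product. The linear extension to words vanishes on each relation by multilinearity, hence on the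
  null module.\<close>

lemma multilinear_lift:
  assumes P: "Module.module K P" and m: "multilinear P \<phi>"
  shows "(\<lambda>X. the_elem (free_lift K P \<phi> ` X)) \<in> linear_map K T P" (is ?lin)
    and "w \<in> L \<Longrightarrow> the_elem (free_lift K P \<phi> ` word w) = \<phi> w" (is "_ \<Longrightarrow> ?val")
proof -
  interpret P: Module.module K P by (rule P)
  interpret W: Module.module K W by (rule word_algebra_module)
  let ?L = "free_lift K P \<phi>"
  have \<phi>: "\<phi> w \<in> carrier P" if "w \<in> L" for w using m that by (auto simp: multilinear_def)
  have lin: "?L \<in> linear_map K W P"
    unfolding linear_map_word_algebra by (rule V.R.free_lift_linear[OF P \<phi>])
  have g: "?L (gen w) = \<phi> w" if "w \<in> L" for w
    by (rule V.R.free_lift_gen[OF P \<phi> that])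
  have rel: "?L z = \<zero>\<^bsub>P\<^esub>" if z: "z \<in> multilinear_relations K V" for z
  proof -
    obtain u c x d y w where z: "z = gen (u @ [c \<odot>\<^bsub>V\<^esub> x \<oplus>\<^bsub>V\<^esub> d \<odot>\<^bsub>V\<^esub> y] @ w)
          \<ominus>\<^bsub>W\<^esub> (c \<odot>\<^bsub>W\<^esub> gen (u @ [x] @ w) \<oplus>\<^bsub>W\<^esub> d \<odot>\<^bsub>W\<^esub> gen (u @ [y] @ w))"
      and m': "u \<in> L" "w \<in> L" "c \<in> carrier K" "d \<in> carrier K" "x \<in> carrier V" "y \<in> carrier V"
      using z unfolding multilinear_relations_def Let_def by blast
    have ls: "u @ [c \<odot>\<^bsub>V\<^esub> x \<oplus>\<^bsub>V\<^esub> d \<odot>\<^bsub>V\<^esub> y] @ w \<in> L" "u @ [x] @ w \<in> L" "u @ [y] @ w \<in> L"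
      using m' by auto
    have "?L z = \<phi> (u @ [c \<odot>\<^bsub>V\<^esub> x \<oplus>\<^bsub>V\<^esub> d \<odot>\<^bsub>V\<^esub> y] @ w)
        \<ominus>\<^bsub>P\<^esub> (c \<odot>\<^bsub>P\<^esub> \<phi> (u @ [x] @ w) \<oplus>\<^bsub>P\<^esub> d \<odot>\<^bsub>P\<^esub> \<phi> (u @ [y] @ w))"
      using ls[THEN gen_closed] m'(3,4) ls[THEN g] unfolding z
      by (simp add: linear_map_minus[OF word_algebra_module P lin] linear_map_add[OF lin] linear_map_smult[OF lin])
    moreover have "\<phi> (u @ [c \<odot>\<^bsub>V\<^esub> x \<oplus>\<^bsub>V\<^esub> d \<odot>\<^bsub>V\<^esub> y] @ w)
       = c \<odot>\<^bsub>P\<^esub> \<phi> (u @ [x] @ w) \<oplus>\<^bsub>P\<^esub> d \<odot>\<^bsub>P\<^esub> \<phi> (u @ [y] @ w)"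
      using m m' unfolding multilinear_def by blast
    ultimately show ?thesis using ls[THEN \<phi>] m'(3,4) by (simp add: P.M.minus_eq P.M.r_neg)
  qed
  have null: "?L z = \<zero>\<^bsub>P\<^esub>" if "z \<in> null" for z
    using linear_map_vanish_on_generated[OF word_algebra_module P multilinear_relations_subset lin rel] that
    by (simp add: tensor_algebra_null_def)
  show ?lin unfolding tensor_algebra_eq by (rule quot.the_elem_linear[OF P lin null])
  show ?val if "w \<in> L"
    unfolding word_def using quot.the_elem_coset[OF P lin null gen_closed[OF that]] g[OF that] by simp
qed

lemma word_foldr_multilinear:
  assumes A: "Module.module K A" and mult: "bilinear_map K A A A (mult A)" and one: "\<one>\<^bsub>A\<^esub> \<in> carrier A"
    and \<phi>: "\<phi> \<in> linear_map K V A"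
  shows "multilinear A (\<lambda>w. foldr (\<lambda>x p. \<phi> x \<otimes>\<^bsub>A\<^esub> p) w \<one>\<^bsub>A\<^esub>)"
proof -
  interpret A: Module.module K A by (rule A)
  let ?f = "\<lambda>w. foldr (\<lambda>x p. \<phi> x \<otimes>\<^bsub>A\<^esub> p) w \<one>\<^bsub>A\<^esub>"
  note l = bilinear_map_left[OF mult] and r = bilinear_map_right[OF mult]
    and \<phi>c = linear_map_closed[OF \<phi>] and mc = bilinear_map_closed[OF mult]
  have cl: "?f w \<in> carrier A" if "w \<in> L" for w
    using that by (induction w) (auto intro: one mc \<phi>c)
  have "?f (u @ [c \<odot>\<^bsub>V\<^esub> x \<oplus>\<^bsub>V\<^esub> d \<odot>\<^bsub>V\<^esub> y] @ w) = c \<odot>\<^bsub>A\<^esub> ?f (u @ [x] @ w) \<oplus>\<^bsub>A\<^esub> d \<odot>\<^bsub>A\<^esub> ?f (u @ [y] @ w)"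
    if "u \<in> L" "w \<in> L" "c \<in> carrier K" "d \<in> carrier K" "x \<in> carrier V" "y \<in> carrier V" for u w c d x y
    using that(1)
  proof (induction u)
    case Nil
    then show ?case using that cl[OF that(2)]
      by (simp add: linear_map_add[OF \<phi>] linear_map_smult[OF \<phi>] \<phi>c linear_map_add[OF l] linear_map_smult[OF l])
  next
    case (Cons a u)
    have u: "u \<in> L" "\<phi> a \<in> carrier A" using Cons by (auto intro: \<phi>c)
    have c': "?f (u @ [x] @ w) \<in> carrier A" "?f (u @ [y] @ w) \<in> carrier A"
      by (rule cl, use u that in simp)+
    then show ?case using Cons.IH u(2) that
      by (simp add: linear_map_add[OF r] linear_map_smult[OF r])
  qed
  with cl show ?thesis by (auto simp: multilinear_def)
qed

text \<open>The \<open>foldr\<close> nests to the right, so prefixing a letter multiplies the value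
  on the left. This rule, linearity and the value at 1 are all that is later used of \<Delta> being
  an algebra morphism.\<close>

lemma tensor_algebra_lift_props:
  assumes A: "Module.module K A" and mult: "bilinear_map K A A A (mult A)" and one: "\<one>\<^bsub>A\<^esub> \<in> carrier A"
    and \<phi>: "\<phi> \<in> linear_map K V A"
  shows "tensor_algebra_lift K A \<phi> \<in> linear_map K T A"
    and "tensor_algebra_lift K A \<phi> \<one>\<^bsub>T\<^esub> = \<one>\<^bsub>A\<^esub>"
    and "\<lbrakk>x \<in> carrier V; h \<in> carrier T\<rbrakk>
      \<Longrightarrow> tensor_algebra_lift K A \<phi> (incl x \<otimes>\<^bsub>T\<^esub> h) = \<phi> x \<otimes>\<^bsub>A\<^esub> tensor_algebra_lift K A \<phi> h"
proof -
  let ?f = "\<lambda>w. foldr (\<lambda>x p. \<phi> x \<otimes>\<^bsub>A\<^esub> p) w \<one>\<^bsub>A\<^esub>"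
  note m = multilinear_lift[OF A word_foldr_multilinear[OF assms]]
  show lin: "tensor_algebra_lift K A \<phi> \<in> linear_map K T A"
    using m(1) by (simp add: tensor_algebra_lift_def[abs_def])
  have val: "tensor_algebra_lift K A \<phi> (word w) = ?f w" if "w \<in> L" for w
    using m(2)[OF that] by (simp add: tensor_algebra_lift_def)
  show "tensor_algebra_lift K A \<phi> \<one>\<^bsub>T\<^esub> = \<one>\<^bsub>A\<^esub>" by (simp add: one_eq val)
  assume x: "x \<in> carrier V" and h: "h \<in> carrier T"
  have xc: "incl x \<in> carrier T" "\<phi> x \<in> carrier A"
    using x linear_map_closed[OF \<phi>] by (auto simp: incl_eq intro!: word_closed)
  show "tensor_algebra_lift K A \<phi> (incl x \<otimes>\<^bsub>T\<^esub> h) = \<phi> x \<otimes>\<^bsub>A\<^esub> tensor_algebra_lift K A \<phi> h"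
    by (rule tensor_algebra_eqI[OF A linear_map_compose[OF bilinear_map_right[OF mult_bilinear xc(1)] lin]
       linear_map_compose[OF lin bilinear_map_right[OF mult xc(2)]] h])
      (use x in \<open>simp add: incl_eq word_append val\<close>)
qed

lemma incl_linear: "incl \<in> linear_map K V T"
proof (rule linear_mapI)
  fix x assume x: "x \<in> carrier V"
  then show "incl x \<in> carrier T" by (auto simp: incl_eq intro!: word_closed)
  fix c assume c: "c \<in> carrier K"
  show "incl (c \<odot>\<^bsub>V\<^esub> x) = c \<odot>\<^bsub>T\<^esub> incl x"
    using word_multilinear[of "[]" "[]" c "\<zero>\<^bsub>K\<^esub>" x x] x c word_closed[of "[x]"] by (simp add: incl_eq)
next
  fix x y assume x: "x \<in> carrier V" "y \<in> carrier V"
  then show "incl (x \<oplus>\<^bsub>V\<^esub> y) = incl x \<oplus>\<^bsub>T\<^esub> incl y"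
    using word_multilinear[of "[]" "[]" "\<one>\<^bsub>K\<^esub>" "\<one>\<^bsub>K\<^esub>" x y] word_closed[of "[x]"] word_closed[of "[y]"]
    by (simp add: incl_eq)
qed

text \<open>Every word in a multilinear relation contains a letter, so relations have coefficient 0
  at the empty word, and reading that coefficient passes to the quotient.\<close>

lemma counit_linear: "tensor_counit \<in> linear_map K T (base_module K)"
  and counit_word: "w \<in> L \<Longrightarrow> tensor_counit (word w) = (if w = [] then \<one>\<^bsub>K\<^esub> else \<zero>\<^bsub>K\<^esub>)"
proof -
  interpret W: Module.module K W by (rule word_algebra_module)
  note B = base_module_module[OF V.R.is_cring]
  interpret B: Module.module K "base_module K" by (rule B)
  have lin: "(\<lambda>f. f []) \<in> linear_map K W (base_module K)"
    by (auto simp: linear_map_def base_module_def word_algebra_simps free_module_simps)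
  have null: "z [] = \<zero>\<^bsub>base_module K\<^esub>" if z: "z \<in> null" for z
    using z unfolding tensor_algebra_null_def
  proof (rule linear_map_vanish_on_generated[OF word_algebra_module B multilinear_relations_subset lin, rotated])
    fix z assume "z \<in> multilinear_relations K V"
    then obtain u c x d y w where z: "z = gen (u @ [c \<odot>\<^bsub>V\<^esub> x \<oplus>\<^bsub>V\<^esub> d \<odot>\<^bsub>V\<^esub> y] @ w)
          \<ominus>\<^bsub>W\<^esub> (c \<odot>\<^bsub>W\<^esub> gen (u @ [x] @ w) \<oplus>\<^bsub>W\<^esub> d \<odot>\<^bsub>W\<^esub> gen (u @ [y] @ w))"
      and m': "u \<in> L" "w \<in> L" "c \<in> carrier K" "d \<in> carrier K" "x \<in> carrier V" "y \<in> carrier V"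
      unfolding multilinear_relations_def Let_def by blast
    have ls: "u @ [c \<odot>\<^bsub>V\<^esub> x \<oplus>\<^bsub>V\<^esub> d \<odot>\<^bsub>V\<^esub> y] @ w \<in> L" "u @ [x] @ w \<in> L" "u @ [y] @ w \<in> L"
      using m' by auto
    have "z [] = gen (u @ [c \<odot>\<^bsub>V\<^esub> x \<oplus>\<^bsub>V\<^esub> d \<odot>\<^bsub>V\<^esub> y] @ w) [] \<ominus>\<^bsub>base_module K\<^esub>
       (c \<odot>\<^bsub>base_module K\<^esub> gen (u @ [x] @ w) [] \<oplus>\<^bsub>base_module K\<^esub> d \<odot>\<^bsub>base_module K\<^esub> gen (u @ [y] @ w) [])"
      using ls[THEN gen_closed] m'(3,4) unfolding z
      by (simp add: linear_map_minus[OF word_algebra_module B lin] linear_map_add[OF lin] linear_map_smult[OF lin])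
    also have "\<dots> = \<zero>\<^bsub>base_module K\<^esub> \<ominus>\<^bsub>base_module K\<^esub>
      (c \<odot>\<^bsub>base_module K\<^esub> \<zero>\<^bsub>base_module K\<^esub> \<oplus>\<^bsub>base_module K\<^esub> d \<odot>\<^bsub>base_module K\<^esub> \<zero>\<^bsub>base_module K\<^esub>)"
      by (simp add: free_gen_def base_module_def)
    also have "\<dots> = \<zero>\<^bsub>base_module K\<^esub>" using m'(3,4) by (simp add: B.M.minus_eq B.M.r_neg)
    finally show "z [] = \<zero>\<^bsub>base_module K\<^esub>" .
  qed
  show "tensor_counit \<in> linear_map K T (base_module K)"
    using quot.the_elem_linear[OF B lin] null by (simp add: tensor_algebra_eq tensor_counit_def[abs_def])
  show "tensor_counit (word w) = (if w = [] then \<one>\<^bsub>K\<^esub> else \<zero>\<^bsub>K\<^esub>)" if "w \<in> L"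
    using quot.the_elem_coset[OF B lin _ gen_closed[OF that]] null
    by (simp add: word_def tensor_counit_def free_gen_def)
qed

end

section \<open>The deshuffling coalgebra\<close>

context tensor_algebra_over
begin

sublocale TT: two_modules K T T by unfold_locales
sublocale TTT: two_modules K T "tensor_product K T T"
  by (intro two_modules.intro T.module_axioms TT.tensor_module)

abbreviation "TT \<equiv> tensor_product K T T"
abbreviation "TTT \<equiv> tensor_product K T TT"
abbreviation "pure2 \<equiv> pure_tensor K T T"
abbreviation "pure3 \<equiv> pure_tensor K T TT"
abbreviation "\<Delta> \<equiv> deshuffle K V"

lemma incl_closed: "x \<in> carrier V \<Longrightarrow> incl x \<in> carrier T"
  by (rule linear_map_closed[OF incl_linear])

text \<open>Words are taken apart at the first letter, the side on which
  \<open>deshuffle_lift\<close> describes \<Delta>.\<close>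

lemma left_induct [consumes 1, case_names one left zero add smult]:
  assumes "X \<in> carrier T"
    and "P \<one>\<^bsub>T\<^esub>"
    and "\<And>x h. \<lbrakk>x \<in> carrier V; h \<in> carrier T; P h\<rbrakk> \<Longrightarrow> P (incl x \<otimes>\<^bsub>T\<^esub> h)"
    and "P \<zero>\<^bsub>T\<^esub>"
    and "\<And>x y. \<lbrakk>x \<in> carrier T; y \<in> carrier T; P x; P y\<rbrakk> \<Longrightarrow> P (x \<oplus>\<^bsub>T\<^esub> y)"
    and "\<And>c x. \<lbrakk>c \<in> carrier K; x \<in> carrier T; P x\<rbrakk> \<Longrightarrow> P (c \<odot>\<^bsub>T\<^esub> x)"
  shows "P X"
  using assms(1)
proof (induction rule: tensor_algebra_induct)
  case (word w)
  then show ?case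
  proof (induction w)
    case Nil
    then show ?case using assms(2) by (simp add: one_eq)
  next
    case (Cons x w)
    then have "P (incl x \<otimes>\<^bsub>T\<^esub> word w)" by (intro assms(3) word_closed) auto
    moreover have "incl x \<otimes>\<^bsub>T\<^esub> word w = word (x # w)"
      using Cons.hyps by (simp add: incl_eq word_append)
    ultimately show ?case by simp
  qed
qed fact+

lemma linear_eqI_left:
  assumes P: "Module.module K P" and f: "f \<in> linear_map K T P" and g: "g \<in> linear_map K T P"
    and X: "X \<in> carrier T"
    and "f \<one>\<^bsub>T\<^esub> = g \<one>\<^bsub>T\<^esub>"
    and "\<And>x h. \<lbrakk>x \<in> carrier V; h \<in> carrier T; f h = g h\<rbrakk> \<Longrightarrow> f (incl x \<otimes>\<^bsub>T\<^esub> h) = g (incl x \<otimes>\<^bsub>T\<^esub> h)"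
  shows "f X = g X"
  using X
  by (induction rule: left_induct)
    (simp_all add: assms(5,6) linear_map_add[OF f] linear_map_add[OF g] linear_map_smult[OF f]
      linear_map_smult[OF g] linear_map_zero[OF tensor_algebra_module P f] linear_map_zero[OF tensor_algebra_module P g])

lemma left_mult_linear: "a \<in> carrier T \<Longrightarrow> (\<lambda>h. a \<otimes>\<^bsub>T\<^esub> h) \<in> linear_map K T T"
  and right_mult_linear: "a \<in> carrier T \<Longrightarrow> (\<lambda>h. h \<otimes>\<^bsub>T\<^esub> a) \<in> linear_map K T T"
  using bilinear_map_left[OF mult_bilinear] bilinear_map_right[OF mult_bilinear] by auto

text \<open>The endomorphism \<open>A \<otimes> id + id \<otimes> A\<close> of \<open>T \<otimes> T\<close>.\<close>

definition leibniz :: "(('v list \<Rightarrow> 'k) set \<Rightarrow> ('v list \<Rightarrow> 'k) set) \<Rightarrow> _"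
  where "leibniz A = tensor_lift K TT (\<lambda>a b. pure2 (A a) b \<oplus>\<^bsub>TT\<^esub> pure2 a (A b))"

lemma leibniz_bilinear:
  assumes "A \<in> linear_map K T T"
  shows "bilinear_map K T T TT (\<lambda>a b. pure2 (A a) b \<oplus>\<^bsub>TT\<^esub> pure2 a (A b))"
  using bilinear_map_compose[OF TT.pure_bilinear assms linear_map_id]
    bilinear_map_compose[OF TT.pure_bilinear linear_map_id assms]
  by (rule bilinear_map_sum[OF TT.tensor_module])

lemma leibniz_linear: "A \<in> linear_map K T T \<Longrightarrow> leibniz A \<in> linear_map K TT TT"
  unfolding leibniz_def by (rule TT.tensor_lift_linear[OF TT.tensor_module leibniz_bilinear])

lemma leibniz_pure:
  "\<lbrakk>A \<in> linear_map K T T; a \<in> carrier T; b \<in> carrier T\<rbrakk>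
    \<Longrightarrow> leibniz A (pure2 a b) = pure2 (A a) b \<oplus>\<^bsub>TT\<^esub> pure2 a (A b)"
  unfolding leibniz_def by (rule TT.tensor_lift_pure[OF TT.tensor_module leibniz_bilinear])

lemma pure2_zero: "a \<in> carrier T \<Longrightarrow> pure2 a \<zero>\<^bsub>T\<^esub> = \<zero>\<^bsub>TT\<^esub>" "b \<in> carrier T \<Longrightarrow> pure2 \<zero>\<^bsub>T\<^esub> b = \<zero>\<^bsub>TT\<^esub>"
  using linear_map_zero[OF tensor_algebra_module TT.tensor_module bilinear_map_right[OF TT.pure_bilinear]]
    linear_map_zero[OF tensor_algebra_module TT.tensor_module bilinear_map_left[OF TT.pure_bilinear]]
  by auto

lemma pure2_add:
  "\<lbrakk>a \<in> carrier T; b \<in> carrier T; c \<in> carrier T\<rbrakk> \<Longrightarrow> pure2 a (b \<oplus>\<^bsub>T\<^esub> c) = pure2 a b \<oplus>\<^bsub>TT\<^esub> pure2 a c"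
  "\<lbrakk>a \<in> carrier T; b \<in> carrier T; c \<in> carrier T\<rbrakk> \<Longrightarrow> pure2 (a \<oplus>\<^bsub>T\<^esub> b) c = pure2 a c \<oplus>\<^bsub>TT\<^esub> pure2 b c"
  using linear_map_add[OF bilinear_map_right[OF TT.pure_bilinear]]
    linear_map_add[OF bilinear_map_left[OF TT.pure_bilinear]]
  by auto

lemma leibniz_sum:
  assumes A: "A \<in> linear_map K T T" and B: "B \<in> linear_map K T T" and X: "X \<in> carrier TT"
  shows "leibniz (\<lambda>a. A a \<oplus>\<^bsub>T\<^esub> B a) X = leibniz A X \<oplus>\<^bsub>TT\<^esub> leibniz B X"
proof -
  note AB = linear_map_sum[OF tensor_algebra_module A B]
  show ?thesis
    by (rule TT.tensor_eqI[OF TT.tensor_module leibniz_linear[OF AB]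
          linear_map_sum[OF TT.tensor_module leibniz_linear[OF A] leibniz_linear[OF B]] X])
      (simp add: leibniz_pure A B AB pure2_add linear_map_closed[OF A] linear_map_closed[OF B]
        TT.pure_closed TTT.N.M.a_ac)
qed

text \<open>\<open>leibniz\<close> respects commutators: the mixed terms
  \<open>A a \<otimes> B b\<close> and \<open>B a \<otimes> A b\<close> occur on both sides, and
  only the commutator \<open>C\<close> in one slot or the other remains. It is applied with
  \<open>A\<close> the map \<open>\<star> x\<close> and \<open>B\<close>, \<open>C\<close> left
  multiplications by letters.\<close>

lemma leibniz_commutator:
  assumes A: "A \<in> linear_map K T T" and B: "B \<in> linear_map K T T" and C: "C \<in> linear_map K T T"
    and comm: "\<And>a. a \<in> carrier T \<Longrightarrow> A (B a) = B (A a) \<oplus>\<^bsub>T\<^esub> C a" and X: "X \<in> carrier TT"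
  shows "leibniz A (leibniz B X) = leibniz B (leibniz A X) \<oplus>\<^bsub>TT\<^esub> leibniz C X"
proof -
  note cl = linear_map_closed[OF A] linear_map_closed[OF B] linear_map_closed[OF C]
  note l = linear_map_compose[OF leibniz_linear[OF A] leibniz_linear[OF B]]
  note r = linear_map_compose[OF leibniz_linear[OF B] leibniz_linear[OF A]]
  show ?thesis
    by (rule TT.tensor_eqI[OF TT.tensor_module r linear_map_sum[OF TT.tensor_module l leibniz_linear[OF C]] X])
      (simp add: leibniz_pure A B C pure2_add cl comm linear_map_add[OF leibniz_linear[OF A]]
        linear_map_add[OF leibniz_linear[OF B]] TT.pure_closed TTT.N.M.a_ac)
qed

text \<open>The case of commuting operators, applied to a left and a right multiplication, which
  commute by associativity of concatenation.\<close>

lemma leibniz_commute: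
  assumes A: "A \<in> linear_map K T T" and B: "B \<in> linear_map K T T"
    and comm: "\<And>a. a \<in> carrier T \<Longrightarrow> A (B a) = B (A a)" and X: "X \<in> carrier TT"
  shows "leibniz A (leibniz B X) = leibniz B (leibniz A X)"
proof -
  note cl = linear_map_closed[OF A] linear_map_closed[OF B]
  note l = linear_map_compose[OF leibniz_linear[OF A] leibniz_linear[OF B]]
  note r = linear_map_compose[OF leibniz_linear[OF B] leibniz_linear[OF A]]
  show ?thesis
    by (rule TT.tensor_eqI[OF TT.tensor_module r l X])
      (simp add: leibniz_pure A B cl comm linear_map_add[OF leibniz_linear[OF A]]
        linear_map_add[OF leibniz_linear[OF B]] TT.pure_closed TTT.N.M.a_ac)
qed

abbreviation primitive :: "'v \<Rightarrow> _"
  where "primitive x \<equiv> pure2 (incl x) \<one>\<^bsub>T\<^esub> \<oplus>\<^bsub>TT\<^esub> pure2 \<one>\<^bsub>T\<^esub> (incl x)"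

lemma primitive_linear: "primitive \<in> linear_map K V TT"
  by (intro linear_map_sum[OF TT.tensor_module] linear_map_compose[OF incl_linear]
      bilinear_map_left[OF TT.pure_bilinear] bilinear_map_right[OF TT.pure_bilinear] T.one_closed)

lemmas TT_mult_bilinear = TT.tensor_mult_bilinear[OF mult_bilinear mult_bilinear]
  and TT_mult_pure = TT.tensor_mult_pure[OF mult_bilinear mult_bilinear]

lemma TT_one: "\<one>\<^bsub>TT\<^esub> = pure2 \<one>\<^bsub>T\<^esub> \<one>\<^bsub>T\<^esub>"
  by (simp add: tensor_product_def Let_def)

lemma TT_one_closed: "\<one>\<^bsub>TT\<^esub> \<in> carrier TT"
  by (simp add: TT_one TT.pure_closed)

lemma deshuffle_eq: "\<Delta> = tensor_algebra_lift K TT primitive"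
  by (simp add: deshuffle_def Let_def)

lemmas deshuffle_lift = tensor_algebra_lift_props[OF TT.tensor_module TT_mult_bilinear TT_one_closed
    primitive_linear, folded deshuffle_eq]

lemma deshuffle_linear: "\<Delta> \<in> linear_map K T TT" by (rule deshuffle_lift(1))

lemma deshuffle_closed: "h \<in> carrier T \<Longrightarrow> \<Delta> h \<in> carrier TT"
  by (rule linear_map_closed[OF deshuffle_linear])

lemma deshuffle_one: "\<Delta> \<one>\<^bsub>T\<^esub> = pure2 \<one>\<^bsub>T\<^esub> \<one>\<^bsub>T\<^esub>"
  using deshuffle_lift(2) by (simp add: TT_one)

section \<open>Coderivations of the deshuffling coproduct\<close>

definition coderivation where
  "coderivation A \<longleftrightarrow> A \<in> linear_map K T T \<and> (\<forall>h\<in>carrier T. \<Delta> (A h) = leibniz A (\<Delta> h))"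

lemma coderivation_linear: "coderivation A \<Longrightarrow> A \<in> linear_map K T T"
  and coderivation_deshuffle: "\<lbrakk>coderivation A; h \<in> carrier T\<rbrakk> \<Longrightarrow> \<Delta> (A h) = leibniz A (\<Delta> h)"
  by (auto simp: coderivation_def)

lemma coderivation_sum:
  assumes "coderivation A" "coderivation B"
  shows "coderivation (\<lambda>h. A h \<oplus>\<^bsub>T\<^esub> B h)"
  using assms unfolding coderivation_def
  by (auto intro!: linear_map_sum tensor_algebra_module
      simp: leibniz_sum deshuffle_closed linear_map_add[OF deshuffle_linear] linear_map_closed)

text \<open>Multiplying by \<open>x \<otimes> 1 + 1 \<otimes> x\<close> in T \<otimes> T is
  \<open>leibniz\<close> of left multiplication by \<open>x\<close>, as a check on pure tensors
  shows. The defining rule of \<Delta> on \<open>x h\<close> is then the coderivation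
  property.\<close>

lemma coderivation_left_mult:
  assumes x: "x \<in> carrier V"
  shows "coderivation (\<lambda>h. incl x \<otimes>\<^bsub>T\<^esub> h)"
proof -
  note l = left_mult_linear[OF incl_closed[OF x]]
  have pc: "primitive x \<in> carrier TT" by (rule linear_map_closed[OF primitive_linear x])
  have "primitive x \<otimes>\<^bsub>TT\<^esub> X = leibniz (\<lambda>h. incl x \<otimes>\<^bsub>T\<^esub> h) X" if X: "X \<in> carrier TT" for X
  proof (rule TT.tensor_eqI[OF TT.tensor_module bilinear_map_right[OF TT_mult_bilinear pc] leibniz_linear[OF l] X])
    fix a b assume "a \<in> carrier T" "b \<in> carrier T"
    then show "primitive x \<otimes>\<^bsub>TT\<^esub> pure2 a b = leibniz (\<lambda>h. incl x \<otimes>\<^bsub>T\<^esub> h) (pure2 a b)"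
      using x
      by (simp add: linear_map_add[OF bilinear_map_left[OF TT_mult_bilinear]] TT.pure_closed incl_closed
          TT_mult_pure leibniz_pure[OF l])
  qed
  then show ?thesis
    unfolding coderivation_def using l x by (simp add: deshuffle_lift(3) deshuffle_closed)
qed

lemma deshuffle_incl: "x \<in> carrier V \<Longrightarrow> \<Delta> (incl x) = primitive x"
  using coderivation_deshuffle[OF coderivation_left_mult, of x "\<one>\<^bsub>T\<^esub>"]
  by (simp add: incl_closed deshuffle_one leibniz_pure left_mult_linear)

text \<open>The recursion for \<Delta> only prefixes letters. A letter at the end is reached by
  induction on \<open>h\<close> from the left, the two multiplications and hence their
  \<open>leibniz\<close> operators being interchangeable.\<close>

lemma coderivation_right_mult:
  assumes x: "x \<in> carrier V"
  shows "coderivation (\<lambda>h. h \<otimes>\<^bsub>T\<^esub> incl x)"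
proof -
  note r = right_mult_linear[OF incl_closed[OF x]]
  have "\<Delta> (h \<otimes>\<^bsub>T\<^esub> incl x) = leibniz (\<lambda>h. h \<otimes>\<^bsub>T\<^esub> incl x) (\<Delta> h)" if h: "h \<in> carrier T" for h
  proof (rule linear_eqI_left[OF TT.tensor_module linear_map_compose[OF r deshuffle_linear]
        linear_map_compose[OF deshuffle_linear leibniz_linear[OF r]] h])
    show "\<Delta> (\<one>\<^bsub>T\<^esub> \<otimes>\<^bsub>T\<^esub> incl x) = leibniz (\<lambda>h. h \<otimes>\<^bsub>T\<^esub> incl x) (\<Delta> \<one>\<^bsub>T\<^esub>)"
      using x by (simp add: incl_closed deshuffle_one deshuffle_incl leibniz_pure[OF r])
  next
    fix y h assume y: "y \<in> carrier V" and h: "h \<in> carrier T"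
      and IH: "\<Delta> (h \<otimes>\<^bsub>T\<^esub> incl x) = leibniz (\<lambda>h. h \<otimes>\<^bsub>T\<^esub> incl x) (\<Delta> h)"
    note cy = coderivation_left_mult[OF y] and l = left_mult_linear[OF incl_closed[OF y]]
    have "\<Delta> ((incl y \<otimes>\<^bsub>T\<^esub> h) \<otimes>\<^bsub>T\<^esub> incl x) = \<Delta> (incl y \<otimes>\<^bsub>T\<^esub> (h \<otimes>\<^bsub>T\<^esub> incl x))"
      using x y h by (simp add: T.m_assoc incl_closed)
    also have "\<dots> = leibniz (\<lambda>h. incl y \<otimes>\<^bsub>T\<^esub> h) (leibniz (\<lambda>h. h \<otimes>\<^bsub>T\<^esub> incl x) (\<Delta> h))"
      using x h coderivation_deshuffle[OF cy] by (simp add: IH incl_closed)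
    also have "\<dots> = leibniz (\<lambda>h. h \<otimes>\<^bsub>T\<^esub> incl x) (leibniz (\<lambda>h. incl y \<otimes>\<^bsub>T\<^esub> h) (\<Delta> h))"
      by (rule leibniz_commute[OF l r _ deshuffle_closed[OF h]]) (use x y in \<open>simp add: T.m_assoc incl_closed\<close>)
    also have "leibniz (\<lambda>h. incl y \<otimes>\<^bsub>T\<^esub> h) (\<Delta> h) = \<Delta> (incl y \<otimes>\<^bsub>T\<^esub> h)"
      using h coderivation_deshuffle[OF cy] by simp
    finally show "\<Delta> ((incl y \<otimes>\<^bsub>T\<^esub> h) \<otimes>\<^bsub>T\<^esub> incl x) = leibniz (\<lambda>h. h \<otimes>\<^bsub>T\<^esub> incl x) (\<Delta> (incl y \<otimes>\<^bsub>T\<^esub> h))" .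
  qed
  then show ?thesis using r by (simp add: coderivation_def)
qed

section \<open>Values of the counit and the counit axioms\<close>

lemma counit_closed: "h \<in> carrier T \<Longrightarrow> tensor_counit h \<in> carrier K"
  using linear_map_closed[OF counit_linear] by (simp add: base_module_def)

lemma counit_one: "tensor_counit \<one>\<^bsub>T\<^esub> = \<one>\<^bsub>K\<^esub>"
  by (simp add: one_eq counit_word)

lemma counit_add: "\<lbrakk>f \<in> carrier T; g \<in> carrier T\<rbrakk> \<Longrightarrow> tensor_counit (f \<oplus>\<^bsub>T\<^esub> g) = tensor_counit f \<oplus>\<^bsub>K\<^esub> tensor_counit g"
  and counit_smult: "\<lbrakk>c \<in> carrier K; f \<in> carrier T\<rbrakk> \<Longrightarrow> tensor_counit (c \<odot>\<^bsub>T\<^esub> f) = c \<otimes>\<^bsub>K\<^esub> tensor_counit f"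
  and counit_zero: "tensor_counit \<zero>\<^bsub>T\<^esub> = \<zero>\<^bsub>K\<^esub>"
  using linear_map_add[OF counit_linear] linear_map_smult[OF counit_linear]
    linear_map_zero[OF tensor_algebra_module base_module_module[OF V.R.is_cring] counit_linear]
  by (simp_all add: base_module_def)

lemma counit_mult_incl:
  assumes "x \<in> carrier V" "h \<in> carrier T"
  shows "tensor_counit (incl x \<otimes>\<^bsub>T\<^esub> h) = \<zero>\<^bsub>K\<^esub>" "tensor_counit (h \<otimes>\<^bsub>T\<^esub> incl x) = \<zero>\<^bsub>K\<^esub>"
proof -
  show "tensor_counit (incl x \<otimes>\<^bsub>T\<^esub> h) = \<zero>\<^bsub>K\<^esub>"
    using assms(2)
    by (induction rule: tensor_algebra_induct)
      (use assms(1) in \<open>simp_all add: incl_eq word_append counit_word T.r_distr T.smult_mult_right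
         counit_add counit_smult counit_zero word_closed\<close>)
  show "tensor_counit (h \<otimes>\<^bsub>T\<^esub> incl x) = \<zero>\<^bsub>K\<^esub>"
    using assms(2)
    by (induction rule: tensor_algebra_induct)
      (use assms(1) in \<open>simp_all add: incl_eq word_append counit_word T.l_distr T.smult_mult_left
         counit_add counit_smult counit_zero word_closed\<close>)
qed

lemma counit_incl: "x \<in> carrier V \<Longrightarrow> tensor_counit (incl x) = \<zero>\<^bsub>K\<^esub>"
  by (simp add: incl_eq counit_word)

lemma counit_bilinear:
  "bilinear_map K T T T (\<lambda>a b. tensor_counit a \<odot>\<^bsub>T\<^esub> b)" "bilinear_map K T T T (\<lambda>a b. tensor_counit b \<odot>\<^bsub>T\<^esub> a)"
  by (auto intro!: bilinear_mapI_linear linear_map_smult_vector counit_linear tensor_algebra_module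
      linear_map_smult_const counit_closed)

text \<open>The map \<open>?E\<close> turns \<open>leibniz\<close> of left multiplication by
  \<open>x\<close> into left multiplication by \<open>x\<close>: the extra term carries the factor
  \<open>tensor_counit (x a)\<close>, which is 0.\<close>

lemma deshuffle_counit_left:
  assumes "h \<in> carrier T"
  shows "tensor_lift K T (\<lambda>a b. tensor_counit a \<odot>\<^bsub>T\<^esub> b) (\<Delta> h) = h"
proof -
  note b = counit_bilinear(1)
  let ?E = "tensor_lift K T (\<lambda>a b. tensor_counit a \<odot>\<^bsub>T\<^esub> b)"
  note E = TT.tensor_lift_linear[OF tensor_algebra_module b]
  note Ep = TT.tensor_lift_pure[OF tensor_algebra_module b]
  show ?thesis
  proof (rule linear_eqI_left[OF tensor_algebra_module linear_map_compose[OF deshuffle_linear E] linear_map_id assms])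
    show "?E (\<Delta> \<one>\<^bsub>T\<^esub>) = \<one>\<^bsub>T\<^esub>" by (simp add: deshuffle_one Ep counit_one)
    fix x h assume x: "x \<in> carrier V" and h: "h \<in> carrier T" and IH: "?E (\<Delta> h) = h"
    note l = left_mult_linear[OF incl_closed[OF x]]
    have "?E (leibniz (\<lambda>h. incl x \<otimes>\<^bsub>T\<^esub> h) X) = incl x \<otimes>\<^bsub>T\<^esub> ?E X" if X: "X \<in> carrier TT" for X
      by (rule TT.tensor_eqI[OF tensor_algebra_module linear_map_compose[OF leibniz_linear[OF l] E]
            linear_map_compose[OF E l] X])
        (use x in \<open>simp add: leibniz_pure[OF l] Ep incl_closed linear_map_add[OF E] TT.pure_closed
          counit_mult_incl T.smult_mult_right counit_closed\<close>)
    then show "?E (\<Delta> (incl x \<otimes>\<^bsub>T\<^esub> h)) = incl x \<otimes>\<^bsub>T\<^esub> h"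
      using h IH coderivation_deshuffle[OF coderivation_left_mult[OF x] h] by (simp add: deshuffle_closed)
  qed
qed

lemma deshuffle_counit_right:
  assumes "h \<in> carrier T"
  shows "tensor_lift K T (\<lambda>a b. tensor_counit b \<odot>\<^bsub>T\<^esub> a) (\<Delta> h) = h"
proof -
  note b = counit_bilinear(2)
  let ?E = "tensor_lift K T (\<lambda>a b. tensor_counit b \<odot>\<^bsub>T\<^esub> a)"
  note E = TT.tensor_lift_linear[OF tensor_algebra_module b]
  note Ep = TT.tensor_lift_pure[OF tensor_algebra_module b]
  show ?thesis
  proof (rule linear_eqI_left[OF tensor_algebra_module linear_map_compose[OF deshuffle_linear E] linear_map_id assms])
    show "?E (\<Delta> \<one>\<^bsub>T\<^esub>) = \<one>\<^bsub>T\<^esub>" by (simp add: deshuffle_one Ep counit_one)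
    fix x h assume x: "x \<in> carrier V" and h: "h \<in> carrier T" and IH: "?E (\<Delta> h) = h"
    note l = left_mult_linear[OF incl_closed[OF x]]
    have "?E (leibniz (\<lambda>h. incl x \<otimes>\<^bsub>T\<^esub> h) X) = incl x \<otimes>\<^bsub>T\<^esub> ?E X" if X: "X \<in> carrier TT" for X
      by (rule TT.tensor_eqI[OF tensor_algebra_module linear_map_compose[OF leibniz_linear[OF l] E]
            linear_map_compose[OF E l] X])
        (use x in \<open>simp add: leibniz_pure[OF l] Ep incl_closed linear_map_add[OF E] TT.pure_closed
          counit_mult_incl T.smult_mult_right counit_closed\<close>)
    then show "?E (\<Delta> (incl x \<otimes>\<^bsub>T\<^esub> h)) = incl x \<otimes>\<^bsub>T\<^esub> h"
      using h IH coderivation_deshuffle[OF coderivation_left_mult[OF x] h] by (simp add: deshuffle_closed)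
  qed
qed

text \<open>The operator A \<otimes> id \<otimes> id + id \<otimes> A \<otimes> id + id \<otimes> id
  \<otimes> A, the last two summands being contained in \<open>leibniz A\<close> on the inner tensor
  square.\<close>

definition leibniz3 where
  "leibniz3 A = tensor_lift K TTT (\<lambda>a Y. pure3 (A a) Y \<oplus>\<^bsub>TTT\<^esub> pure3 a (leibniz A Y))"

lemma leibniz3_bilinear:
  assumes "A \<in> linear_map K T T"
  shows "bilinear_map K T TT TTT (\<lambda>a Y. pure3 (A a) Y \<oplus>\<^bsub>TTT\<^esub> pure3 a (leibniz A Y))"
  using bilinear_map_compose[OF TTT.pure_bilinear assms linear_map_id]
    bilinear_map_compose[OF TTT.pure_bilinear linear_map_id leibniz_linear[OF assms]]
  by (rule bilinear_map_sum[OF TTT.tensor_module])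

lemma leibniz3_linear: "A \<in> linear_map K T T \<Longrightarrow> leibniz3 A \<in> linear_map K TTT TTT"
  unfolding leibniz3_def by (rule TTT.tensor_lift_linear[OF TTT.tensor_module leibniz3_bilinear])

lemma leibniz3_pure:
  "\<lbrakk>A \<in> linear_map K T T; a \<in> carrier T; Y \<in> carrier TT\<rbrakk>
    \<Longrightarrow> leibniz3 A (pure3 a Y) = pure3 (A a) Y \<oplus>\<^bsub>TTT\<^esub> pure3 a (leibniz A Y)"
  unfolding leibniz3_def by (rule TTT.tensor_lift_pure[OF TTT.tensor_module leibniz3_bilinear])

text \<open>The canonical map from \<open>(a \<otimes> b) \<otimes> z\<close> to
  \<open>a \<otimes> (b \<otimes> z)\<close>, as a bilinear function of the tensor \<open>X\<close>
  and of \<open>z\<close>. In this form it matches the inner lift of the coassociativity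
  axiom.\<close>

definition associator where
  "associator X z = tensor_lift K TTT (\<lambda>a b. pure3 a (pure2 b z)) X"

lemma associator_inner_bilinear: "z \<in> carrier T \<Longrightarrow> bilinear_map K T T TTT (\<lambda>a b. pure3 a (pure2 b z))"
  by (rule bilinear_map_compose[OF TTT.pure_bilinear linear_map_id bilinear_map_left[OF TT.pure_bilinear]])

lemma associator_bilinear: "bilinear_map K TT T TTT associator"
proof (rule bilinear_mapI_linear)
  fix X assume X: "X \<in> carrier TT"
  show "(\<lambda>z. associator X z) \<in> linear_map K T TTT"
    unfolding associator_def
    by (rule TT.tensor_lift_param_linear[OF TTT.tensor_module tensor_algebra_module X associator_inner_bilinear])
      (auto intro!: linear_map_compose[OF bilinear_map_right[OF TT.pure_bilinear]
          bilinear_map_right[OF TTT.pure_bilinear]])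
next
  fix z assume z: "z \<in> carrier T"
  show "(\<lambda>X. associator X z) \<in> linear_map K TT TTT"
    unfolding associator_def by (rule TT.tensor_lift_linear[OF TTT.tensor_module associator_inner_bilinear[OF z]])
qed

lemma associator_pure:
  "\<lbrakk>a \<in> carrier T; b \<in> carrier T; z \<in> carrier T\<rbrakk> \<Longrightarrow> associator (pure2 a b) z = pure3 a (pure2 b z)"
  unfolding associator_def by (rule TT.tensor_lift_pure[OF TTT.tensor_module associator_inner_bilinear])

lemma leibniz3_associator:
  assumes A: "A \<in> linear_map K T T" and X: "X \<in> carrier TT" and z: "z \<in> carrier T"
  shows "leibniz3 A (associator X z) = associator (leibniz A X) z \<oplus>\<^bsub>TTT\<^esub> associator X (A z)"
proof -
  interpret Q: Module.module K TTT by (rule TTT.tensor_module)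
  note cl = linear_map_closed[OF A]
  note l = bilinear_map_left[OF associator_bilinear]
  show ?thesis
    by (rule TT.tensor_eqI[OF TTT.tensor_module linear_map_compose[OF l[OF z] leibniz3_linear[OF A]]
          linear_map_sum[OF TTT.tensor_module linear_map_compose[OF leibniz_linear[OF A] l[OF z]] l[OF cl[OF z]]] X])
      (use z in \<open>simp add: associator_pure leibniz_pure[OF A] leibniz3_pure[OF A] cl TT.pure_closed TTT.pure_closed
        linear_map_add[OF l] linear_map_add[OF bilinear_map_right[OF TTT.pure_bilinear]] Q.M.a_ac\<close>)
qed

text \<open>For every coderivation \<open>A\<close>, both composites carry \<open>leibniz A\<close>
  to \<open>leibniz3 A\<close>. They agree at 1, and left multiplications by letters are
  coderivations that build up all of T from 1.\<close>

lemma deshuffle_coassoc: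
  assumes h: "h \<in> carrier T"
  shows "tensor_lift K TTT (\<lambda>x z. tensor_lift K TTT (\<lambda>a b. pure3 a (pure2 b z)) (\<Delta> x)) (\<Delta> h)
    = tensor_lift K TTT (\<lambda>x z. pure3 x (\<Delta> z)) (\<Delta> h)"
proof -
  interpret Q: Module.module K TTT by (rule TTT.tensor_module)
  let ?L = "tensor_lift K TTT (\<lambda>x z. associator (\<Delta> x) z)" and ?R = "tensor_lift K TTT (\<lambda>x z. pure3 x (\<Delta> z))"
  have bL: "bilinear_map K T T TTT (\<lambda>x z. associator (\<Delta> x) z)"
    by (rule bilinear_map_compose[OF associator_bilinear deshuffle_linear linear_map_id])
  have bR: "bilinear_map K T T TTT (\<lambda>x z. pure3 x (\<Delta> z))"
    by (rule bilinear_map_compose[OF TTT.pure_bilinear linear_map_id deshuffle_linear])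
  note L = TT.tensor_lift_linear[OF TTT.tensor_module bL] and Lp = TT.tensor_lift_pure[OF TTT.tensor_module bL]
    and R = TT.tensor_lift_linear[OF TTT.tensor_module bR] and Rp = TT.tensor_lift_pure[OF TTT.tensor_module bR]
  have step: "?L (leibniz A X) = leibniz3 A (?L X)" "?R (leibniz A X) = leibniz3 A (?R X)"
    if c: "coderivation A" and X: "X \<in> carrier TT" for A X
  proof -
    note A = coderivation_linear[OF c] and d = coderivation_deshuffle[OF c]
    note cl = linear_map_closed[OF A]
    show "?L (leibniz A X) = leibniz3 A (?L X)"
      by (rule TT.tensor_eqI[OF TTT.tensor_module linear_map_compose[OF leibniz_linear[OF A] L]
            linear_map_compose[OF L leibniz3_linear[OF A]] X])
        (simp add: leibniz_pure[OF A] Lp linear_map_add[OF L] TT.pure_closed cl d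
          leibniz3_associator[OF A] deshuffle_closed)
    show "?R (leibniz A X) = leibniz3 A (?R X)"
      by (rule TT.tensor_eqI[OF TTT.tensor_module linear_map_compose[OF leibniz_linear[OF A] R]
            linear_map_compose[OF R leibniz3_linear[OF A]] X])
        (simp add: leibniz_pure[OF A] Rp linear_map_add[OF R] TT.pure_closed cl d
          leibniz3_pure[OF A] deshuffle_closed)
  qed
  have "?L (\<Delta> h) = ?R (\<Delta> h)"
  proof (rule linear_eqI_left[OF TTT.tensor_module linear_map_compose[OF deshuffle_linear L]
        linear_map_compose[OF deshuffle_linear R] h])
    show "?L (\<Delta> \<one>\<^bsub>T\<^esub>) = ?R (\<Delta> \<one>\<^bsub>T\<^esub>)" by (simp add: deshuffle_one Lp Rp associator_pure)
  next
    fix x h assume x: "x \<in> carrier V" and h: "h \<in> carrier T" and IH: "?L (\<Delta> h) = ?R (\<Delta> h)"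
    note c = coderivation_left_mult[OF x]
    show "?L (\<Delta> (incl x \<otimes>\<^bsub>T\<^esub> h)) = ?R (\<Delta> (incl x \<otimes>\<^bsub>T\<^esub> h))"
      using step[OF c deshuffle_closed[OF h]] IH by (simp add: coderivation_deshuffle[OF c h])
  qed
  then show ?thesis by (simp add: associator_def[abs_def])
qed

end

section \<open>The product \<open>\<bullet>\<close>\<close>

locale extended_product = tensor_algebra_over K V
  for K :: "('k, 'r) ring_scheme" (structure) and V :: "('k, 'v, 'm) module_scheme" (structure) +
  fixes star :: "'v \<Rightarrow> 'v \<Rightarrow> 'v"
    and ext :: "('v list \<Rightarrow> 'k) set \<Rightarrow> ('v list \<Rightarrow> 'k) set \<Rightarrow> ('v list \<Rightarrow> 'k) set" (infixl \<open>\<star>\<close> 70)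
  assumes star_bilinear: "bilinear_map K V V V star"
    and extension: "product_extension K V star ext"
begin

abbreviation circ (infixl \<open>\<bullet>\<close> 70) where "f \<bullet> g \<equiv> circledast K V ext f g"

lemma ext_bilinear: "bilinear_map K T T T (\<star>)"
  and ext_incl: "\<lbrakk>x \<in> carrier V; y \<in> carrier V\<rbrakk> \<Longrightarrow> incl x \<star> incl y = incl (star x y)"
  and ext_one_right: "f \<in> carrier T \<Longrightarrow> f \<star> \<one>\<^bsub>T\<^esub> = f"
  and ext_one_left: "f \<in> carrier T \<Longrightarrow> \<one>\<^bsub>T\<^esub> \<star> f = tensor_counit f \<odot>\<^bsub>T\<^esub> \<one>\<^bsub>T\<^esub>"
  and ext_letter: "\<lbrakk>x \<in> carrier V; f \<in> carrier T; y \<in> carrier V\<rbrakk> \<Longrightarrow>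
      incl x \<star> (f \<otimes>\<^bsub>T\<^esub> incl y) = (incl x \<star> f) \<star> incl y \<ominus>\<^bsub>T\<^esub> incl x \<star> (f \<star> incl y)"
  and ext_mult: "\<lbrakk>f \<in> carrier T; g \<in> carrier T; h \<in> carrier T\<rbrakk> \<Longrightarrow>
      (f \<otimes>\<^bsub>T\<^esub> g) \<star> h = tensor_lift K T (\<lambda>a b. (f \<star> a) \<otimes>\<^bsub>T\<^esub> (g \<star> b)) (\<Delta> h)"
  using extension unfolding product_extension_def by auto

lemma star_closed: "\<lbrakk>x \<in> carrier V; y \<in> carrier V\<rbrakk> \<Longrightarrow> star x y \<in> carrier V"
  by (rule bilinear_map_closed[OF star_bilinear])

lemmas ext_closed = bilinear_map_closed[OF ext_bilinear]
  and ext_left = bilinear_map_left[OF ext_bilinear]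
  and ext_right = bilinear_map_right[OF ext_bilinear]
  and mult_left = bilinear_map_left[OF mult_bilinear]
  and mult_right = bilinear_map_right[OF mult_bilinear]

lemma ext_mult_bilinear:
  "\<lbrakk>f \<in> carrier T; g \<in> carrier T\<rbrakk> \<Longrightarrow> bilinear_map K T T T (\<lambda>a b. (f \<star> a) \<otimes>\<^bsub>T\<^esub> (g \<star> b))"
  by (intro bilinear_map_compose[OF mult_bilinear] ext_right)

lemma one_ext_incl: "x \<in> carrier V \<Longrightarrow> \<one>\<^bsub>T\<^esub> \<star> incl x = \<zero>\<^bsub>T\<^esub>"
  by (simp add: ext_one_left incl_closed counit_incl)

text \<open>A letter is primitive and \<open>f \<star> 1 = f\<close>, so the Sweedler sum of
  \<open>ext_mult\<close> has exactly the two Leibniz terms.\<close>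

lemma ext_incl_derivation:
  assumes "f \<in> carrier T" "g \<in> carrier T" "x \<in> carrier V"
  shows "(f \<otimes>\<^bsub>T\<^esub> g) \<star> incl x = (f \<star> incl x) \<otimes>\<^bsub>T\<^esub> g \<oplus>\<^bsub>T\<^esub> f \<otimes>\<^bsub>T\<^esub> (g \<star> incl x)"
  using assms
  by (simp add: ext_mult incl_closed deshuffle_incl TT.pure_closed ext_one_right
      linear_map_add[OF TT.tensor_lift_linear[OF tensor_algebra_module ext_mult_bilinear]]
      TT.tensor_lift_pure[OF tensor_algebra_module ext_mult_bilinear])

text \<open>By the derivation rule, the commutator of \<open>\<star> x\<close> with left
  multiplication by \<open>y\<close> is left multiplication by the letter \<open>star y x\<close>.
  Both left multiplications are coderivations, so \<open>leibniz_commutator\<close> carries the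
  induction from \<open>h\<close> to \<open>y h\<close>.\<close>

lemma coderivation_ext:
  assumes x: "x \<in> carrier V"
  shows "coderivation (\<lambda>h. h \<star> incl x)"
proof -
  let ?D = "\<lambda>h. h \<star> incl x"
  note D = ext_left[OF incl_closed[OF x]]
  have "\<Delta> (h \<star> incl x) = leibniz ?D (\<Delta> h)" if h: "h \<in> carrier T" for h
  proof (rule linear_eqI_left[OF TT.tensor_module linear_map_compose[OF D deshuffle_linear]
        linear_map_compose[OF deshuffle_linear leibniz_linear[OF D]] h])
    show "\<Delta> (\<one>\<^bsub>T\<^esub> \<star> incl x) = leibniz ?D (\<Delta> \<one>\<^bsub>T\<^esub>)"
      using x linear_map_zero[OF tensor_algebra_module TT.tensor_module deshuffle_linear]
      by (simp add: one_ext_incl deshuffle_one leibniz_pure[OF D] pure2_zero)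
  next
    fix y h assume y: "y \<in> carrier V" and h: "h \<in> carrier T"
      and IH: "\<Delta> (h \<star> incl x) = leibniz ?D (\<Delta> h)"
    let ?z = "star y x"
    have z: "?z \<in> carrier V" by (rule star_closed[OF y x])
    note cy = coderivation_left_mult[OF y] and cz = coderivation_left_mult[OF z]
    note ly = coderivation_linear[OF cy] and lz = coderivation_linear[OF cz]
    have comm: "(incl y \<otimes>\<^bsub>T\<^esub> a) \<star> incl x = incl y \<otimes>\<^bsub>T\<^esub> (a \<star> incl x) \<oplus>\<^bsub>T\<^esub> incl ?z \<otimes>\<^bsub>T\<^esub> a" if "a \<in> carrier T" for a
      using that x y z
      by (simp add: ext_incl_derivation incl_closed ext_incl ext_closed T.M.a_comm)
    have "\<Delta> ((incl y \<otimes>\<^bsub>T\<^esub> h) \<star> incl x)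
        = \<Delta> (incl y \<otimes>\<^bsub>T\<^esub> (h \<star> incl x)) \<oplus>\<^bsub>TT\<^esub> \<Delta> (incl ?z \<otimes>\<^bsub>T\<^esub> h)"
      using x y z h by (simp add: comm linear_map_add[OF deshuffle_linear] incl_closed ext_closed)
    also have "\<dots> = leibniz (\<lambda>h. incl y \<otimes>\<^bsub>T\<^esub> h) (leibniz ?D (\<Delta> h)) \<oplus>\<^bsub>TT\<^esub> leibniz (\<lambda>h. incl ?z \<otimes>\<^bsub>T\<^esub> h) (\<Delta> h)"
      using x y z h coderivation_deshuffle[OF cy] coderivation_deshuffle[OF cz]
      by (simp add: IH incl_closed ext_closed)
    also have "\<dots> = leibniz ?D (leibniz (\<lambda>h. incl y \<otimes>\<^bsub>T\<^esub> h) (\<Delta> h))"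
      by (rule leibniz_commutator[OF D ly lz comm deshuffle_closed[OF h], symmetric])
    also have "\<dots> = leibniz ?D (\<Delta> (incl y \<otimes>\<^bsub>T\<^esub> h))"
      using coderivation_deshuffle[OF cy h] by simp
    finally show "\<Delta> ((incl y \<otimes>\<^bsub>T\<^esub> h) \<star> incl x) = leibniz ?D (\<Delta> (incl y \<otimes>\<^bsub>T\<^esub> h))" .
  qed
  then show ?thesis using D by (simp add: coderivation_def)
qed

lemma circ_inner_bilinear: "f \<in> carrier T \<Longrightarrow> bilinear_map K T T T (\<lambda>a b. (f \<star> a) \<otimes>\<^bsub>T\<^esub> b)"
  by (intro bilinear_map_compose[OF mult_bilinear] ext_right linear_map_id)

lemma circ_eq: "f \<bullet> g = tensor_lift K T (\<lambda>a b. (f \<star> a) \<otimes>\<^bsub>T\<^esub> b) (\<Delta> g)"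
  by (simp add: circledast_def)

lemma circ_right: "f \<in> carrier T \<Longrightarrow> (\<lambda>g. f \<bullet> g) \<in> linear_map K T T"
  unfolding circ_eq
  by (rule linear_map_compose[OF deshuffle_linear TT.tensor_lift_linear[OF tensor_algebra_module circ_inner_bilinear]])

lemma circ_left: "g \<in> carrier T \<Longrightarrow> (\<lambda>f. f \<bullet> g) \<in> linear_map K T T"
  unfolding circ_eq
  by (rule TT.tensor_lift_param_linear[OF tensor_algebra_module tensor_algebra_module deshuffle_closed circ_inner_bilinear])
    (auto intro!: linear_map_compose[OF ext_left mult_left])

lemma circ_bilinear: "bilinear_map K T T T (\<bullet>)"
  by (intro bilinear_mapI_linear circ_right circ_left)

lemmas circ_closed = bilinear_map_closed[OF circ_bilinear]

lemma circ_incl: "\<lbrakk>f \<in> carrier T; x \<in> carrier V\<rbrakk> \<Longrightarrow> f \<bullet> incl x = f \<star> incl x \<oplus>\<^bsub>T\<^esub> f \<otimes>\<^bsub>T\<^esub> incl x"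
  unfolding circ_eq
  by (simp add: incl_closed deshuffle_incl TT.pure_closed ext_one_right ext_closed
      linear_map_add[OF TT.tensor_lift_linear[OF tensor_algebra_module circ_inner_bilinear]]
      TT.tensor_lift_pure[OF tensor_algebra_module circ_inner_bilinear])

lemma circ_one_right: "f \<in> carrier T \<Longrightarrow> f \<bullet> \<one>\<^bsub>T\<^esub> = f"
  unfolding circ_eq
  by (simp add: deshuffle_one TT.tensor_lift_pure[OF tensor_algebra_module circ_inner_bilinear] ext_one_right)

text \<open>As \<open>1 \<star> a\<close> is the counit of \<open>a\<close> times 1, this is the
  left counit axiom.\<close>

lemma circ_one_left:
  assumes "f \<in> carrier T"
  shows "\<one>\<^bsub>T\<^esub> \<bullet> f = f"
proof -
  have "\<one>\<^bsub>T\<^esub> \<bullet> f = tensor_lift K T (\<lambda>a b. tensor_counit a \<odot>\<^bsub>T\<^esub> b) (\<Delta> f)"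
    unfolding circ_eq
    by (rule TT.tensor_lift_cong[OF tensor_algebra_module circ_inner_bilinear])
      (use assms in \<open>auto simp: ext_one_left T.smult_mult_left counit_closed deshuffle_closed\<close>)
  also have "\<dots> = f" by (rule deshuffle_counit_left[OF assms])
  finally show ?thesis .
qed

lemma coderivation_circ:
  assumes x: "x \<in> carrier V"
  shows "coderivation (\<lambda>h. h \<bullet> incl x)"
proof -
  have c: "coderivation (\<lambda>h. h \<star> incl x \<oplus>\<^bsub>T\<^esub> h \<otimes>\<^bsub>T\<^esub> incl x)" (is "coderivation ?R")
    by (rule coderivation_sum[OF coderivation_ext[OF x] coderivation_right_mult[OF x]])
  have eq: "h \<bullet> incl x = ?R h" if "h \<in> carrier T" for h
    using that x by (rule circ_incl)
  have lin: "(\<lambda>h. h \<bullet> incl x) \<in> linear_map K T T" by (rule circ_left[OF incl_closed[OF x]])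
  \<comment> \<open>The functions \<open>h \<bullet> x\<close> and \<open>?R h\<close> are known to
    agree on the carrier only, so they cannot be rewritten under \<open>leibniz\<close>; the two
    operators are compared on pure tensors instead.\<close>
  have "leibniz (\<lambda>h. h \<bullet> incl x) X = leibniz ?R X" if "X \<in> carrier TT" for X
    by (rule TT.tensor_eqI[OF TT.tensor_module leibniz_linear[OF lin] leibniz_linear[OF coderivation_linear[OF c]] that])
      (simp add: leibniz_pure lin coderivation_linear[OF c] eq)
  then show ?thesis
    using lin coderivation_deshuffle[OF c] by (simp add: coderivation_def eq deshuffle_closed)
qed

text \<open>The map \<open>\<star> x\<close> kills 1, and on \<open>y h\<close> the derivation rule
  leaves two terms that each begin with a letter.\<close>

lemma counit_ext_incl:
  assumes "h \<in> carrier T" "x \<in> carrier V"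
  shows "tensor_counit (h \<star> incl x) = \<zero>\<^bsub>K\<^esub>"
  using assms(1)
proof (induction rule: left_induct)
  case (left y h)
  then show ?case
    using assms(2)
    by (simp add: ext_incl_derivation incl_closed ext_incl star_closed ext_closed counit_add counit_mult_incl)
qed (use assms(2) in \<open>simp_all add: one_ext_incl counit_zero incl_closed ext_closed counit_add counit_smult
    linear_map_add[OF ext_left] linear_map_smult[OF ext_left]
    linear_map_zero[OF tensor_algebra_module tensor_algebra_module ext_left]\<close>)

text \<open>The core of associativity: \<star> is a right action of \<bullet>, so far for a letter
  \<open>x\<close>. At \<open>f = 1\<close> both sides vanish because the counit kills
  \<open>g \<bullet> x\<close>; a factor \<open>y\<close> is added to \<open>f\<close> by
  \<open>ext_mult\<close>, with \<open>ext_letter\<close> responsible for \<open>y\<close>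
  itself.\<close>

lemma ext_ext_incl:
  assumes f: "f \<in> carrier T" and x: "x \<in> carrier V" and g: "g \<in> carrier T"
  shows "(f \<star> g) \<star> incl x = f \<star> (g \<bullet> incl x)"
proof -
  note ix = incl_closed[OF x]
  \<comment> \<open>\<open>g\<close> is quantified inside the induction, since the hypothesis for
    \<open>h\<close> is applied to the second tensor factors of \<Delta> g.\<close>
  have "\<forall>g\<in>carrier T. (f \<star> g) \<star> incl x = f \<star> (g \<bullet> incl x)"
    using f
  proof (induction rule: left_induct)
    case one
    show ?case
      using x
      by (simp add: ext_one_left circ_closed ix linear_map_smult[OF ext_left] counit_closed
          circ_incl counit_add ext_closed counit_mult_incl counit_ext_incl counit_incl)
  next
    case (left y h)
    show ?case
    proof
      fix g assume g: "g \<in> carrier T"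
      note iy = incl_closed[OF left(1)]
      let ?R = "\<lambda>h. h \<bullet> incl x"
      note R = coderivation_linear[OF coderivation_circ[OF x]]
      note b = ext_mult_bilinear[OF iy left(2)]
      let ?E = "tensor_lift K T (\<lambda>a b. (incl y \<star> a) \<otimes>\<^bsub>T\<^esub> (h \<star> b))"
      note E = TT.tensor_lift_linear[OF tensor_algebra_module b]
        and Ep = TT.tensor_lift_pure[OF tensor_algebra_module b]
      \<comment> \<open>This is \<open>ext_letter\<close> with the subtracted term moved to the
        other side: \<open>y \<star> (a x)\<close> and \<open>y \<star> (a \<star> x)\<close> add up
        to \<open>y \<star> (a \<bullet> x)\<close>.\<close>
      have ystep: "(incl y \<star> a) \<star> incl x = incl y \<star> (a \<bullet> incl x)" if a: "a \<in> carrier T" for a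
        using ext_letter[OF left(1) a x] a x iy ix
        by (simp add: circ_incl linear_map_add[OF ext_right] ext_closed T.M.minus_eq T.M.a_assoc T.M.l_neg
            T.M.a_comm[of "incl y \<star> (a \<star> incl x)"
              "incl y \<star> a \<star> incl x \<oplus>\<^bsub>T\<^esub> \<ominus>\<^bsub>T\<^esub> (incl y \<star> (a \<star> incl x))"])
      \<comment> \<open>On a pure tensor the derivation rule gives two summands;
        \<open>ystep\<close> and the induction hypothesis move \<open>\<bullet> x\<close> inside,
        one slot each. At \<open>X = \<Delta> g\<close> the coderivation property then turns
        \<open>leibniz ?R X\<close> into \<Delta> (g \<bullet> x).\<close>
      have "?E X \<star> incl x = ?E (leibniz ?R X)" if X: "X \<in> carrier TT" for X
        by (rule TT.tensor_eqI[OF tensor_algebra_module linear_map_compose[OF E ext_left[OF ix]]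
              linear_map_compose[OF leibniz_linear[OF R] E] X])
          (use x left(2,3) in \<open>simp add: Ep leibniz_pure[OF R] linear_map_add[OF E] TT.pure_closed circ_closed
            ix iy ext_incl_derivation ext_closed ystep\<close>)
      then show "(incl y \<otimes>\<^bsub>T\<^esub> h \<star> g) \<star> incl x = incl y \<otimes>\<^bsub>T\<^esub> h \<star> (g \<bullet> incl x)"
        using g x left(2) iy ix coderivation_deshuffle[OF coderivation_circ[OF x] g]
        by (simp add: ext_mult circ_closed deshuffle_closed)
    qed
  next
    case zero
    show ?case using ix linear_map_zero[OF tensor_algebra_module tensor_algebra_module ext_left]
      by (simp add: circ_closed)
  next
    case (add f f')
    then show ?case using ix by (simp add: circ_closed linear_map_add[OF ext_left] ext_closed)
  next
    case (smult c f)
    then show ?case using ix by (simp add: circ_closed linear_map_smult[OF ext_left] ext_closed)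
  qed
  then show ?thesis using g by blast
qed

text \<open>On \<open>p \<otimes> q\<close>, the product
  \<open>((f \<star> p) q) \<bullet> x\<close> expands to
  \<open>((f \<star> p) \<star> x) q + (f \<star> p) (q \<bullet> x)\<close>. By
  \<open>ext_ext_incl\<close> the first factor is \<open>f \<star> (p \<bullet> x)\<close>, so
  \<open>\<bullet> x\<close> acts on \<open>p \<otimes> q\<close> through \<open>leibniz\<close>,
  and it is a coderivation.\<close>

lemma circ_assoc_incl:
  assumes f: "f \<in> carrier T" and g: "g \<in> carrier T" and x: "x \<in> carrier V"
  shows "(f \<bullet> g) \<bullet> incl x = f \<bullet> (g \<bullet> incl x)"
proof -
  note ix = incl_closed[OF x]
  let ?R = "\<lambda>h. h \<bullet> incl x"
  note c = coderivation_circ[OF x]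
  note R = coderivation_linear[OF c]
  note b = circ_inner_bilinear[OF f]
  let ?E = "tensor_lift K T (\<lambda>a b. (f \<star> a) \<otimes>\<^bsub>T\<^esub> b)"
  note E = TT.tensor_lift_linear[OF tensor_algebra_module b]
    and Ep = TT.tensor_lift_pure[OF tensor_algebra_module b]
  have "?E X \<bullet> incl x = ?E (leibniz ?R X)" if X: "X \<in> carrier TT" for X
  proof (rule TT.tensor_eqI[OF tensor_algebra_module linear_map_compose[OF E R]
        linear_map_compose[OF leibniz_linear[OF R] E] X])
    fix p q assume pq: "p \<in> carrier T" "q \<in> carrier T"
    have "?E (pure2 p q) \<bullet> incl x = ((f \<star> p) \<star> incl x) \<otimes>\<^bsub>T\<^esub> q
        \<oplus>\<^bsub>T\<^esub> (f \<star> p) \<otimes>\<^bsub>T\<^esub> (q \<star> incl x \<oplus>\<^bsub>T\<^esub> q \<otimes>\<^bsub>T\<^esub> incl x)"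
      using pq f x ix
      by (simp add: Ep circ_incl ext_closed ext_incl_derivation T.m_assoc T.M.a_assoc T.r_distr)
    also have "\<dots> = (f \<star> (p \<bullet> incl x)) \<otimes>\<^bsub>T\<^esub> q \<oplus>\<^bsub>T\<^esub> (f \<star> p) \<otimes>\<^bsub>T\<^esub> (q \<bullet> incl x)"
      using pq f x by (simp add: ext_ext_incl circ_incl)
    also have "\<dots> = ?E (leibniz ?R (pure2 p q))"
      using pq ix by (simp add: leibniz_pure[OF R] linear_map_add[OF E] Ep TT.pure_closed circ_closed)
    finally show "?E (pure2 p q) \<bullet> incl x = ?E (leibniz ?R (pure2 p q))" .
  qed
  then show ?thesis
    using coderivation_deshuffle[OF c g] deshuffle_closed[OF g] by (simp add: circ_eq[of f])
qed

text \<open>The derivation rule replaces one letter of the word at a time by a letter, so the length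
  is preserved. The generated submodule is the homogeneous component; both the generation of T by
  \<bullet> and the recursion for the antipode rest on this.\<close>

lemma ext_incl_graded:
  assumes "w \<in> L" "x \<in> carrier V"
  shows "word w \<star> incl x \<in> generated_submodule K T (word ` {u \<in> L. length u = length w})"
  using assms(1)
proof (induction w)
  case Nil
  have "word ` {u \<in> L. length u = length []} \<subseteq> carrier T"
    by (rule image_subsetI) (simp add: word_closed)
  from subgroup.one_closed[OF submodule.axioms(1)[OF generated_submodule_submodule[OF tensor_algebra_module this]]]
  show ?case using assms(2) by (simp add: one_eq[symmetric] one_ext_incl)
next
  case (Cons y w)
  let ?G = "\<lambda>n. generated_submodule K T (word ` {u \<in> L. length u = n})"
  have sub: "word ` {u \<in> L. length u = n} \<subseteq> carrier T" for n
    by (rule image_subsetI) (simp add: word_closed)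
  note G = generated_submodule_submodule[OF tensor_algebra_module sub]
  have iy: "incl y \<in> carrier T" by (rule incl_closed[OF Cons.hyps(1)])
  note l = mult_right[OF iy]
  have step: "incl y \<otimes>\<^bsub>T\<^esub> f \<in> ?G (Suc n)" if "f \<in> ?G n" for f n
    using tensor_algebra_module sub that
  proof (induction rule: generated_submodule_induct)
    case (gen f)
    then obtain u where u: "f = word u" "u \<in> L" "length u = n" by auto
    then have "incl y \<otimes>\<^bsub>T\<^esub> f = word (y # u)" using Cons.hyps(1) by (simp add: incl_eq word_append)
    then show ?case using u Cons.hyps(1) by (auto intro!: subsetD[OF generated_submodule_subset] imageI)
  qed (simp_all add: iy T.r_distr T.smult_mult_right T.submoduleE(4,5)[OF G]
      subgroup.one_closed[OF submodule.axioms(1)[OF G], simplified])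
  have "word (y # w) \<star> incl x = word (star y x # w) \<oplus>\<^bsub>T\<^esub> incl y \<otimes>\<^bsub>T\<^esub> (word w \<star> incl x)"
    using ext_incl_derivation[OF iy word_closed[OF Cons.hyps(2)] assms(2)] Cons.hyps assms(2)
    by (simp add: ext_incl) (simp add: incl_eq word_append star_closed)
  moreover have "word (star y x # w) \<in> ?G (length (y # w))"
    using Cons.hyps assms(2) by (auto intro!: subsetD[OF generated_submodule_subset] imageI star_closed)
  ultimately show ?case using step[OF Cons.IH] T.submoduleE(5)[OF G] by simp
qed

text \<open>\<open>T\<close> is generated from \<open>1\<close> by the maps \<open>h \<mapsto> h \<bullet> x\<close>, because \<open>h x = h \<bullet> x - h \<star> x\<close> and
  \<open>h \<star> x\<close> is a combination of words of the length of \<open>h\<close>.\<close>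

lemma circ_induct [consumes 1, case_names one circ zero add smult]:
  assumes "X \<in> carrier T"
    and "P \<one>\<^bsub>T\<^esub>"
    and circ: "\<And>x h. \<lbrakk>x \<in> carrier V; h \<in> carrier T; P h\<rbrakk> \<Longrightarrow> P (h \<bullet> incl x)"
    and "P \<zero>\<^bsub>T\<^esub>"
    and "\<And>x y. \<lbrakk>x \<in> carrier T; y \<in> carrier T; P x; P y\<rbrakk> \<Longrightarrow> P (x \<oplus>\<^bsub>T\<^esub> y)"
    and "\<And>c x. \<lbrakk>c \<in> carrier K; x \<in> carrier T; P x\<rbrakk> \<Longrightarrow> P (c \<odot>\<^bsub>T\<^esub> x)"
  shows "P X"
  using assms(1)
proof (induction rule: tensor_algebra_induct)
  case (word w)
  \<comment> \<open>The induction takes all words of one length together: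
    \<open>word u \<star> incl x\<close> is a combination of words of the length of
    \<open>u\<close>, usually different from \<open>u\<close>.\<close>
  have "\<forall>w\<in>L. length w = n \<longrightarrow> P (word w)" for n
  proof (induction n)
    case 0
    then show ?case using assms(2) by (simp add: one_eq)
  next
    case (Suc n)
    show ?case
    proof (intro ballI impI)
      fix w assume w: "w \<in> L" "length w = Suc n"
      then obtain u x where ux: "w = u @ [x]" by (metis length_Suc_conv_rev)
      then have u: "u \<in> L" "length u = n" and x: "x \<in> carrier V" using w by auto
      note wu = word_closed[OF u(1)] and ix = incl_closed[OF x]
      have sub: "word ` {v \<in> L. length v = n} \<subseteq> carrier T"
        by (rule image_subsetI) (simp add: word_closed)
      have "P (word u \<star> incl x)"
        using tensor_algebra_module sub ext_incl_graded[OF u(1) x, unfolded u(2)]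
        by (rule generated_submodule_induct) (use Suc assms(4-6) in auto)
      then have D: "P ((\<ominus>\<^bsub>K\<^esub> \<one>\<^bsub>K\<^esub>) \<odot>\<^bsub>T\<^esub> (word u \<star> incl x))"
        using wu ix by (intro assms(6)) (auto intro: ext_closed)
      have "P (word u \<bullet> incl x)" using Suc u x wu by (intro circ) auto
      then have "P (word u \<bullet> incl x \<oplus>\<^bsub>T\<^esub> (\<ominus>\<^bsub>K\<^esub> \<one>\<^bsub>K\<^esub>) \<odot>\<^bsub>T\<^esub> (word u \<star> incl x))"
        using D wu ix by (intro assms(5)) (auto intro: ext_closed circ_closed)
      moreover have "word u \<bullet> incl x \<oplus>\<^bsub>T\<^esub> (\<ominus>\<^bsub>K\<^esub> \<one>\<^bsub>K\<^esub>) \<odot>\<^bsub>T\<^esub> (word u \<star> incl x) = word u \<otimes>\<^bsub>T\<^esub> incl x"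
        using wu x ix
        by (simp add: circ_incl T.smult_l_minus ext_closed T.M.a_assoc T.M.r_neg
            T.M.a_comm[of "word u \<star> incl x" "word u \<otimes>\<^bsub>T\<^esub> incl x"])
      moreover have "word u \<otimes>\<^bsub>T\<^esub> incl x = word w" using u x by (simp add: ux incl_eq word_append)
      ultimately show "P (word w)" by simp
    qed
  qed
  then show ?case using word by blast
qed fact+

lemma linear_eqI_circ:
  assumes P: "Module.module K P" and f: "f \<in> linear_map K T P" and g: "g \<in> linear_map K T P"
    and X: "X \<in> carrier T"
    and "f \<one>\<^bsub>T\<^esub> = g \<one>\<^bsub>T\<^esub>"
    and "\<And>x h. \<lbrakk>x \<in> carrier V; h \<in> carrier T; f h = g h\<rbrakk> \<Longrightarrow> f (h \<bullet> incl x) = g (h \<bullet> incl x)"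
  shows "f X = g X"
  using X
  by (induction rule: circ_induct)
    (simp_all add: assms(5,6) linear_map_add[OF f] linear_map_add[OF g] linear_map_smult[OF f]
      linear_map_smult[OF g] linear_map_zero[OF tensor_algebra_module P f] linear_map_zero[OF tensor_algebra_module P g])

text \<open>In the induction on \<open>h\<close>, \<open>circ_assoc_incl\<close> moves the letter
  \<open>x\<close> of \<open>h \<bullet> x\<close> outwards on both sides:
  \<open>((f \<bullet> g) \<bullet> h) \<bullet> x\<close> and
  \<open>(f \<bullet> (g \<bullet> h)) \<bullet> x\<close> remain.\<close>

lemma circ_assoc:
  assumes f: "f \<in> carrier T" and g: "g \<in> carrier T" and h: "h \<in> carrier T"
  shows "(f \<bullet> g) \<bullet> h = f \<bullet> (g \<bullet> h)"
  by (rule linear_eqI_circ[OF tensor_algebra_module circ_right linear_map_compose[OF circ_right circ_right] h])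
    (use f g in \<open>simp_all add: circ_closed circ_one_right circ_assoc_incl[symmetric] incl_closed\<close>)


section \<open>The antipode\<close>

definition antipode_step where
  "antipode_step A x h = \<ominus>\<^bsub>T\<^esub> (incl x \<bullet> A h \<oplus>\<^bsub>T\<^esub> A (h \<star> incl x))"

text \<open>The antipode \<open>S\<close> has to satisfy \<open>S (h \<bullet> x) = - x \<bullet> S h\<close>, that is,
  \<open>S (h x) = - (x \<bullet> S h + S (h \<star> x))\<close>. Since \<open>h \<star> x\<close> has the degree of \<open>h\<close>, this determines \<open>S\<close>
  degree by degree; \<open>antipode_degree n\<close> is linear on all of \<open>T\<close>, but only its values on words of
  length \<open>n\<close> are meaningful.\<close>

primrec antipode_degree :: "nat \<Rightarrow> ('v list \<Rightarrow> 'k) set \<Rightarrow> ('v list \<Rightarrow> 'k) set" where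
  "antipode_degree 0 = (\<lambda>X. tensor_counit X \<odot>\<^bsub>T\<^esub> \<one>\<^bsub>T\<^esub>)"
| "antipode_degree (Suc n) = (\<lambda>X. the_elem (free_lift K T (\<lambda>w. if w = [] then \<zero>\<^bsub>T\<^esub>
      else antipode_step (antipode_degree n) (last w) (word (butlast w))) ` X))"

definition antipode :: "('v list \<Rightarrow> 'k) set \<Rightarrow> ('v list \<Rightarrow> 'k) set" where
  "antipode X = the_elem (free_lift K T (\<lambda>w. antipode_degree (length w) (word w)) ` X)"

lemma antipode_step_bilinear:
  assumes "A \<in> linear_map K T T"
  shows "bilinear_map K V T T (antipode_step A)"
proof (rule bilinear_mapI_linear)
  fix x assume x: "x \<in> carrier V"
  show "(\<lambda>h. antipode_step A x h) \<in> linear_map K T T"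
    unfolding antipode_step_def
    by (intro linear_map_neg linear_map_sum tensor_algebra_module linear_map_compose[OF assms circ_right]
        linear_map_compose[OF ext_left assms] incl_closed x)
next
  fix h assume h: "h \<in> carrier T"
  show "(\<lambda>x. antipode_step A x h) \<in> linear_map K V T"
    unfolding antipode_step_def
    by (intro linear_map_neg linear_map_sum tensor_algebra_module linear_map_compose[OF incl_linear]
        linear_map_compose[OF incl_linear circ_left] linear_map_compose[OF ext_right assms] h linear_map_closed[OF assms])
qed

text \<open>The value 0 at the empty word is a mere default in the carrier. If the varying letter is
  the last one, linearity of the step in its letter applies; otherwise the variation sits inside
  \<open>word (butlast w)\<close>, where \<open>word_multilinear\<close> handles it.\<close>

lemma antipode_step_multilinear:
  assumes "A \<in> linear_map K T T"
  shows "multilinear T (\<lambda>w. if w = [] then \<zero>\<^bsub>T\<^esub> else antipode_step A (last w) (word (butlast w)))"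
    (is "multilinear T ?\<phi>")
proof -
  note b = antipode_step_bilinear[OF assms]
  note l = bilinear_map_left[OF b] and r = bilinear_map_right[OF b]
  have last: "?\<phi> (u @ [x]) = antipode_step A x (word u)" for u x by simp
  have "?\<phi> w \<in> carrier T" if "w \<in> L" for w
    using that by (cases w rule: rev_cases) (auto simp: last intro!: bilinear_map_closed[OF b] word_closed)
  moreover have "?\<phi> (u @ [c \<odot>\<^bsub>V\<^esub> x \<oplus>\<^bsub>V\<^esub> d \<odot>\<^bsub>V\<^esub> y] @ w)
      = c \<odot>\<^bsub>T\<^esub> ?\<phi> (u @ [x] @ w) \<oplus>\<^bsub>T\<^esub> d \<odot>\<^bsub>T\<^esub> ?\<phi> (u @ [y] @ w)"
    if m: "u \<in> L" "w \<in> L" "c \<in> carrier K" "d \<in> carrier K" "x \<in> carrier V" "y \<in> carrier V" for u w c d x y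
  proof (cases w rule: rev_cases)
    case Nil
    then show ?thesis using m word_closed[OF m(1)]
      by (simp add: linear_map_add[OF l] linear_map_smult[OF l])
  next
    case (snoc w' z)
    then have w': "w' \<in> L" and z: "z \<in> carrier V" using m by auto
    have wc: "word (u @ [x] @ w') \<in> carrier T" "word (u @ [y] @ w') \<in> carrier T"
      by (rule word_closed, use m w' in simp)+
    have "?\<phi> (u @ [p] @ w) = antipode_step A z (word (u @ [p] @ w'))" for p
      using last[of "u @ [p] @ w'" z] by (simp add: snoc)
    then show ?thesis
      using word_multilinear[OF m(1) w' m(3-6)] wc m(3,4)
      by (simp only:) (simp only: linear_map_add[OF r] linear_map_smult[OF r] z T.smult_closed)
  qed
  ultimately show ?thesis unfolding multilinear_def by blast
qed

lemma antipode_degree_linear: "antipode_degree n \<in> linear_map K T T"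
proof (induction n)
  case 0
  then show ?case
    by (auto intro: linear_map_smult_vector tensor_algebra_module counit_linear)
next
  case (Suc n)
  then show ?case
    using multilinear_lift(1)[OF tensor_algebra_module antipode_step_multilinear] by simp
qed

lemma antipode_degree_word:
  assumes "w \<in> L" "x \<in> carrier V"
  shows "antipode_degree (Suc n) (word (w @ [x])) = antipode_step (antipode_degree n) x (word w)"
  using multilinear_lift(2)[OF tensor_algebra_module antipode_step_multilinear[OF antipode_degree_linear],
      of "w @ [x]" n] assms by simp

text \<open>The degrees can be glued because the three words of a relation have the same length: one
  and the same linear map \<open>antipode_degree n\<close> is applied to all of them.\<close>

lemma antipode_multilinear: "multilinear T (\<lambda>w. antipode_degree (length w) (word w))"
proof -
  have "antipode_degree (length (u @ [c \<odot>\<^bsub>V\<^esub> x \<oplus>\<^bsub>V\<^esub> d \<odot>\<^bsub>V\<^esub> y] @ w)) (word (u @ [c \<odot>\<^bsub>V\<^esub> x \<oplus>\<^bsub>V\<^esub> d \<odot>\<^bsub>V\<^esub> y] @ w))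
      = c \<odot>\<^bsub>T\<^esub> antipode_degree (length (u @ [x] @ w)) (word (u @ [x] @ w))
        \<oplus>\<^bsub>T\<^esub> d \<odot>\<^bsub>T\<^esub> antipode_degree (length (u @ [y] @ w)) (word (u @ [y] @ w))"
    if m: "u \<in> L" "w \<in> L" "c \<in> carrier K" "d \<in> carrier K" "x \<in> carrier V" "y \<in> carrier V" for u w c d x y
  proof -
    have wc: "word (u @ [x] @ w) \<in> carrier T" "word (u @ [y] @ w) \<in> carrier T"
      by (rule word_closed, use m in simp)+
    have len: "length (u @ [p] @ w) = Suc (length u + length w)" for p by simp
    note A = antipode_degree_linear[of "Suc (length u + length w)"]
    show ?thesis
      unfolding word_multilinear[OF m] len using wc m(3,4)
      by (simp only: linear_map_add[OF A] linear_map_smult[OF A] T.smult_closed)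
  qed
  then show ?thesis
    unfolding multilinear_def using linear_map_closed[OF antipode_degree_linear word_closed] by blast
qed

lemma antipode_linear: "antipode \<in> linear_map K T T"
  unfolding antipode_def[abs_def] by (rule multilinear_lift(1)[OF tensor_algebra_module antipode_multilinear])

lemma antipode_word: "w \<in> L \<Longrightarrow> antipode (word w) = antipode_degree (length w) (word w)"
  unfolding antipode_def by (rule multilinear_lift(2)[OF tensor_algebra_module antipode_multilinear])

lemma antipode_closed: "h \<in> carrier T \<Longrightarrow> antipode h \<in> carrier T"
  by (rule linear_map_closed[OF antipode_linear])

lemma antipode_one: "antipode \<one>\<^bsub>T\<^esub> = \<one>\<^bsub>T\<^esub>"
  using antipode_word[of "[]"] by (simp add: one_eq[symmetric] counit_one)

text \<open>The recursion of \<open>antipode_degree\<close>, now for the glued map. The delicate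
  term is the antipode of \<open>word w \<star> incl x\<close>: by \<open>ext_incl_graded\<close>
  this element has degree \<open>length w\<close>, where the glued map and
  \<open>antipode_degree (length w)\<close> agree.\<close>

lemma antipode_mult_incl:
  assumes x: "x \<in> carrier V" and h: "h \<in> carrier T"
  shows "antipode (h \<otimes>\<^bsub>T\<^esub> incl x) = antipode_step antipode x h"
proof (rule tensor_algebra_eqI[OF tensor_algebra_module
      linear_map_compose[OF mult_left[OF incl_closed[OF x]] antipode_linear]
      bilinear_map_right[OF antipode_step_bilinear[OF antipode_linear] x] h])
  fix w assume w: "w \<in> L"
  have sub: "word ` {u \<in> L. length u = length w} \<subseteq> carrier T"
    by (rule image_subsetI) (simp add: word_closed)
  have eq: "antipode (word w \<star> incl x) = antipode_degree (length w) (word w \<star> incl x)"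
    by (rule linear_map_eq_on_generated[OF tensor_algebra_module tensor_algebra_module sub antipode_linear
          antipode_degree_linear _ ext_incl_graded[OF w x]])
      (erule imageE, simp add: antipode_word)
  have "antipode (word w \<otimes>\<^bsub>T\<^esub> incl x) = antipode_degree (Suc (length w)) (word (w @ [x]))"
    using w x by (simp add: incl_eq word_append antipode_word del: antipode_degree.simps)
  also have "\<dots> = antipode_step antipode x (word w)"
    unfolding antipode_degree_word[OF w x] by (simp add: antipode_step_def antipode_word[OF w] eq)
  finally show "antipode (word w \<otimes>\<^bsub>T\<^esub> incl x) = antipode_step antipode x (word w)" .
qed

text \<open>The step was designed for this: the summand for \<open>h \<star> x\<close> in
  \<open>h \<bullet> x\<close> cancels against the correction term of
  \<open>antipode_step\<close>.\<close>

lemma antipode_circ_incl: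
  assumes x: "x \<in> carrier V" and h: "h \<in> carrier T"
  shows "antipode (h \<bullet> incl x) = \<ominus>\<^bsub>T\<^esub> (incl x \<bullet> antipode h)"
proof -
  have c: "incl x \<bullet> antipode h \<in> carrier T" "antipode (h \<star> incl x) \<in> carrier T"
    using x h by (auto intro: circ_closed antipode_closed incl_closed ext_closed)
  have "antipode (h \<bullet> incl x) = antipode (h \<star> incl x) \<oplus>\<^bsub>T\<^esub> antipode_step antipode x h"
    using x h by (simp add: circ_incl linear_map_add[OF antipode_linear] ext_closed incl_closed antipode_mult_incl)
  also have "\<dots> = \<ominus>\<^bsub>T\<^esub> (incl x \<bullet> antipode h)"
    using c by (simp add: antipode_step_def T.M.minus_add T.M.a_assoc T.M.r_neg T.M.l_neg
        T.M.a_lcomm[of "antipode (h \<star> incl x)"])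
  finally show ?thesis .
qed

lemma counit_circ_incl: "\<lbrakk>h \<in> carrier T; x \<in> carrier V\<rbrakk> \<Longrightarrow> tensor_counit (h \<bullet> incl x) = \<zero>\<^bsub>K\<^esub>"
  by (simp add: circ_incl counit_add ext_closed incl_closed counit_ext_incl counit_mult_incl)

lemma counit_smult_one_linear: "(\<lambda>h. tensor_counit h \<odot>\<^bsub>T\<^esub> \<one>\<^bsub>T\<^esub>) \<in> linear_map K T T"
  by (auto intro: linear_map_smult_vector tensor_algebra_module counit_linear)

text \<open>Passing from \<open>h\<close> to \<open>h \<bullet> x\<close> turns the value
  \<open>E\<close> at \<open>h\<close> into \<open>- x \<bullet> E + E \<bullet> x\<close>. By
  induction \<open>E\<close> is a multiple of 1, so this vanishes, as does the counit of
  \<open>h \<bullet> x\<close>.\<close>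

lemma antipode_left:
  assumes h: "h \<in> carrier T"
  shows "tensor_lift K T (\<lambda>a b. antipode a \<bullet> b) (\<Delta> h) = tensor_counit h \<odot>\<^bsub>T\<^esub> \<one>\<^bsub>T\<^esub>"
proof -
  have b: "bilinear_map K T T T (\<lambda>a b. antipode a \<bullet> b)"
    by (rule bilinear_map_compose[OF circ_bilinear antipode_linear linear_map_id])
  let ?E = "tensor_lift K T (\<lambda>a b. antipode a \<bullet> b)"
  note E = TT.tensor_lift_linear[OF tensor_algebra_module b]
    and Ep = TT.tensor_lift_pure[OF tensor_algebra_module b]
  show ?thesis
  proof (rule linear_eqI_circ[OF tensor_algebra_module linear_map_compose[OF deshuffle_linear E]
        counit_smult_one_linear h])
    show "?E (\<Delta> \<one>\<^bsub>T\<^esub>) = tensor_counit \<one>\<^bsub>T\<^esub> \<odot>\<^bsub>T\<^esub> \<one>\<^bsub>T\<^esub>"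
      by (simp add: deshuffle_one Ep antipode_one circ_one_left counit_one)
  next
    fix x h assume x: "x \<in> carrier V" and h: "h \<in> carrier T" and IH: "?E (\<Delta> h) = tensor_counit h \<odot>\<^bsub>T\<^esub> \<one>\<^bsub>T\<^esub>"
    note ix = incl_closed[OF x] and c = coderivation_circ[OF x]
    note R = coderivation_linear[OF c] and cr = circ_right[OF ix] and cl = circ_left[OF ix]
    have "?E (leibniz (\<lambda>h. h \<bullet> incl x) X) = \<ominus>\<^bsub>T\<^esub> (incl x \<bullet> ?E X) \<oplus>\<^bsub>T\<^esub> ?E X \<bullet> incl x" if X: "X \<in> carrier TT" for X
      by (rule TT.tensor_eqI[OF tensor_algebra_module linear_map_compose[OF leibniz_linear[OF R] E]
            linear_map_sum[OF tensor_algebra_module linear_map_neg[OF tensor_algebra_module linear_map_compose[OF E cr]]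
              linear_map_compose[OF E cl]] X])
        (use x ix in \<open>simp add: leibniz_pure[OF R] linear_map_add[OF E] Ep TT.pure_closed circ_closed antipode_closed
          antipode_circ_incl linear_map_uminus[OF tensor_algebra_module tensor_algebra_module circ_left] circ_assoc\<close>)
    then have "?E (\<Delta> (h \<bullet> incl x)) = \<ominus>\<^bsub>T\<^esub> (incl x \<bullet> ?E (\<Delta> h)) \<oplus>\<^bsub>T\<^esub> ?E (\<Delta> h) \<bullet> incl x"
      using coderivation_deshuffle[OF c h] deshuffle_closed[OF h] by simp
    also have "\<dots> = \<zero>\<^bsub>T\<^esub>"
      using ix h by (simp add: IH linear_map_smult[OF cr] linear_map_smult[OF cl] counit_closed
          circ_one_left circ_one_right T.M.l_neg)
    also have "\<dots> = tensor_counit (h \<bullet> incl x) \<odot>\<^bsub>T\<^esub> \<one>\<^bsub>T\<^esub>"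
      using h x by (simp add: counit_circ_incl)
    finally show "?E (\<Delta> (h \<bullet> incl x)) = tensor_counit (h \<bullet> incl x) \<odot>\<^bsub>T\<^esub> \<one>\<^bsub>T\<^esub>" .
  qed
qed

text \<open>Here the cancellation takes place on each pure tensor:
  \<open>(a \<bullet> x) \<bullet> S b\<close> and \<open>a \<bullet> S (b \<bullet> x) = - a
  \<bullet> (x \<bullet> S b)\<close> add up to 0 by associativity.\<close>

lemma antipode_right:
  assumes h: "h \<in> carrier T"
  shows "tensor_lift K T (\<lambda>a b. a \<bullet> antipode b) (\<Delta> h) = tensor_counit h \<odot>\<^bsub>T\<^esub> \<one>\<^bsub>T\<^esub>"
proof -
  have b: "bilinear_map K T T T (\<lambda>a b. a \<bullet> antipode b)"
    by (rule bilinear_map_compose[OF circ_bilinear linear_map_id antipode_linear])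
  let ?E = "tensor_lift K T (\<lambda>a b. a \<bullet> antipode b)"
  note E = TT.tensor_lift_linear[OF tensor_algebra_module b]
    and Ep = TT.tensor_lift_pure[OF tensor_algebra_module b]
  show ?thesis
  proof (rule linear_eqI_circ[OF tensor_algebra_module linear_map_compose[OF deshuffle_linear E]
        counit_smult_one_linear h])
    show "?E (\<Delta> \<one>\<^bsub>T\<^esub>) = tensor_counit \<one>\<^bsub>T\<^esub> \<odot>\<^bsub>T\<^esub> \<one>\<^bsub>T\<^esub>"
      by (simp add: deshuffle_one Ep antipode_one circ_one_left counit_one)
  next
    fix x h assume x: "x \<in> carrier V" and h: "h \<in> carrier T"
    note ix = incl_closed[OF x] and c = coderivation_circ[OF x]
    note R = coderivation_linear[OF c]
    have "?E (leibniz (\<lambda>h. h \<bullet> incl x) X) = \<zero>\<^bsub>T\<^esub>" if X: "X \<in> carrier TT" for X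
      by (rule TT.tensor_eqI[OF tensor_algebra_module linear_map_compose[OF leibniz_linear[OF R] E] _ X])
        (use x ix in \<open>auto intro!: linear_mapI simp: leibniz_pure[OF R] linear_map_add[OF E] Ep TT.pure_closed
          circ_closed antipode_closed antipode_circ_incl circ_assoc T.M.r_neg
          linear_map_uminus[OF tensor_algebra_module tensor_algebra_module circ_right]\<close>)
    then have "?E (\<Delta> (h \<bullet> incl x)) = \<zero>\<^bsub>T\<^esub>"
      using coderivation_deshuffle[OF c h] deshuffle_closed[OF h] by simp
    also have "\<dots> = tensor_counit (h \<bullet> incl x) \<odot>\<^bsub>T\<^esub> \<one>\<^bsub>T\<^esub>"
      using h x by (simp add: counit_circ_incl)
    finally show "?E (\<Delta> (h \<bullet> incl x)) = tensor_counit (h \<bullet> incl x) \<odot>\<^bsub>T\<^esub> \<one>\<^bsub>T\<^esub>" .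
  qed
qed

section \<open>The Hopf algebra\<close>

text \<open>By associativity \<open>f \<bullet> (h \<bullet> x)\<close> is again a product with a
  letter on the right, and the counit kills all of these.\<close>

lemma counit_circ:
  assumes f: "f \<in> carrier T" and g: "g \<in> carrier T"
  shows "tensor_counit (f \<bullet> g) = tensor_counit f \<otimes>\<^bsub>K\<^esub> tensor_counit g"
  using g
proof (induction rule: circ_induct)
  case (circ x h)
  have "tensor_counit (f \<bullet> (h \<bullet> incl x)) = tensor_counit ((f \<bullet> h) \<bullet> incl x)"
    using f circ by (simp add: circ_assoc_incl)
  then show ?case using f circ by (simp add: counit_circ_incl circ_closed counit_closed)
qed (use f in \<open>simp_all add: circ_one_right counit_one counit_closed counit_zero counit_add counit_smult
   circ_closed linear_map_add[OF circ_right] linear_map_smult[OF circ_right] V.R.r_distr V.R.m_lcomm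
   linear_map_zero[OF tensor_algebra_module tensor_algebra_module circ_right]\<close>)

abbreviation "H \<equiv> T\<lparr>mult := circledast K V ext\<rparr>"
abbreviation "HH \<equiv> tensor_product K H H"

lemma H_module: "Module.module K H"
  by (rule module_cong[OF tensor_algebra_module]) simp_all

lemma H_assoc_algebra: "assoc_algebra K H"
proof -
  interpret H: Module.module K H by (rule H_module)
  have "ring H"
    by (intro ringI H.abelian_group_axioms monoidI)
      (auto simp: circ_closed circ_assoc circ_one_left circ_one_right linear_map_add[OF circ_left]
        linear_map_add[OF circ_right])
  then show ?thesis
    by (intro assoc_algebra.intro assoc_algebra_axioms.intro H_module)
      (auto simp: linear_map_smult[OF circ_left] linear_map_smult[OF circ_right])
qed

text \<open>The tensor square and cube of \<open>H\<close> are those of T up to \<open>mult\<close>.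
  The coalgebra axioms use the module structure only, so they are inherited from T.\<close>

lemma HH_eq: "HH = TT\<lparr>mult := mult HH\<rparr>" and HHH_eq: "\<exists>m. tensor_product K H HH = TTT\<lparr>mult := m\<rparr>"
  using tensor_product_update by metis+

lemma H_coalgebra: "coalgebra K H \<Delta> tensor_counit"
proof -
  obtain m where m: "HH = TT\<lparr>mult := m\<rparr>" using HH_eq by blast
  obtain m' where m': "tensor_product K H (TT\<lparr>mult := m\<rparr>) = TTT\<lparr>mult := m'\<rparr>"
    using HHH_eq unfolding m by blast
  show ?thesis
    by (intro coalgebra.intro coalgebra_axioms.intro H_module)
      (simp_all add: m m' deshuffle_linear counit_linear deshuffle_coassoc deshuffle_counit_left deshuffle_counit_right)
qed

text \<open>As functions of \<open>g\<close> both sides agree at 1 and obey one recursion: replacing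
  \<open>g\<close> by \<open>g \<bullet> x\<close> applies \<open>leibniz\<close> of
  \<open>\<bullet> x\<close>. On the right-hand side this is \<open>step\<close> below.\<close>

lemma deshuffle_circ:
  assumes f: "f \<in> carrier T" and g: "g \<in> carrier T"
  shows "\<Delta> (f \<bullet> g) = \<Delta> f \<otimes>\<^bsub>HH\<^esub> \<Delta> g"
proof -
  interpret HH: two_modules K H H by (intro two_modules.intro H_module)
  have b: "bilinear_map K H H H (mult H)" using circ_bilinear by (simp add: bilinear_map_def)
  have lin: "linear_map K HH HH = linear_map K TT TT"
    using HH_eq linear_map_update by metis
  have car: "carrier HH = carrier TT" by (subst HH_eq) simp
  have M: "bilinear_map K TT TT TT (mult HH)"
    using HH.tensor_mult_bilinear[OF b b] by (simp add: bilinear_map_def lin car)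
  note Ml = bilinear_map_left[OF M] and Mr = bilinear_map_right[OF M]
  have Mp: "pure2 a b \<otimes>\<^bsub>HH\<^esub> pure2 c d = pure2 (a \<bullet> c) (b \<bullet> d)"
    if "a \<in> carrier T" "b \<in> carrier T" "c \<in> carrier T" "d \<in> carrier T" for a b c d
    using HH.tensor_mult_pure[OF b b, of a b c d] that by simp
  have one: "X \<otimes>\<^bsub>HH\<^esub> pure2 \<one>\<^bsub>T\<^esub> \<one>\<^bsub>T\<^esub> = X" if X: "X \<in> carrier TT" for X
    by (rule TT.tensor_eqI[OF TT.tensor_module Ml linear_map_id X])
      (simp_all add: Mp TT.pure_closed circ_one_right)
  \<comment> \<open>Right multiplication by \<open>x\<close> in either slot commutes with left
    multiplication by \<open>X\<close>. On pure tensors this is associativity of \<bullet> in that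
    slot; \<open>Y\<close> is reduced to pure tensors for pure \<open>X\<close> first, then
    \<open>X\<close>.\<close>
  have step: "leibniz (\<lambda>h. h \<bullet> incl x) (X \<otimes>\<^bsub>HH\<^esub> Y) = X \<otimes>\<^bsub>HH\<^esub> leibniz (\<lambda>h. h \<bullet> incl x) Y"
    if x: "x \<in> carrier V" and X: "X \<in> carrier TT" and Y: "Y \<in> carrier TT" for x X Y
  proof -
    note ix = incl_closed[OF x]
    note R = circ_left[OF ix]
    note D = leibniz_linear[OF R]
    have 1: "leibniz (\<lambda>h. h \<bullet> incl x) (pure2 a b \<otimes>\<^bsub>HH\<^esub> Y) = pure2 a b \<otimes>\<^bsub>HH\<^esub> leibniz (\<lambda>h. h \<bullet> incl x) Y"
      if ab: "a \<in> carrier T" "b \<in> carrier T" for a b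
    proof -
      note ab' = TT.pure_closed[OF ab]
      show ?thesis
        by (rule TT.tensor_eqI[OF TT.tensor_module linear_map_compose[OF Mr[OF ab'] D]
              linear_map_compose[OF D Mr[OF ab']] Y])
          (use ab ix in \<open>simp add: Mp leibniz_pure[OF R] linear_map_add[OF Mr] TT.pure_closed circ_closed circ_assoc\<close>)
    qed
    show ?thesis
      by (rule TT.tensor_eqI[OF TT.tensor_module linear_map_compose[OF Ml[OF Y] D]
            Ml[OF linear_map_closed[OF D Y]] X 1])
  qed
  show ?thesis
  proof (rule linear_eqI_circ[OF TT.tensor_module linear_map_compose[OF circ_right[OF f] deshuffle_linear]
        linear_map_compose[OF deshuffle_linear Mr[OF deshuffle_closed[OF f]]] g])
    show "\<Delta> (f \<bullet> \<one>\<^bsub>T\<^esub>) = \<Delta> f \<otimes>\<^bsub>HH\<^esub> \<Delta> \<one>\<^bsub>T\<^esub>"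
      using f by (simp add: circ_one_right deshuffle_one one deshuffle_closed)
  next
    fix x h assume x: "x \<in> carrier V" and h: "h \<in> carrier T" and IH: "\<Delta> (f \<bullet> h) = \<Delta> f \<otimes>\<^bsub>HH\<^esub> \<Delta> h"
    note c = coderivation_deshuffle[OF coderivation_circ[OF x]]
    show "\<Delta> (f \<bullet> (h \<bullet> incl x)) = \<Delta> f \<otimes>\<^bsub>HH\<^esub> \<Delta> (h \<bullet> incl x)"
      using f x h by (simp add: circ_assoc_incl[symmetric] c circ_closed IH step deshuffle_closed)
  qed
qed

lemma H_hopf_algebra: "hopf_algebra K H \<Delta> tensor_counit"
proof (intro hopf_algebra.intro hopf_algebra_axioms.intro bialgebra.intro bialgebra_axioms.intro
    H_assoc_algebra H_coalgebra)
  obtain m where m: "HH = TT\<lparr>mult := m\<rparr>" using HH_eq by blast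
  have "\<Delta> \<in> linear_map K H HH" unfolding m by (simp add: deshuffle_linear)
  moreover have "\<Delta> \<in> ring_hom H HH"
  proof (rule ring_hom_memI)
    show "\<Delta> x \<in> carrier HH" if "x \<in> carrier H" for x
      using that by (simp add: m deshuffle_closed)
    show "\<Delta> (x \<otimes>\<^bsub>H\<^esub> y) = \<Delta> x \<otimes>\<^bsub>HH\<^esub> \<Delta> y" if "x \<in> carrier H" "y \<in> carrier H" for x y
      using that deshuffle_circ by simp
    show "\<Delta> (x \<oplus>\<^bsub>H\<^esub> y) = \<Delta> x \<oplus>\<^bsub>HH\<^esub> \<Delta> y" if "x \<in> carrier H" "y \<in> carrier H" for x y
      using that by (simp add: m linear_map_add[OF deshuffle_linear])
    show "\<Delta> \<one>\<^bsub>H\<^esub> = \<one>\<^bsub>HH\<^esub>" by (simp add: m deshuffle_one TT_one)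
  qed
  ultimately show "\<Delta> \<in> algebra_hom K H HH" by (simp add: algebra_hom_def)
  have "tensor_counit \<in> ring_hom H (base_module K)"
    by (rule ring_hom_memI) (simp_all add: base_module_def counit_closed counit_circ counit_add counit_one)
  then show "tensor_counit \<in> algebra_hom K H (base_module K)"
    by (simp add: algebra_hom_def counit_linear)
  show "\<exists>S\<in>linear_map K H H. \<forall>h\<in>carrier H.
      tensor_lift K H (\<lambda>x y. S x \<otimes>\<^bsub>H\<^esub> y) (\<Delta> h) = tensor_counit h \<odot>\<^bsub>H\<^esub> \<one>\<^bsub>H\<^esub> \<and>
      tensor_lift K H (\<lambda>x y. x \<otimes>\<^bsub>H\<^esub> S y) (\<Delta> h) = tensor_counit h \<odot>\<^bsub>H\<^esub> \<one>\<^bsub>H\<^esub>"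
    using antipode_linear antipode_left antipode_right by (intro bexI[of _ antipode]) simp_all
qed

end

theorem theorem1:
  fixes K :: "('k, 'r) ring_scheme"
    and V :: "('k, 'v, 'm) module_scheme"
    and star :: "'v \<Rightarrow> 'v \<Rightarrow> 'v"
    and ext :: "('v list \<Rightarrow> 'k) set \<Rightarrow> ('v list \<Rightarrow> 'k) set \<Rightarrow> ('v list \<Rightarrow> 'k) set"
  assumes "field K" and "Module.module K V"
    and "bilinear_map K V V V star"
    and "product_extension K V star ext"
  shows "hopf_algebra K ((tensor_algebra K V)\<lparr>mult := circledast K V ext\<rparr>)
    (deshuffle K V) tensor_counit"
proof -
  interpret extended_product K V star ext
    using assms(2-4)
    by (intro extended_product.intro extended_product_axioms.intro tensor_algebra_over.intro)
  show ?thesis by (rule H_hopf_algebra)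
qed

end
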